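(* The system $\mathsf{ACA}_0^\omega+\Sigma\text{-}\mathsf{IND}$ proves that $\mathsf{ENC}^\omega$ implies $\mathsf{HBT}$, where $\mathsf{HBT}$ is the following version of Cousin's lemma: for any $\psi:[0,1]\to\mathbb R^+\cup\{0\}$ such that $(\forall x\in[0,1])(\exists y\in[0,1])(x\in B(y,\psi(y)))$, there are $x_0,\dots,x_m\in[0,1]$ with $[0,1]\subseteq\bigcup_{i\le m}B(x_i,\psi(x_i))$.
   Context: Framework. $\mathsf{RCA}_0^\omega$ is Kohlenbach's base theory of higher-order reverse mathematics: the classical theory in the language of all finite types (type $0$ is $\mathbb N$, type $1$ is $\mathbb N^{\mathbb N}$, type $2$ is $\mathbb N^{\mathbb N}\to\mathbb N$, etc.) with the basic axioms of arithmetic, quantifier-free induction, the defining axioms of the typed combinators ($\lambda$-abstraction) and of primitive recursion at type $0$ only, the axiom of extensionality at all types, and $\mathsf{QF}\text{-}\mathsf{AC}^{1,0}$: for quantifier-free $\varphi$, $(\forall f\in\mathbb N^{\mathbb N})(\exists n\in\mathbb N)\varphi(f,n)\to(\exists Y:\mathbb N^{\mathbb N}\to\mathbb N)(\forall f)\varphi(f,Y(f))$. $\mathsf{ACA}_0^\omega$ is $\mathsf{RCA}_0^\omega$ plus $(\exists^2)$: there is $E:\mathbb N^{\mathbb N}\to\{0,1\}$ with $(\forall f\in\mathbb N^{\mathbb N})(E(f)=0\leftrightarrow(\exists n\in\mathbb N)(f(n)=0))$. Reals are fast-converging Cauchy sequences; functions on $[0,1]$ are third-order objects respecting $=_{\mathbb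 R}$. $B(x,r)$ is the open interval $(x-r,x+r)$, empty if $r=0$. $\Sigma\text{-}\mathsf{IND}$: the induction axiom for formulas $\varphi(n)\equiv(\exists f\in\mathbb N^{\mathbb N})(Y(f,n)=0)$, for any third-order $Y$. $\mathsf{ENC}^\omega$: for any formula $\varphi(n,m)$ of the form $(\forall f\in\mathbb N^{\mathbb N})\psi(f,n,m)$ with $\psi$ arithmetical (only number quantifiers), where parameters of higher type are allowed, $(\forall n\in\mathbb N)(\exists m\in\mathbb N)\varphi(n,m)\to(\exists g\in\mathbb N^{\mathbb N})(\forall n)\varphi(n,g(n))$. *)

theory Defs
  imports Main
begin

section \<open>Finite types, terms and formulas\<close>

datatype ty = TNat | Arr ty ty  (infixr "\<Rrightarrow>" 65)

abbreviation T1 :: ty where "T1 \<equiv> TNat \<Rrightarrow> TNat"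

text \<open>
  Free variables are named and carry their type (so that variables with the same name and different
  types are different variables); bound variables are de Bruijn indices. The formulas of
  the object theory are the well-formed ones (\<open>wf_fm []\<close> below), in which no index is loose.
  The typed constants are the combinators \<open>K\<close> (also written \<open>\<Pi>\<close>) and \<open>S\<close> (also written \<open>\<Sigma>\<close>)
  and the recursor for primitive recursion at type 0.
\<close>

datatype tm =
    Fr string ty
  | Bd nat
  | Zero
  | Succ
  | Kc ty ty
  | Sc ty ty ty
  | Rec
  | App tm tm  (infixl "\<cdot>" 100)

text \<open>Equality at type 0 is the only primitive relation.\<close>

datatype fm =
    Eq tm tm  (infix "\<^bold>=" 50)
  | Falsum  ("\<^bold>\<bottom>")
  | Imp fm fm  (infixr "\<^bold>\<longrightarrow>" 25)
  | Forall ty fm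

text \<open>In \<open>tyof \<Delta> t\<close> the list \<open>\<Delta>\<close> gives the types of the bound variables, innermost binder first.\<close>

fun tyof :: "ty list \<Rightarrow> tm \<Rightarrow> ty option" where
  "tyof \<Delta> (Fr x \<sigma>) = Some \<sigma>"
| "tyof \<Delta> (Bd i) = (if i < length \<Delta> then Some (\<Delta> ! i) else None)"
| "tyof \<Delta> Zero = Some TNat"
| "tyof \<Delta> Succ = Some T1"
| "tyof \<Delta> (Kc \<rho> \<sigma>) = Some (\<rho> \<Rrightarrow> \<sigma> \<Rrightarrow> \<rho>)"
| "tyof \<Delta> (Sc \<rho> \<sigma> \<tau>) = Some ((\<rho> \<Rrightarrow> \<sigma> \<Rrightarrow> \<tau>) \<Rrightarrow> (\<rho> \<Rrightarrow> \<sigma>) \<Rrightarrow> \<rho> \<Rrightarrow> \<tau>)"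
| "tyof \<Delta> Rec = Some (TNat \<Rrightarrow> TNat \<Rrightarrow> (TNat \<Rrightarrow> TNat \<Rrightarrow> TNat) \<Rrightarrow> TNat)"
| "tyof \<Delta> (s \<cdot> t) =
    (case tyof \<Delta> s of
       Some (\<sigma> \<Rrightarrow> \<tau>) \<Rightarrow> if tyof \<Delta> t = Some \<sigma> then Some \<tau> else None
     | _ \<Rightarrow> None)"

fun wf_fm :: "ty list \<Rightarrow> fm \<Rightarrow> bool" where
  "wf_fm \<Delta> (s \<^bold>= t) \<longleftrightarrow> tyof \<Delta> s = Some TNat \<and> tyof \<Delta> t = Some TNat"
| "wf_fm \<Delta> \<^bold>\<bottom> \<longleftrightarrow> True"
| "wf_fm \<Delta> (\<phi> \<^bold>\<longrightarrow> \<psi>) \<longleftrightarrow> wf_fm \<Delta> \<phi> \<and> wf_fm \<Delta> \<psi>"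
| "wf_fm \<Delta> (Forall \<sigma> \<phi>) \<longleftrightarrow> wf_fm (\<sigma> # \<Delta>) \<phi>"

fun fv_tm :: "tm \<Rightarrow> (string \<times> ty) set" where
  "fv_tm (Fr x \<sigma>) = {(x, \<sigma>)}"
| "fv_tm (s \<cdot> t) = fv_tm s \<union> fv_tm t"
| "fv_tm _ = {}"

fun fv :: "fm \<Rightarrow> (string \<times> ty) set" where
  "fv (s \<^bold>= t) = fv_tm s \<union> fv_tm t"
| "fv \<^bold>\<bottom> = {}"
| "fv (\<phi> \<^bold>\<longrightarrow> \<psi>) = fv \<phi> \<union> fv \<psi>"
| "fv (Forall \<sigma> \<phi>) = fv \<phi>"

text \<open>
  \<open>subst x \<sigma> u \<phi>\<close> replaces the free variable \<open>x\<close> of type \<open>\<sigma>\<close> by \<open>u\<close>. It is only used for \<open>u\<close> without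
  bound indices, so nothing can be captured.
\<close>

fun subst_tm :: "string \<Rightarrow> ty \<Rightarrow> tm \<Rightarrow> tm \<Rightarrow> tm" where
  "subst_tm x \<sigma> u (Fr y \<tau>) = (if y = x \<and> \<tau> = \<sigma> then u else Fr y \<tau>)"
| "subst_tm x \<sigma> u (s \<cdot> t) = subst_tm x \<sigma> u s \<cdot> subst_tm x \<sigma> u t"
| "subst_tm x \<sigma> u t = t"

fun subst :: "string \<Rightarrow> ty \<Rightarrow> tm \<Rightarrow> fm \<Rightarrow> fm" where
  "subst x \<sigma> u (s \<^bold>= t) = (subst_tm x \<sigma> u s \<^bold>= subst_tm x \<sigma> u t)"
| "subst x \<sigma> u \<^bold>\<bottom> = \<^bold>\<bottom>"
| "subst x \<sigma> u (\<phi> \<^bold>\<longrightarrow> \<psi>) = (subst x \<sigma> u \<phi> \<^bold>\<longrightarrow> subst x \<sigma> u \<psi>)"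
| "subst x \<sigma> u (Forall \<tau> \<phi>) = Forall \<tau> (subst x \<sigma> u \<phi>)"

fun bind_fm :: "nat \<Rightarrow> string \<Rightarrow> ty \<Rightarrow> fm \<Rightarrow> fm" where
  "bind_fm k x \<sigma> (s \<^bold>= t) = (subst_tm x \<sigma> (Bd k) s \<^bold>= subst_tm x \<sigma> (Bd k) t)"
| "bind_fm k x \<sigma> \<^bold>\<bottom> = \<^bold>\<bottom>"
| "bind_fm k x \<sigma> (\<phi> \<^bold>\<longrightarrow> \<psi>) = (bind_fm k x \<sigma> \<phi> \<^bold>\<longrightarrow> bind_fm k x \<sigma> \<psi>)"
| "bind_fm k x \<sigma> (Forall \<tau> \<phi>) = Forall \<tau> (bind_fm (Suc k) x \<sigma> \<phi>)"

definition all_fm :: "string \<Rightarrow> ty \<Rightarrow> fm \<Rightarrow> fm"  ("(\<^bold>\<forall>_:_./ _)" [1000, 65, 10] 10) where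
  "all_fm x \<sigma> \<phi> = Forall \<sigma> (bind_fm 0 x \<sigma> \<phi>)"

definition neg_fm :: "fm \<Rightarrow> fm"  ("\<^bold>\<not> _" [40] 40) where
  "(\<^bold>\<not> \<phi>) = (\<phi> \<^bold>\<longrightarrow> \<^bold>\<bottom>)"

definition conj_fm :: "fm \<Rightarrow> fm \<Rightarrow> fm"  (infixr "\<^bold>\<and>" 35) where
  "(\<phi> \<^bold>\<and> \<psi>) = (\<^bold>\<not> (\<phi> \<^bold>\<longrightarrow> \<^bold>\<not> \<psi>))"

definition disj_fm :: "fm \<Rightarrow> fm \<Rightarrow> fm"  (infixr "\<^bold>\<or>" 30) where
  "(\<phi> \<^bold>\<or> \<psi>) = (\<^bold>\<not> \<phi> \<^bold>\<longrightarrow> \<psi>)"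

definition iff_fm :: "fm \<Rightarrow> fm \<Rightarrow> fm"  (infix "\<^bold>\<longleftrightarrow>" 25) where
  "(\<phi> \<^bold>\<longleftrightarrow> \<psi>) = ((\<phi> \<^bold>\<longrightarrow> \<psi>) \<^bold>\<and> (\<psi> \<^bold>\<longrightarrow> \<phi>))"

definition ex_fm :: "string \<Rightarrow> ty \<Rightarrow> fm \<Rightarrow> fm"  ("(\<^bold>\<exists>_:_./ _)" [1000, 65, 10] 10) where
  "(\<^bold>\<exists>x:\<sigma>. \<phi>) = (\<^bold>\<not> (\<^bold>\<forall>x:\<sigma>. \<^bold>\<not> \<phi>))"

fun quantifier_free :: "fm \<Rightarrow> bool" where
  "quantifier_free (s \<^bold>= t) \<longleftrightarrow> True"
| "quantifier_free \<^bold>\<bottom> \<longleftrightarrow> True"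
| "quantifier_free (\<phi> \<^bold>\<longrightarrow> \<psi>) \<longleftrightarrow> quantifier_free \<phi> \<and> quantifier_free \<psi>"
| "quantifier_free (Forall \<sigma> \<phi>) \<longleftrightarrow> False"

fun arithmetical :: "fm \<Rightarrow> bool" where
  "arithmetical (s \<^bold>= t) \<longleftrightarrow> True"
| "arithmetical \<^bold>\<bottom> \<longleftrightarrow> True"
| "arithmetical (\<phi> \<^bold>\<longrightarrow> \<psi>) \<longleftrightarrow> arithmetical \<phi> \<and> arithmetical \<psi>"
| "arithmetical (Forall \<sigma> \<phi>) \<longleftrightarrow> \<sigma> = TNat \<and> arithmetical \<phi>"


section \<open>Derivability\<close>

text \<open>
  A Hilbert calculus for classical many-sorted predicate logic. Generalisation is unrestricted, so
  an axiom with free variables stands for its universal closure (free variables are parameters).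
\<close>

inductive derivable :: "fm set \<Rightarrow> fm \<Rightarrow> bool"  (infix "\<turnstile>" 5) for T :: "fm set" where
  Ax: "\<phi> \<in> T \<Longrightarrow> wf_fm [] \<phi> \<Longrightarrow> T \<turnstile> \<phi>"
| Weaken: "wf_fm [] \<phi> \<Longrightarrow> wf_fm [] \<psi> \<Longrightarrow> T \<turnstile> \<phi> \<^bold>\<longrightarrow> \<psi> \<^bold>\<longrightarrow> \<phi>"
| Distrib: "wf_fm [] \<phi> \<Longrightarrow> wf_fm [] \<psi> \<Longrightarrow> wf_fm [] \<chi> \<Longrightarrow>
    T \<turnstile> (\<phi> \<^bold>\<longrightarrow> \<psi> \<^bold>\<longrightarrow> \<chi>) \<^bold>\<longrightarrow> (\<phi> \<^bold>\<longrightarrow> \<psi>) \<^bold>\<longrightarrow> \<phi> \<^bold>\<longrightarrow> \<chi>"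
| DNeg: "wf_fm [] \<phi> \<Longrightarrow> T \<turnstile> \<^bold>\<not> \<^bold>\<not> \<phi> \<^bold>\<longrightarrow> \<phi>"
| Inst: "wf_fm [] \<phi> \<Longrightarrow> tyof [] t = Some \<sigma> \<Longrightarrow> T \<turnstile> (\<^bold>\<forall>x:\<sigma>. \<phi>) \<^bold>\<longrightarrow> subst x \<sigma> t \<phi>"
| AllDistrib: "wf_fm [] \<phi> \<Longrightarrow> wf_fm [] \<psi> \<Longrightarrow> (x, \<sigma>) \<notin> fv \<phi> \<Longrightarrow>
    T \<turnstile> (\<^bold>\<forall>x:\<sigma>. \<phi> \<^bold>\<longrightarrow> \<psi>) \<^bold>\<longrightarrow> \<phi> \<^bold>\<longrightarrow> (\<^bold>\<forall>x:\<sigma>. \<psi>)"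
| MP: "T \<turnstile> \<phi> \<^bold>\<longrightarrow> \<psi> \<Longrightarrow> T \<turnstile> \<phi> \<Longrightarrow> T \<turnstile> \<psi>"
| Gen: "T \<turnstile> \<phi> \<Longrightarrow> T \<turnstile> \<^bold>\<forall>x:\<sigma>. \<phi>"


section \<open>The base theory\<close>

fun shift :: "tm \<Rightarrow> tm" where
  "shift (Bd i) = Bd (Suc i)"
| "shift (s \<cdot> t) = shift s \<cdot> shift t"
| "shift t = t"

text \<open>
  Equality at higher types is not primitive: \<open>s\<close> and \<open>t\<close> of type
  \<open>\<sigma>\<^sub>1 \<Rrightarrow> \<dots> \<Rrightarrow> \<sigma>\<^sub>k \<Rrightarrow> 0\<close> are equal iff \<open>s v\<^sub>1 \<dots> v\<^sub>k = t v\<^sub>1 \<dots> v\<^sub>k\<close> for all \<open>v\<^sub>1, \<dots>, v\<^sub>k\<close>.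
\<close>

fun eq_at :: "ty \<Rightarrow> tm \<Rightarrow> tm \<Rightarrow> fm" where
  "eq_at TNat s t = (s \<^bold>= t)"
| "eq_at (\<sigma> \<Rrightarrow> \<tau>) s t = Forall \<sigma> (eq_at \<tau> (shift s \<cdot> Bd 0) (shift t \<cdot> Bd 0))"

abbreviation nv :: "string \<Rightarrow> tm" where "nv x \<equiv> Fr x TNat"
abbreviation fnv :: "string \<Rightarrow> tm" where "fnv x \<equiv> Fr x T1"

text \<open>Congruence of equality under all terms is an instance of \<open>Ext\<close>.\<close>

inductive_set RCA0w :: "fm set" where
  Refl: "(\<^bold>\<forall>''x'':TNat. nv ''x'' \<^bold>= nv ''x'') \<in> RCA0w"
| Sym: "(\<^bold>\<forall>''x'':TNat. \<^bold>\<forall>''y'':TNat. nv ''x'' \<^bold>= nv ''y'' \<^bold>\<longrightarrow> nv ''y'' \<^bold>= nv ''x'') \<in> RCA0w"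
| Trans: "(\<^bold>\<forall>''x'':TNat. \<^bold>\<forall>''y'':TNat. \<^bold>\<forall>''z'':TNat.
    nv ''x'' \<^bold>= nv ''y'' \<^bold>\<longrightarrow> nv ''y'' \<^bold>= nv ''z'' \<^bold>\<longrightarrow> nv ''x'' \<^bold>= nv ''z'') \<in> RCA0w"
| Succ_nonzero: "(\<^bold>\<forall>''x'':TNat. \<^bold>\<not> Succ \<cdot> nv ''x'' \<^bold>= Zero) \<in> RCA0w"
| Succ_inj: "(\<^bold>\<forall>''x'':TNat. \<^bold>\<forall>''y'':TNat.
    Succ \<cdot> nv ''x'' \<^bold>= Succ \<cdot> nv ''y'' \<^bold>\<longrightarrow> nv ''x'' \<^bold>= nv ''y'') \<in> RCA0w"
| QF_IND: "quantifier_free \<phi> \<Longrightarrow> wf_fm [] \<phi> \<Longrightarrow>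
    (subst n TNat Zero \<phi> \<^bold>\<and> (\<^bold>\<forall>n:TNat. \<phi> \<^bold>\<longrightarrow> subst n TNat (Succ \<cdot> nv n) \<phi>)
      \<^bold>\<longrightarrow> (\<^bold>\<forall>n:TNat. \<phi>)) \<in> RCA0w"
| K_eq: "(\<^bold>\<forall>''x'':\<rho>. \<^bold>\<forall>''y'':\<sigma>. eq_at \<rho> (Kc \<rho> \<sigma> \<cdot> Fr ''x'' \<rho> \<cdot> Fr ''y'' \<sigma>) (Fr ''x'' \<rho>)) \<in> RCA0w"
| S_eq: "(\<^bold>\<forall>''x'':\<rho> \<Rrightarrow> \<sigma> \<Rrightarrow> \<tau>. \<^bold>\<forall>''y'':\<rho> \<Rrightarrow> \<sigma>. \<^bold>\<forall>''z'':\<rho>.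
    eq_at \<tau> (Sc \<rho> \<sigma> \<tau> \<cdot> Fr ''x'' (\<rho> \<Rrightarrow> \<sigma> \<Rrightarrow> \<tau>) \<cdot> Fr ''y'' (\<rho> \<Rrightarrow> \<sigma>) \<cdot> Fr ''z'' \<rho>)
      (Fr ''x'' (\<rho> \<Rrightarrow> \<sigma> \<Rrightarrow> \<tau>) \<cdot> Fr ''z'' \<rho> \<cdot> (Fr ''y'' (\<rho> \<Rrightarrow> \<sigma>) \<cdot> Fr ''z'' \<rho>))) \<in> RCA0w"
| Rec_Zero: "(\<^bold>\<forall>''y'':TNat. \<^bold>\<forall>''z'':TNat \<Rrightarrow> T1.
    Rec \<cdot> Zero \<cdot> nv ''y'' \<cdot> Fr ''z'' (TNat \<Rrightarrow> T1) \<^bold>= nv ''y'') \<in> RCA0w"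
| Rec_Succ: "(\<^bold>\<forall>''x'':TNat. \<^bold>\<forall>''y'':TNat. \<^bold>\<forall>''z'':TNat \<Rrightarrow> T1.
    Rec \<cdot> (Succ \<cdot> nv ''x'') \<cdot> nv ''y'' \<cdot> Fr ''z'' (TNat \<Rrightarrow> T1) \<^bold>=
      Fr ''z'' (TNat \<Rrightarrow> T1) \<cdot> (Rec \<cdot> nv ''x'' \<cdot> nv ''y'' \<cdot> Fr ''z'' (TNat \<Rrightarrow> T1)) \<cdot> nv ''x'')
    \<in> RCA0w"
| Ext: "(\<^bold>\<forall>''z'':\<rho> \<Rrightarrow> \<tau>. \<^bold>\<forall>''x'':\<rho>. \<^bold>\<forall>''y'':\<rho>. eq_at \<rho> (Fr ''x'' \<rho>) (Fr ''y'' \<rho>) \<^bold>\<longrightarrow>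
    eq_at \<tau> (Fr ''z'' (\<rho> \<Rrightarrow> \<tau>) \<cdot> Fr ''x'' \<rho>) (Fr ''z'' (\<rho> \<Rrightarrow> \<tau>) \<cdot> Fr ''y'' \<rho>)) \<in> RCA0w"
| QF_AC: "quantifier_free \<phi> \<Longrightarrow> wf_fm [] \<phi> \<Longrightarrow> (Y, T1 \<Rrightarrow> TNat) \<notin> fv \<phi> \<Longrightarrow>
    ((\<^bold>\<forall>f:T1. \<^bold>\<exists>n:TNat. \<phi>) \<^bold>\<longrightarrow>
      (\<^bold>\<exists>Y:T1 \<Rrightarrow> TNat. \<^bold>\<forall>f:T1. subst n TNat (Fr Y (T1 \<Rrightarrow> TNat) \<cdot> fnv f) \<phi>)) \<in> RCA0w"

definition Exists2 :: fm where
  "Exists2 = (\<^bold>\<exists>''E'':T1 \<Rrightarrow> TNat. \<^bold>\<forall>''f'':T1.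
     (Fr ''E'' (T1 \<Rrightarrow> TNat) \<cdot> fnv ''f'' \<^bold>= Zero \<^bold>\<or>
      Fr ''E'' (T1 \<Rrightarrow> TNat) \<cdot> fnv ''f'' \<^bold>= Succ \<cdot> Zero) \<^bold>\<and>
     (Fr ''E'' (T1 \<Rrightarrow> TNat) \<cdot> fnv ''f'' \<^bold>= Zero \<^bold>\<longleftrightarrow>
       (\<^bold>\<exists>''n'':TNat. fnv ''f'' \<cdot> nv ''n'' \<^bold>= Zero)))"

definition ACA0w :: "fm set" where
  "ACA0w = insert Exists2 RCA0w"

definition Sigma_formula :: "tm \<Rightarrow> fm" where
  "Sigma_formula t =
    (\<^bold>\<exists>''f'':T1. Fr ''Y'' (T1 \<Rrightarrow> TNat \<Rrightarrow> TNat) \<cdot> fnv ''f'' \<cdot> t \<^bold>= Zero)"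

definition Sigma_IND :: fm where
  "Sigma_IND = (\<^bold>\<forall>''Y'':T1 \<Rrightarrow> TNat \<Rrightarrow> TNat.
     Sigma_formula Zero \<^bold>\<and>
     (\<^bold>\<forall>''n'':TNat. Sigma_formula (nv ''n'') \<^bold>\<longrightarrow> Sigma_formula (Succ \<cdot> nv ''n'')) \<^bold>\<longrightarrow>
     (\<^bold>\<forall>''n'':TNat. Sigma_formula (nv ''n'')))"

inductive_set ENCw :: "fm set" where
  "\<lbrakk>\<phi> = (\<^bold>\<forall>f:T1. \<psi>); arithmetical \<psi>; wf_fm [] \<psi>; n \<noteq> m; (g, T1) \<notin> fv \<phi>\<rbrakk> \<Longrightarrow>
    ((\<^bold>\<forall>n:TNat. \<^bold>\<exists>m:TNat. \<phi>) \<^bold>\<longrightarrow>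
      (\<^bold>\<exists>g:T1. \<^bold>\<forall>n:TNat. subst m TNat (fnv g \<cdot> nv n) \<phi>)) \<in> ENCw"


section \<open>Primitive recursive functions as closed terms\<close>

text \<open>
  Bracket abstraction: \<open>lam x \<sigma> t\<close> is the combinator term for \<open>\<lambda>x\<^sup>\<sigma>. t\<close>, for well-typed \<open>t\<close> without
  bound indices.
\<close>

fun lam :: "string \<Rightarrow> ty \<Rightarrow> tm \<Rightarrow> tm" where
  "lam x \<sigma> (s \<cdot> t) =
    (if (x, \<sigma>) \<in> fv_tm (s \<cdot> t)
     then Sc \<sigma> (the (tyof [] t)) (the (tyof [] (s \<cdot> t))) \<cdot> lam x \<sigma> s \<cdot> lam x \<sigma> t
     else Kc (the (tyof [] (s \<cdot> t))) \<sigma> \<cdot> (s \<cdot> t))"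
| "lam x \<sigma> t =
    (if t = Fr x \<sigma> then Sc \<sigma> (\<sigma> \<Rrightarrow> \<sigma>) \<sigma> \<cdot> Kc \<sigma> (\<sigma> \<Rrightarrow> \<sigma>) \<cdot> Kc \<sigma> \<sigma>
     else Kc (the (tyof [] t)) \<sigma> \<cdot> t)"

abbreviation nlam :: "string \<Rightarrow> tm \<Rightarrow> tm"  ("(\<^bold>\<lambda>_./ _)" [1000, 10] 10) where
  "(\<^bold>\<lambda>x. t) \<equiv> lam x TNat t"

definition pred_tm :: tm where
  "pred_tm = (\<^bold>\<lambda>''x''. Rec \<cdot> nv ''x'' \<cdot> Zero \<cdot> (\<^bold>\<lambda>''u''. \<^bold>\<lambda>''v''. nv ''v''))"

definition add_tm :: tm where
  "add_tm = (\<^bold>\<lambda>''x''. \<^bold>\<lambda>''y''. Rec \<cdot> nv ''y'' \<cdot> nv ''x'' \<cdot> (\<^bold>\<lambda>''u''. \<^bold>\<lambda>''v''. Succ \<cdot> nv ''u''))"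

abbreviation add_app  (infixl "\<^bold>+" 65) where "s \<^bold>+ t \<equiv> add_tm \<cdot> s \<cdot> t"

definition mult_tm :: tm where
  "mult_tm = (\<^bold>\<lambda>''x''. \<^bold>\<lambda>''y''. Rec \<cdot> nv ''y'' \<cdot> Zero \<cdot> (\<^bold>\<lambda>''u''. \<^bold>\<lambda>''v''. (nv ''u'' \<^bold>+ nv ''x'')))"

abbreviation mult_app  (infixl "\<^bold>*" 70) where "s \<^bold>* t \<equiv> mult_tm \<cdot> s \<cdot> t"

text \<open>Truncated subtraction.\<close>

definition monus_tm :: tm where
  "monus_tm = (\<^bold>\<lambda>''x''. \<^bold>\<lambda>''y''. Rec \<cdot> nv ''y'' \<cdot> nv ''x'' \<cdot> (\<^bold>\<lambda>''u''. \<^bold>\<lambda>''v''. pred_tm \<cdot> nv ''u''))"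

abbreviation monus_app  (infixl "\<^bold>-" 65) where "s \<^bold>- t \<equiv> monus_tm \<cdot> s \<cdot> t"

definition pow2_tm :: tm where
  "pow2_tm = (\<^bold>\<lambda>''x''. Rec \<cdot> nv ''x'' \<cdot> (Succ \<cdot> Zero) \<cdot> (\<^bold>\<lambda>''u''. \<^bold>\<lambda>''v''. (nv ''u'' \<^bold>+ nv ''u'')))"

definition le_fm :: "tm \<Rightarrow> tm \<Rightarrow> fm"  (infix "\<^bold>\<le>" 50) where
  "(s \<^bold>\<le> t) = ((s \<^bold>- t) \<^bold>= Zero)"

definition less_fm :: "tm \<Rightarrow> tm \<Rightarrow> fm"  (infix "\<^bold><" 50) where
  "(s \<^bold>< t) = ((Succ \<cdot> s) \<^bold>\<le> t)"

text \<open>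
  Cantor pairing \<open>\<langle>x, y\<rangle> = (x + y)(x + y + 1)/2 + x\<close>. The value of \<open>root_tm\<close> at \<open>n\<close> is the largest
  \<open>r\<close> with \<open>r(r + 1)/2 \<le> n\<close>, i.e. the sum of the two components of \<open>n\<close>.
\<close>

definition triangle_tm :: tm where
  "triangle_tm = (\<^bold>\<lambda>''x''. Rec \<cdot> nv ''x'' \<cdot> Zero \<cdot> (\<^bold>\<lambda>''u''. \<^bold>\<lambda>''v''. (nv ''u'' \<^bold>+ (Succ \<cdot> nv ''v''))))"

definition root_tm :: tm where
  "root_tm = (\<^bold>\<lambda>''x''. Rec \<cdot> nv ''x'' \<cdot> Zero \<cdot> (\<^bold>\<lambda>''u''. \<^bold>\<lambda>''v''.
     (nv ''u'' \<^bold>+ (Succ \<cdot> Zero \<^bold>- (triangle_tm \<cdot> (Succ \<cdot> nv ''u'') \<^bold>- (Succ \<cdot> nv ''v''))))))"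

definition pair_tm :: tm where
  "pair_tm = (\<^bold>\<lambda>''x''. \<^bold>\<lambda>''y''. (triangle_tm \<cdot> (nv ''x'' \<^bold>+ nv ''y'') \<^bold>+ nv ''x''))"

definition fst_tm :: tm where
  "fst_tm = (\<^bold>\<lambda>''x''. (nv ''x'' \<^bold>- (triangle_tm \<cdot> (root_tm \<cdot> nv ''x''))))"

definition snd_tm :: tm where
  "snd_tm = (\<^bold>\<lambda>''x''. (root_tm \<cdot> nv ''x'' \<^bold>- (fst_tm \<cdot> nv ''x'')))"


section \<open>Rational and real numbers\<close>

text \<open>
  Every number codes a rational: \<open>\<langle>\<langle>a, b\<rangle>, c\<rangle>\<close> is a code for \<open>(a - b)/(c + 1)\<close>. Equality and order of
  rationals are relations on codes.
\<close>

abbreviation qcode :: "tm \<Rightarrow> tm \<Rightarrow> tm \<Rightarrow> tm" where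
  "qcode a b d \<equiv> pair_tm \<cdot> (pair_tm \<cdot> a \<cdot> b) \<cdot> (pred_tm \<cdot> d)"

abbreviation qpos :: "tm \<Rightarrow> tm" where "qpos q \<equiv> fst_tm \<cdot> (fst_tm \<cdot> q)"
abbreviation qneg :: "tm \<Rightarrow> tm" where "qneg q \<equiv> snd_tm \<cdot> (fst_tm \<cdot> q)"
abbreviation qden :: "tm \<Rightarrow> tm" where "qden q \<equiv> Succ \<cdot> (snd_tm \<cdot> q)"

definition qadd_tm :: tm where
  "qadd_tm = (\<^bold>\<lambda>''p''. \<^bold>\<lambda>''q''. qcode
     (qpos (nv ''p'') \<^bold>* qden (nv ''q'') \<^bold>+ (qpos (nv ''q'') \<^bold>* qden (nv ''p'')))
     (qneg (nv ''p'') \<^bold>* qden (nv ''q'') \<^bold>+ (qneg (nv ''q'') \<^bold>* qden (nv ''p'')))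
     (qden (nv ''p'') \<^bold>* qden (nv ''q'')))"

definition qminus_tm :: tm where
  "qminus_tm = (\<^bold>\<lambda>''q''. qcode (qneg (nv ''q'')) (qpos (nv ''q'')) (qden (nv ''q'')))"

definition qabs_tm :: tm where
  "qabs_tm = (\<^bold>\<lambda>''q''. qcode
     ((qpos (nv ''q'') \<^bold>- qneg (nv ''q'')) \<^bold>+ (qneg (nv ''q'') \<^bold>- qpos (nv ''q''))) Zero
     (qden (nv ''q'')))"

abbreviation qadd :: "tm \<Rightarrow> tm \<Rightarrow> tm" where "qadd p q \<equiv> qadd_tm \<cdot> p \<cdot> q"
abbreviation qsub :: "tm \<Rightarrow> tm \<Rightarrow> tm" where "qsub p q \<equiv> qadd_tm \<cdot> p \<cdot> (qminus_tm \<cdot> q)"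
abbreviation qabs :: "tm \<Rightarrow> tm" where "qabs q \<equiv> qabs_tm \<cdot> q"

text \<open>The rational \<open>2\<^sup>-\<^sup>k\<close>.\<close>

definition qpow_tm :: tm where
  "qpow_tm = (\<^bold>\<lambda>''k''. qcode (Succ \<cdot> Zero) Zero (pow2_tm \<cdot> nv ''k''))"

abbreviation qpow :: "tm \<Rightarrow> tm" where "qpow k \<equiv> qpow_tm \<cdot> k"

definition qle :: "tm \<Rightarrow> tm \<Rightarrow> fm" where
  "qle p q = ((qpos p \<^bold>* qden q \<^bold>+ (qneg q \<^bold>* qden p)) \<^bold>\<le> (qpos q \<^bold>* qden p \<^bold>+ (qneg p \<^bold>* qden q)))"

definition qless :: "tm \<Rightarrow> tm \<Rightarrow> fm" where
  "qless p q = ((qpos p \<^bold>* qden q \<^bold>+ (qneg q \<^bold>* qden p)) \<^bold>< (qpos q \<^bold>* qden p \<^bold>+ (qneg p \<^bold>* qden q)))"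

text \<open>
  In the following formulas \<open>''k''\<close> and \<open>''l''\<close> are bound, so they may only be applied to terms in
  which the number variables \<open>''k''\<close> and \<open>''l''\<close> do not occur. A real is a sequence \<open>(q\<^sub>k)\<close> of
  rationals with \<open>\<bar>q\<^sub>k - q\<^sub>k\<^sub>+\<^sub>l\<bar> < 2\<^sup>-\<^sup>k\<close>; two reals are equal iff \<open>\<bar>q\<^sub>k - r\<^sub>k\<bar> \<le> 2\<^sup>-\<^sup>k + 2\<^sup>-\<^sup>k\<close> for all \<open>k\<close>.
\<close>

definition is_real :: "tm \<Rightarrow> fm" where
  "is_real x = (\<^bold>\<forall>''k'':TNat. \<^bold>\<forall>''l'':TNat.
     qless (qabs (qsub (x \<cdot> nv ''k'') (x \<cdot> (nv ''k'' \<^bold>+ nv ''l'')))) (qpow (nv ''k'')))"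

definition eqR :: "tm \<Rightarrow> tm \<Rightarrow> fm" where
  "eqR x y = (\<^bold>\<forall>''k'':TNat.
     qle (qabs (qsub (x \<cdot> nv ''k'') (y \<cdot> nv ''k''))) (qadd (qpow (nv ''k'')) (qpow (nv ''k''))))"

definition leR :: "tm \<Rightarrow> tm \<Rightarrow> fm" where
  "leR x y = (\<^bold>\<forall>''k'':TNat.
     qle (x \<cdot> nv ''k'') (qadd (y \<cdot> nv ''k'') (qadd (qpow (nv ''k'')) (qpow (nv ''k'')))))"

definition lessR :: "tm \<Rightarrow> tm \<Rightarrow> fm" where
  "lessR x y = (\<^bold>\<not> leR y x)"

definition zeroR :: tm where
  "zeroR = (\<^bold>\<lambda>''k''. qcode Zero Zero (Succ \<cdot> Zero))"

definition oneR :: tm where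
  "oneR = (\<^bold>\<lambda>''k''. qcode (Succ \<cdot> Zero) Zero (Succ \<cdot> Zero))"

text \<open>The index \<open>k + 1\<close> makes the sum and the difference converge fast again.\<close>

definition addR_tm :: tm where
  "addR_tm = lam ''x'' T1 (lam ''y'' T1 (\<^bold>\<lambda>''k''.
     qadd (fnv ''x'' \<cdot> (Succ \<cdot> nv ''k'')) (fnv ''y'' \<cdot> (Succ \<cdot> nv ''k''))))"

definition subR_tm :: tm where
  "subR_tm = lam ''x'' T1 (lam ''y'' T1 (\<^bold>\<lambda>''k''.
     qsub (fnv ''x'' \<cdot> (Succ \<cdot> nv ''k'')) (fnv ''y'' \<cdot> (Succ \<cdot> nv ''k''))))"

definition in_unit :: "tm \<Rightarrow> fm" where
  "in_unit x = (is_real x \<^bold>\<and> leR zeroR x \<^bold>\<and> leR x oneR)"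

text \<open>\<open>z \<in> B(y, r)\<close>, i.e. \<open>y - r < z < y + r\<close>; for \<open>r = 0\<close> there is no such \<open>z\<close>.\<close>

definition in_ball :: "tm \<Rightarrow> tm \<Rightarrow> tm \<Rightarrow> fm" where
  "in_ball z y r = (lessR (subR_tm \<cdot> y \<cdot> r) z \<^bold>\<and> lessR z (addR_tm \<cdot> y \<cdot> r))"


section \<open>Cousin's lemma\<close>

abbreviation psi :: tm where "psi \<equiv> Fr ''psi'' (T1 \<Rrightarrow> T1)"
abbreviation pts :: tm where "pts \<equiv> Fr ''pts'' (TNat \<Rrightarrow> T1)"

text \<open>
  A function from \<open>[0,1]\<close> to the nonnegative reals is an object of type \<open>1 \<Rrightarrow> 1\<close> that maps elements of
  \<open>[0,1]\<close> to nonnegative reals and respects equality of reals.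
\<close>

definition psi_is_function :: fm where
  "psi_is_function =
    ((\<^bold>\<forall>''x'':T1. in_unit (fnv ''x'') \<^bold>\<longrightarrow>
        is_real (psi \<cdot> fnv ''x'') \<^bold>\<and> leR zeroR (psi \<cdot> fnv ''x'')) \<^bold>\<and>
     (\<^bold>\<forall>''x'':T1. \<^bold>\<forall>''y'':T1. in_unit (fnv ''x'') \<^bold>\<and> in_unit (fnv ''y'') \<^bold>\<and>
        eqR (fnv ''x'') (fnv ''y'') \<^bold>\<longrightarrow> eqR (psi \<cdot> fnv ''x'') (psi \<cdot> fnv ''y'')))"

definition HBT :: fm where
  "HBT = (\<^bold>\<forall>''psi'':T1 \<Rrightarrow> T1.
     psi_is_function \<^bold>\<and>
     (\<^bold>\<forall>''x'':T1. in_unit (fnv ''x'') \<^bold>\<longrightarrow>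
       (\<^bold>\<exists>''y'':T1. in_unit (fnv ''y'') \<^bold>\<and> in_ball (fnv ''x'') (fnv ''y'') (psi \<cdot> fnv ''y'')))
     \<^bold>\<longrightarrow>
     (\<^bold>\<exists>''pts'':TNat \<Rrightarrow> T1. \<^bold>\<exists>''m'':TNat.
       (\<^bold>\<forall>''i'':TNat. nv ''i'' \<^bold>\<le> nv ''m'' \<^bold>\<longrightarrow> in_unit (pts \<cdot> nv ''i'')) \<^bold>\<and>
       (\<^bold>\<forall>''x'':T1. in_unit (fnv ''x'') \<^bold>\<longrightarrow>
         (\<^bold>\<exists>''i'':TNat. nv ''i'' \<^bold>\<le> nv ''m'' \<^bold>\<and>
           in_ball (fnv ''x'') (pts \<cdot> nv ''i'') (psi \<cdot> (pts \<cdot> nv ''i''))))))"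

end

theory Submission
  imports Defs "HOL-Library.Countable_Set" "HOL-Computational_Algebra.Fraction_Field"
begin

text \<open>
  If \<open>HBT\<close> were not derivable, it would fail in a Henkin model of the theory: the term model of a
  maximal consistent set, modulo extensional equality. So it suffices to argue inside an arbitrary
  model, whose numbers form a possibly nonstandard discretely ordered semiring.

  Let \<open>y\<close> capture \<open>(n, i)\<close> if \<open>B(y, \<psi>(y))\<close> contains the interval from \<open>(i - 1) / 2\<^sup>n\<close> to \<open>(i + 2) / 2\<^sup>n\<close>. If
  for some \<open>n\<close> every \<open>(n, i)\<close> with \<open>i < 2\<^sup>n\<close> is captured, then \<open>\<Sigma>-IND\<close>, applied to the statement that some
  object of type 1 codes points capturing \<open>(n, 0), \<dots>, (n, k - 1)\<close>, yields a finite cover. Otherwise, for each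
  \<open>n\<close> there is \<open>i < 2\<^sup>n\<close> such that no \<open>y\<close> captures \<open>(n, i)\<close>, and \<open>ENC\<close> gives a sequence \<open>g\<close> of such \<open>i\<close>. By
  arithmetical comprehension, \<open>g(n) / 2\<^sup>n\<close> has a limit superior \<open>x\<close>. It lies in some ball \<open>B(y, \<psi>(y))\<close>, and \<open>y\<close>
  captures \<open>(n, g(n))\<close> for some large \<open>n\<close>, a contradiction.
\<close>

text \<open>Working in a model replaces formal derivations by ordinary proofs, but its numbers may
  be nonstandard. So induction holds only for quantifier-free formulas, for arithmetical ones after
  coding them with the functional of \<open>Exists2\<close>, and for the formulas of
  \<open>Sigma_IND\<close>. This shapes the notion of capturing: it compares endpoints instead of
  quantifying over the points of an interval, hence is arithmetical in y with \<open>psi\<close> as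
  a parameter. Then "no y captures (n, i)" has the form that ENC accepts, and "f codes capturing
  points for all i < k" the form that \<open>Sigma_IND\<close> accepts. A limit superior is taken,
  not a bisection, because the bad indices chosen for different n need not be nested. The intervals
  are three grid cells long because stage n determines a real only up to an error of one cell. For
  the estimates, the numbers are made a type of class \<open>linordered_semidom\<close> and embedded
  in an ordered quotient field, where \<open>linarith\<close> works; the price is a countermodel
  fixed by choice before it is known to exist.\<close>

instance ty :: countable by countable_datatype
instance tm :: countable by countable_datatype
instance fm :: countable by countable_datatype

section \<open>Syntax\<close>

text \<open>The defining equation is a nested case expression that gets in the way of inductions
  over terms; this form replaces it, which is why \<open>tyof.simps(8)\<close> is so often removed
  from the simplifier.\<close>

lemma tyof_App: "tyof \<Delta> (s \<cdot> t) = Some \<tau> \<longleftrightarrow> (\<exists>\<sigma>. tyof \<Delta> s = Some (\<sigma> \<Rrightarrow> \<tau>) \<and> tyof \<Delta> t = Some \<sigma>)"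
  by (auto split: option.splits ty.splits if_splits)

lemma tyof_weaken: "tyof \<Delta> t = Some \<tau> \<Longrightarrow> tyof (\<Delta> @ \<Delta>') t = Some \<tau>"
  by (induction t arbitrary: \<tau>) (auto simp: nth_append tyof_App simp del: tyof.simps(8) split: if_splits)

lemma tyof_closed: "tyof [] t = Some \<tau> \<Longrightarrow> tyof \<Delta> t = Some \<tau>"
  using tyof_weaken[of "[]" t \<tau> \<Delta>] by simp

lemma tyof_subst_Bd:
  "tyof \<Delta> t = Some \<tau> \<Longrightarrow> tyof (\<Delta> @ [\<sigma>]) (subst_tm x \<sigma> (Bd (length \<Delta>)) t) = Some \<tau>"
  by (induction t arbitrary: \<tau>) (auto simp: nth_append tyof_App simp del: tyof.simps(8) split: if_splits)

lemma wf_bind: "wf_fm \<Delta> \<phi> \<Longrightarrow> wf_fm (\<Delta> @ [\<sigma>]) (bind_fm (length \<Delta>) x \<sigma> \<phi>)"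
proof (induction \<phi> arbitrary: \<Delta>)
  case (Forall \<tau> \<phi>)
  then show ?case using Forall.IH[of "\<tau> # \<Delta>"] by simp
qed (auto simp: tyof_subst_Bd)

lemma wf_all [simp]: "wf_fm [] \<phi> \<Longrightarrow> wf_fm [] (\<^bold>\<forall>x:\<sigma>. \<phi>)"
  using wf_bind[of "[]"] by (simp add: all_fm_def)

lemma wf_neg [simp]: "wf_fm \<Delta> (\<^bold>\<not> \<phi>) = wf_fm \<Delta> \<phi>"
  by (simp add: neg_fm_def)

lemma wf_conj [simp]: "wf_fm \<Delta> (\<phi> \<^bold>\<and> \<psi>) \<longleftrightarrow> wf_fm \<Delta> \<phi> \<and> wf_fm \<Delta> \<psi>"
  by (simp add: conj_fm_def)

lemma wf_disj [simp]: "wf_fm \<Delta> (\<phi> \<^bold>\<or> \<psi>) \<longleftrightarrow> wf_fm \<Delta> \<phi> \<and> wf_fm \<Delta> \<psi>"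
  by (simp add: disj_fm_def)

lemma wf_iff [simp]: "wf_fm \<Delta> (\<phi> \<^bold>\<longleftrightarrow> \<psi>) \<longleftrightarrow> wf_fm \<Delta> \<phi> \<and> wf_fm \<Delta> \<psi>"
  by (auto simp: iff_fm_def)

lemma wf_ex [simp]: "wf_fm [] \<phi> \<Longrightarrow> wf_fm [] (\<^bold>\<exists>x:\<sigma>. \<phi>)"
  by (simp add: ex_fm_def)

lemma tyof_subst: "tyof \<Delta> t = Some \<tau> \<Longrightarrow> tyof [] u = Some \<sigma> \<Longrightarrow> tyof \<Delta> (subst_tm x \<sigma> u t) = Some \<tau>"
  by (induction t arbitrary: \<tau>) (auto simp: tyof_App intro: tyof_closed simp del: tyof.simps(8))

lemma wf_subst: "wf_fm \<Delta> \<phi> \<Longrightarrow> tyof [] u = Some \<sigma> \<Longrightarrow> wf_fm \<Delta> (subst x \<sigma> u \<phi>)"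
  by (induction \<phi> arbitrary: \<Delta>) (auto simp: tyof_subst)

text \<open>Opening with a fresh variable undoes \<open>bind_fm\<close>. The calculus speaks of
  named binding, \<open>all_fm\<close>, while structural recursion meets a bare
  \<open>Forall\<close> whose body has a loose index; opening translates between the two.\<close>

fun open_tm :: "nat \<Rightarrow> tm \<Rightarrow> tm \<Rightarrow> tm" where
  "open_tm k u (Bd i) = (if i = k then u else Bd i)"
| "open_tm k u (s \<cdot> t) = open_tm k u s \<cdot> open_tm k u t"
| "open_tm k u t = t"

fun open_fm :: "nat \<Rightarrow> tm \<Rightarrow> fm \<Rightarrow> fm" where
  "open_fm k u (s \<^bold>= t) = (open_tm k u s \<^bold>= open_tm k u t)"
| "open_fm k u \<^bold>\<bottom> = \<^bold>\<bottom>"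
| "open_fm k u (\<phi> \<^bold>\<longrightarrow> \<psi>) = (open_fm k u \<phi> \<^bold>\<longrightarrow> open_fm k u \<psi>)"
| "open_fm k u (Forall \<sigma> \<phi>) = Forall \<sigma> (open_fm (Suc k) u \<phi>)"

lemma bind_open_tm: "(x, \<sigma>) \<notin> fv_tm t \<Longrightarrow> subst_tm x \<sigma> (Bd k) (open_tm k (Fr x \<sigma>) t) = t"
  by (induction t) auto

lemma bind_open: "(x, \<sigma>) \<notin> fv \<phi> \<Longrightarrow> bind_fm k x \<sigma> (open_fm k (Fr x \<sigma>) \<phi>) = \<phi>"
  by (induction \<phi> arbitrary: k) (auto simp: bind_open_tm)

lemma subst_open_tm: "(x, \<sigma>) \<notin> fv_tm t \<Longrightarrow> subst_tm x \<sigma> u (open_tm k (Fr x \<sigma>) t) = open_tm k u t"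
  by (induction t) auto

lemma subst_open: "(x, \<sigma>) \<notin> fv \<phi> \<Longrightarrow> subst x \<sigma> u (open_fm k (Fr x \<sigma>) \<phi>) = open_fm k u \<phi>"
  by (induction \<phi> arbitrary: k) (auto simp: subst_open_tm)

text \<open>Every \<open>Forall\<close> is an \<open>all_fm\<close> for any fresh name, so the
  quantifier rules of the calculus reach all universal formulas.\<close>

lemma all_open: "(x, \<sigma>) \<notin> fv \<phi> \<Longrightarrow> (\<^bold>\<forall>x:\<sigma>. open_fm 0 (Fr x \<sigma>) \<phi>) = Forall \<sigma> \<phi>"
  by (simp add: all_fm_def bind_open)

lemma tyof_open:
  "tyof (\<Delta> @ [\<sigma>]) t = Some \<tau> \<Longrightarrow> tyof [] u = Some \<sigma> \<Longrightarrow> tyof \<Delta> (open_tm (length \<Delta>) u t) = Some \<tau>"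
  by (induction t arbitrary: \<tau>)
    (auto simp: nth_append tyof_App less_Suc_eq simp del: tyof.simps(8) intro: tyof_closed split: if_splits)

lemma wf_open: "wf_fm (\<Delta> @ [\<sigma>]) \<phi> \<Longrightarrow> tyof [] u = Some \<sigma> \<Longrightarrow> wf_fm \<Delta> (open_fm (length \<Delta>) u \<phi>)"
proof (induction \<phi> arbitrary: \<Delta>)
  case (Forall \<tau> \<phi>)
  then show ?case using Forall.IH[of "\<tau> # \<Delta>"] by simp
qed (auto simp: tyof_open)

lemma finite_fv_tm: "finite (fv_tm t)"
  by (induction t) auto

lemma finite_fv: "finite (fv \<phi>)"
  by (induction \<phi>) (auto simp: finite_fv_tm)

lemma fresh_exists:
  fixes V :: "(string \<times> ty) set"
  assumes "finite V"
  shows "\<exists>x. (x, \<sigma>) \<notin> V"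
proof (rule ccontr)
  assume "\<not> ?thesis"
  then have "(UNIV :: string set) \<subseteq> fst ` V" by force
  then show False using assms finite_surj infinite_UNIV_listI by blast
qed

section \<open>Derivations from hypotheses\<close>

lemma derivable_wf: "T \<turnstile> \<phi> \<Longrightarrow> wf_fm [] \<phi>"
  by (induction rule: derivable.induct) (auto simp: wf_subst)

text \<open>Hypotheses are nested antecedents, the head of the list being the innermost. Enlarging
  the axiom set instead would not do: \<open>Gen\<close> is unrestricted, so the deduction theorem
  fails for hypotheses with free variables.\<close>

fun hyps :: "fm list \<Rightarrow> fm \<Rightarrow> fm" where
  "hyps [] \<phi> = \<phi>"
| "hyps (\<gamma> # G) \<phi> = hyps G (\<gamma> \<^bold>\<longrightarrow> \<phi>)"

abbreviation wfs :: "fm list \<Rightarrow> bool" where "wfs G \<equiv> \<forall>\<gamma>\<in>set G. wf_fm [] \<gamma>"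

lemma wf_hyps [simp]: "wf_fm [] (hyps G \<phi>) \<longleftrightarrow> wfs G \<and> wf_fm [] \<phi>"
  by (induction G arbitrary: \<phi>) auto

lemma hyps_lift: "T \<turnstile> \<phi> \<Longrightarrow> wfs G \<Longrightarrow> T \<turnstile> hyps G \<phi>"
proof (induction G arbitrary: \<phi>)
  case (Cons \<gamma> G)
  have "T \<turnstile> \<gamma> \<^bold>\<longrightarrow> \<phi>"
    using Cons.prems derivable_wf by (intro MP[OF Weaken]) auto
  then show ?case using Cons by simp
qed simp

lemma hyps_MP: "T \<turnstile> hyps G (\<phi> \<^bold>\<longrightarrow> \<psi>) \<Longrightarrow> T \<turnstile> hyps G \<phi> \<Longrightarrow> T \<turnstile> hyps G \<psi>"
proof (induction G arbitrary: \<phi> \<psi>)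
  case Nil
  then show ?case by (metis MP hyps.simps(1))
next
  case (Cons \<gamma> G)
  have "wf_fm [] (hyps (\<gamma> # G) (\<phi> \<^bold>\<longrightarrow> \<psi>))" using Cons.prems derivable_wf by blast
  then have wf: "wfs (\<gamma> # G)" "wf_fm [] \<phi>" "wf_fm [] \<psi>" by (auto simp del: hyps.simps)
  then have "T \<turnstile> hyps G ((\<gamma> \<^bold>\<longrightarrow> \<phi> \<^bold>\<longrightarrow> \<psi>) \<^bold>\<longrightarrow> (\<gamma> \<^bold>\<longrightarrow> \<phi>) \<^bold>\<longrightarrow> \<gamma> \<^bold>\<longrightarrow> \<psi>)"
    by (intro hyps_lift Distrib) auto
  then show ?case using Cons by (metis hyps.simps(2))
qed

lemma imp_refl: "wf_fm [] \<phi> \<Longrightarrow> T \<turnstile> \<phi> \<^bold>\<longrightarrow> \<phi>"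
  using MP[OF MP[OF Distrib[of \<phi> "\<phi> \<^bold>\<longrightarrow> \<phi>" \<phi> T] Weaken[of \<phi> "\<phi> \<^bold>\<longrightarrow> \<phi>" T]] Weaken[of \<phi> \<phi> T]] by simp

lemma hyps_weaken: "T \<turnstile> hyps G \<phi> \<Longrightarrow> wf_fm [] \<gamma> \<Longrightarrow> T \<turnstile> hyps (\<gamma> # G) \<phi>"
proof -
  assume a: "T \<turnstile> hyps G \<phi>" "wf_fm [] \<gamma>"
  then have "wf_fm [] (hyps G \<phi>)" using derivable_wf by blast
  then have "T \<turnstile> hyps G (\<phi> \<^bold>\<longrightarrow> \<gamma> \<^bold>\<longrightarrow> \<phi>)" using a by (intro hyps_lift Weaken) auto
  then have "T \<turnstile> hyps G (\<gamma> \<^bold>\<longrightarrow> \<phi>)" using a(1) hyps_MP by blast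
  then show ?thesis by simp
qed

lemma hyps_append: "T \<turnstile> hyps G \<phi> \<Longrightarrow> wfs G' \<Longrightarrow> T \<turnstile> hyps (G' @ G) \<phi>"
  by (induction G') (simp_all add: hyps_weaken del: hyps.simps(2))

lemma hyps_mem: "\<gamma> \<in> set G \<Longrightarrow> wfs G \<Longrightarrow> T \<turnstile> hyps G \<gamma>"
proof (induction G)
  case (Cons \<delta> G)
  show ?case
  proof (cases "\<gamma> = \<delta>")
    case True
    then show ?thesis using Cons.prems by (auto intro!: hyps_lift imp_refl)
  next
    case False
    then show ?thesis using Cons by (intro hyps_weaken) auto
  qed
qed simp

text \<open>Proof by contradiction: the head hypothesis is the innermost antecedent, so the
  assumption literally derives the double negation of \<open>\<phi>\<close> from
  \<open>G\<close>.\<close>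

lemma hyps_DNeg: "T \<turnstile> hyps ((\<phi> \<^bold>\<longrightarrow> \<^bold>\<bottom>) # G) \<^bold>\<bottom> \<Longrightarrow> T \<turnstile> hyps G \<phi>"
proof -
  assume a: "T \<turnstile> hyps ((\<phi> \<^bold>\<longrightarrow> \<^bold>\<bottom>) # G) \<^bold>\<bottom>"
  then have "wf_fm [] (hyps ((\<phi> \<^bold>\<longrightarrow> \<^bold>\<bottom>) # G) \<^bold>\<bottom>)" using derivable_wf by blast
  then have "T \<turnstile> hyps G (\<^bold>\<not> \<^bold>\<not> \<phi> \<^bold>\<longrightarrow> \<phi>)" by (intro hyps_lift DNeg) (auto simp del: hyps.simps)
  then show ?thesis using a hyps_MP[of T G "\<^bold>\<not> \<^bold>\<not> \<phi>" \<phi>] by (simp add: neg_fm_def)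
qed

lemma hyps_FalsumE: "T \<turnstile> hyps G \<^bold>\<bottom> \<Longrightarrow> wf_fm [] \<phi> \<Longrightarrow> T \<turnstile> hyps G \<phi>"
  by (rule hyps_DNeg, rule hyps_weaken) auto

lemma hyps_append_eq: "hyps (G @ H) \<phi> = hyps H (hyps G \<phi>)"
  by (induction G arbitrary: \<phi>) auto

lemma fv_hyps: "fv (hyps G \<phi>) = fv \<phi> \<union> (\<Union>\<gamma>\<in>set G. fv \<gamma>)"
  by (induction G arbitrary: \<phi>) auto

lemma derivable_contrapos:
  assumes "T \<turnstile> (\<phi> \<^bold>\<longrightarrow> \<^bold>\<bottom>) \<^bold>\<longrightarrow> \<psi>"
  shows "T \<turnstile> (\<psi> \<^bold>\<longrightarrow> \<^bold>\<bottom>) \<^bold>\<longrightarrow> \<phi>"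
proof -
  let ?G = "[\<phi> \<^bold>\<longrightarrow> \<^bold>\<bottom>, \<psi> \<^bold>\<longrightarrow> \<^bold>\<bottom>]"
  have wf: "wf_fm [] \<phi>" "wf_fm [] \<psi>" using derivable_wf[OF assms] by auto
  have "T \<turnstile> hyps ?G \<psi>" using wf by (intro hyps_MP[OF hyps_lift[OF assms] hyps_mem]) auto
  moreover have "T \<turnstile> hyps ?G (\<psi> \<^bold>\<longrightarrow> \<^bold>\<bottom>)" using wf by (intro hyps_mem) auto
  ultimately have "T \<turnstile> hyps ?G \<^bold>\<bottom>" using hyps_MP by blast
  then have "T \<turnstile> hyps [\<psi> \<^bold>\<longrightarrow> \<^bold>\<bottom>] \<phi>" by (rule hyps_DNeg)
  then show ?thesis by simp
qed

text \<open>A fresh counterexample to a refuted universal formula adds no inconsistency: otherwise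
  the remaining hypotheses would prove the instance at the fresh variable, hence by generalisation
  the very formula that they refute.\<close>

lemma henkin_witness:
  assumes incons: "T \<turnstile> hyps ((open_fm 0 (Fr x \<sigma>) \<chi> \<^bold>\<longrightarrow> \<^bold>\<bottom>) # (Forall \<sigma> \<chi> \<^bold>\<longrightarrow> \<^bold>\<bottom>) # G) \<^bold>\<bottom>"
    and fresh: "(x, \<sigma>) \<notin> fv \<chi> \<union> (\<Union>\<gamma>\<in>set G. fv \<gamma>)"
  shows "T \<turnstile> hyps ((Forall \<sigma> \<chi> \<^bold>\<longrightarrow> \<^bold>\<bottom>) # G) \<^bold>\<bottom>"
proof -
  define \<theta> where "\<theta> = open_fm 0 (Fr x \<sigma>) \<chi>"
  define G' where "G' = (Forall \<sigma> \<chi> \<^bold>\<longrightarrow> \<^bold>\<bottom>) # G"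
  \<comment> \<open>\<open>AllDistrib\<close> moves a quantifier past a single antecedent, so the
    hypothesis list is packed into one formula: \<open>\<kappa>\<close> is classically the
    conjunction of \<open>G'\<close>, and \<open>x\<close> does not occur in it.\<close>
  define \<kappa> where "\<kappa> = (hyps G' \<^bold>\<bottom> \<^bold>\<longrightarrow> \<^bold>\<bottom>)"
  have wfall: "wf_fm [] (hyps ((\<theta> \<^bold>\<longrightarrow> \<^bold>\<bottom>) # G') \<^bold>\<bottom>)"
    using derivable_wf[OF incons] by (simp add: G'_def \<theta>_def)
  then have wf: "wfs G'" "wf_fm [] \<theta>" by auto
  have theta: "T \<turnstile> hyps G' \<theta>"
    using incons unfolding G'_def \<theta>_def by (rule hyps_DNeg)
  have "T \<turnstile> \<kappa> \<^bold>\<longrightarrow> \<theta>"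
  proof -
    let ?H = "[\<theta> \<^bold>\<longrightarrow> \<^bold>\<bottom>, \<kappa>]"
    have wfH: "wfs ?H" using wf by (auto simp: \<kappa>_def)
    have "T \<turnstile> hyps (G' @ ?H) \<theta>"
      unfolding hyps_append_eq using theta wfH by (rule hyps_lift)
    moreover have "T \<turnstile> hyps (G' @ ?H) (\<theta> \<^bold>\<longrightarrow> \<^bold>\<bottom>)"
      using wf wfH by (intro hyps_mem) auto
    ultimately have "T \<turnstile> hyps ?H (hyps G' \<^bold>\<bottom>)"
      unfolding hyps_append_eq[symmetric] using hyps_MP by blast
    moreover have "T \<turnstile> hyps ?H (hyps G' \<^bold>\<bottom> \<^bold>\<longrightarrow> \<^bold>\<bottom>)"
      using wfH by (intro hyps_mem) (auto simp: \<kappa>_def)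
    ultimately have "T \<turnstile> hyps ?H \<^bold>\<bottom>" using hyps_MP by blast
    then have "T \<turnstile> hyps [\<kappa>] \<theta>" by (rule hyps_DNeg)
    then show ?thesis by simp
  qed
  then have "T \<turnstile> \<^bold>\<forall>x:\<sigma>. \<kappa> \<^bold>\<longrightarrow> \<theta>" by (rule Gen)
  moreover have "(x, \<sigma>) \<notin> fv \<kappa>" using fresh by (auto simp: \<kappa>_def fv_hyps G'_def)
  moreover have "wf_fm [] \<kappa>" using wf by (auto simp: \<kappa>_def)
  ultimately have "T \<turnstile> \<kappa> \<^bold>\<longrightarrow> (\<^bold>\<forall>x:\<sigma>. \<theta>)" using wf by (metis AllDistrib MP)
  then have "T \<turnstile> \<kappa> \<^bold>\<longrightarrow> Forall \<sigma> \<chi>" using fresh by (simp add: \<theta>_def all_open)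
  then have "T \<turnstile> (Forall \<sigma> \<chi> \<^bold>\<longrightarrow> \<^bold>\<bottom>) \<^bold>\<longrightarrow> hyps G' \<^bold>\<bottom>"
    unfolding \<kappa>_def by (rule derivable_contrapos)
  then have "T \<turnstile> hyps G' ((Forall \<sigma> \<chi> \<^bold>\<longrightarrow> \<^bold>\<bottom>) \<^bold>\<longrightarrow> hyps G' \<^bold>\<bottom>)" using wf hyps_lift by blast
  moreover have "T \<turnstile> hyps G' (Forall \<sigma> \<chi> \<^bold>\<longrightarrow> \<^bold>\<bottom>)" using wf by (intro hyps_mem) (auto simp: G'_def)
  ultimately have 1: "T \<turnstile> hyps G' (hyps G' \<^bold>\<bottom>)" using hyps_MP by blast
  \<comment> \<open>The contraposition leaves the hypotheses \<open>G'\<close> in two copies; the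
    inner copy is discharged against the outer one.\<close>
  have contract: "T \<turnstile> hyps G (hyps H \<phi>) \<Longrightarrow> set H \<subseteq> set G \<Longrightarrow> wfs G \<Longrightarrow> T \<turnstile> hyps G \<phi>" for G H \<phi>
  proof (induction H arbitrary: \<phi>)
    case (Cons \<gamma> H)
    then have "T \<turnstile> hyps G (\<gamma> \<^bold>\<longrightarrow> \<phi>)" by auto
    moreover have "T \<turnstile> hyps G \<gamma>" using Cons.prems by (intro hyps_mem) auto
    ultimately show ?case using hyps_MP by blast
  qed simp
  show ?thesis using contract[OF 1] wf by (simp add: G'_def)
qed

section \<open>Completeness\<close>

text \<open>
  A set closed under these conditions is a maximal consistent set with Henkin witnesses. Since \<open>Gen\<close>
  is unrestricted, the axioms of a theory never constrain the free variables, which therefore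
  serve as Henkin constants.
\<close>

definition henkin :: "fm set \<Rightarrow> fm set \<Rightarrow> bool" where
  "henkin T D \<longleftrightarrow>
    (\<forall>\<phi>. (T \<turnstile> \<phi>) \<longrightarrow> \<phi> \<in> D) \<and> \<^bold>\<bottom> \<notin> D \<and>
    (\<forall>\<phi> \<psi>. wf_fm [] \<phi> \<longrightarrow> wf_fm [] \<psi> \<longrightarrow> (\<phi> \<^bold>\<longrightarrow> \<psi>) \<in> D \<longleftrightarrow> (\<phi> \<in> D \<longrightarrow> \<psi> \<in> D)) \<and>
    (\<forall>\<sigma> \<chi>. wf_fm [\<sigma>] \<chi> \<longrightarrow> Forall \<sigma> \<chi> \<in> D \<longleftrightarrow> (\<forall>t. tyof [] t = Some \<sigma> \<longrightarrow> open_fm 0 t \<chi> \<in> D))"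

definition fresh_var :: "(string \<times> ty) set \<Rightarrow> ty \<Rightarrow> string" where
  "fresh_var V \<sigma> = (SOME x. (x, \<sigma>) \<notin> V)"

lemma fresh_var: "finite V \<Longrightarrow> (fresh_var V \<sigma>, \<sigma>) \<notin> V"
  unfolding fresh_var_def by (rule someI_ex) (rule fresh_exists)

fun witness :: "fm list \<Rightarrow> fm \<Rightarrow> fm list" where
  "witness G (Forall \<sigma> \<chi> \<^bold>\<longrightarrow> \<^bold>\<bottom>) =
    [open_fm 0 (Fr (fresh_var (fv \<chi> \<union> (\<Union>\<gamma>\<in>set G. fv \<gamma>)) \<sigma>) \<sigma>) \<chi> \<^bold>\<longrightarrow> \<^bold>\<bottom>]"
| "witness G _ = []"

text \<open>Nothing is recorded for a rejected formula: its negation already follows from the stage,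
  because an inconsistency with \<open>\<phi>\<close> at the head of the list unfolds to a
  derivation of the negation of \<open>\<phi>\<close> from \<open>G\<close>.\<close>

primrec lindenbaum :: "fm set \<Rightarrow> fm \<Rightarrow> nat \<Rightarrow> fm list" where
  "lindenbaum T \<gamma> 0 = [\<gamma>]"
| "lindenbaum T \<gamma> (Suc n) = (let G = lindenbaum T \<gamma> n; \<phi> = from_nat n in
    if wf_fm [] \<phi> \<and> \<not> (T \<turnstile> hyps (\<phi> # G) \<^bold>\<bottom>) then witness G \<phi> @ \<phi> # G else G)"

lemma witness_cases:
  obtains "witness G \<phi> = []"
  | \<sigma> \<chi> x where "\<phi> = (Forall \<sigma> \<chi> \<^bold>\<longrightarrow> \<^bold>\<bottom>)" "(x, \<sigma>) \<notin> fv \<chi> \<union> (\<Union>\<gamma>\<in>set G. fv \<gamma>)"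
      "witness G \<phi> = [open_fm 0 (Fr x \<sigma>) \<chi> \<^bold>\<longrightarrow> \<^bold>\<bottom>]"
proof (cases "\<exists>\<sigma> \<chi>. \<phi> = (Forall \<sigma> \<chi> \<^bold>\<longrightarrow> \<^bold>\<bottom>)")
  case True
  then obtain \<sigma> \<chi> where "\<phi> = (Forall \<sigma> \<chi> \<^bold>\<longrightarrow> \<^bold>\<bottom>)" by blast
  moreover have "(fresh_var (fv \<chi> \<union> (\<Union>\<gamma>\<in>set G. fv \<gamma>)) \<sigma>, \<sigma>) \<notin> fv \<chi> \<union> (\<Union>\<gamma>\<in>set G. fv \<gamma>)"
    by (rule fresh_var) (auto simp: finite_fv)
  ultimately show ?thesis using that(2) by auto
next
  case False
  then have "witness G \<phi> = []" by (cases "(G, \<phi>)" rule: witness.cases) auto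
  then show ?thesis using that(1) by blast
qed

lemma wfs_witness: "wf_fm [] \<phi> \<Longrightarrow> wfs (witness G \<phi>)"
  by (rule witness_cases[of G \<phi>]) (use wf_open[of "[]"] in auto)

lemma wfs_lindenbaum: "wf_fm [] \<gamma> \<Longrightarrow> wfs (lindenbaum T \<gamma> n)"
proof (induction n)
  case (Suc n)
  then show ?case using wfs_witness[of "from_nat n" "lindenbaum T \<gamma> n"] by (auto simp: Let_def)
qed simp

lemma lindenbaum_consistent:
  assumes "\<not> (T \<turnstile> hyps [\<gamma>] \<^bold>\<bottom>)"
  shows "\<not> (T \<turnstile> hyps (lindenbaum T \<gamma> n) \<^bold>\<bottom>)"
proof (induction n)
  case (Suc n)
  show ?case
  proof (rule witness_cases[of "lindenbaum T \<gamma> n" "from_nat n"])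
    fix \<sigma> \<chi> x
    assume "from_nat n = (Forall \<sigma> \<chi> \<^bold>\<longrightarrow> \<^bold>\<bottom>)" "(x, \<sigma>) \<notin> fv \<chi> \<union> (\<Union>\<gamma>\<in>set (lindenbaum T \<gamma> n). fv \<gamma>)"
      "witness (lindenbaum T \<gamma> n) (from_nat n) = [open_fm 0 (Fr x \<sigma>) \<chi> \<^bold>\<longrightarrow> \<^bold>\<bottom>]"
    then show ?thesis using Suc henkin_witness[of T x \<sigma> \<chi> "lindenbaum T \<gamma> n"]
      by (auto simp: Let_def simp del: hyps.simps)
  qed (use Suc in \<open>auto simp: Let_def simp del: hyps.simps\<close>)
qed (use assms in simp)

lemma lindenbaum_mono: "n \<le> m \<Longrightarrow> \<exists>G. lindenbaum T \<gamma> m = G @ lindenbaum T \<gamma> n"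
proof (induction m rule: dec_induct)
  case (step m)
  then obtain G where "lindenbaum T \<gamma> m = G @ lindenbaum T \<gamma> n" by blast
  moreover have "\<exists>H. lindenbaum T \<gamma> (Suc m) = H @ lindenbaum T \<gamma> m"
    by (auto simp: Let_def)
  ultimately show ?case by (metis append.assoc)
qed simp

theorem henkin_exists:
  assumes wf: "wf_fm [] \<phi>" and unprov: "\<not> (T \<turnstile> \<phi>)"
  shows "\<exists>D. henkin T D \<and> \<phi> \<notin> D"
proof -
  define \<Gamma> where "\<Gamma> = lindenbaum T (\<phi> \<^bold>\<longrightarrow> \<^bold>\<bottom>)"
  \<comment> \<open>All consequences of the stages are taken, not only the formulas added. Negations
    of rejected formulas thereby belong to \<open>D\<close>, and closure under modus ponens needs
    only a common later stage.\<close>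
  define D where "D = {\<psi>. \<exists>n. (T \<turnstile> hyps (\<Gamma> n) \<psi>)}"
  have wfs: "wfs (\<Gamma> n)" for n unfolding \<Gamma>_def by (rule wfs_lindenbaum) (simp add: wf)
  have "\<not> (T \<turnstile> hyps [\<phi> \<^bold>\<longrightarrow> \<^bold>\<bottom>] \<^bold>\<bottom>)" using unprov hyps_DNeg[of T \<phi> "[]"] by auto
  then have cons: "\<not> (T \<turnstile> hyps (\<Gamma> n) \<^bold>\<bottom>)" for n
    unfolding \<Gamma>_def by (rule lindenbaum_consistent)
  have mono: "T \<turnstile> hyps (\<Gamma> m) \<psi>" if le: "n \<le> m" and \<psi>: "T \<turnstile> hyps (\<Gamma> n) \<psi>" for n m \<psi>
  proof -
    obtain G where "\<Gamma> m = G @ \<Gamma> n" using lindenbaum_mono[OF le] unfolding \<Gamma>_def by blast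
    then show ?thesis using hyps_append[OF \<psi>, of G] wfs[of m] by auto
  qed
  have D_MP: "\<chi> \<in> D" if "(\<psi> \<^bold>\<longrightarrow> \<chi>) \<in> D" "\<psi> \<in> D" for \<psi> \<chi>
  proof -
    from that obtain n m where "T \<turnstile> hyps (\<Gamma> n) (\<psi> \<^bold>\<longrightarrow> \<chi>)" "T \<turnstile> hyps (\<Gamma> m) \<psi>" unfolding D_def by blast
    then have "T \<turnstile> hyps (\<Gamma> (max n m)) (\<psi> \<^bold>\<longrightarrow> \<chi>)" "T \<turnstile> hyps (\<Gamma> (max n m)) \<psi>"
      using mono[of n "max n m"] mono[of m "max n m"] by auto
    then show ?thesis using hyps_MP unfolding D_def by blast
  qed
  have D_deriv: "\<psi> \<in> D" if "T \<turnstile> \<psi>" for \<psi>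
    using that hyps_lift wfs unfolding D_def by blast
  have D_bot: "\<^bold>\<bottom> \<notin> D" using cons unfolding D_def by blast
  \<comment> \<open>Each formula is treated at the stage given by its own code, so completeness and
    witnesses can both be read off from that one stage.\<close>
  have D_added: "\<psi> \<in> D \<and> (\<forall>\<chi>\<in>set (witness (\<Gamma> (to_nat \<psi>)) \<psi>). \<chi> \<in> D) \<or> (\<psi> \<^bold>\<longrightarrow> \<^bold>\<bottom>) \<in> D"
    if "wf_fm [] \<psi>" for \<psi>
  proof (cases "T \<turnstile> hyps (\<psi> # \<Gamma> (to_nat \<psi>)) \<^bold>\<bottom>")
    case True
    then show ?thesis unfolding D_def by auto
  next
    case False
    then have "\<Gamma> (Suc (to_nat \<psi>)) = witness (\<Gamma> (to_nat \<psi>)) \<psi> @ \<psi> # \<Gamma> (to_nat \<psi>)"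
      using that by (simp add: \<Gamma>_def Let_def del: hyps.simps)
    then have "\<chi> \<in> D" if "\<chi> \<in> insert \<psi> (set (witness (\<Gamma> (to_nat \<psi>)) \<psi>))" for \<chi>
      using that hyps_mem[of \<chi> "\<Gamma> (Suc (to_nat \<psi>))" T] wfs[of "Suc (to_nat \<psi>)"] unfolding D_def by fastforce
    then show ?thesis by blast
  qed
  have D_neg: "(\<psi> \<^bold>\<longrightarrow> \<^bold>\<bottom>) \<in> D \<longleftrightarrow> \<psi> \<notin> D" if "wf_fm [] \<psi>" for \<psi>
    using D_added[OF that] D_MP D_bot by blast
  have D_imp: "(\<psi> \<^bold>\<longrightarrow> \<chi>) \<in> D \<longleftrightarrow> (\<psi> \<in> D \<longrightarrow> \<chi> \<in> D)" if "wf_fm [] \<psi>" "wf_fm [] \<chi>" for \<psi> \<chi>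
  proof (intro iffI impI)
    assume r: "\<psi> \<in> D \<longrightarrow> \<chi> \<in> D"
    show "(\<psi> \<^bold>\<longrightarrow> \<chi>) \<in> D"
    proof (cases "\<psi> \<in> D")
      case True
      then show ?thesis using r D_MP D_deriv[OF Weaken[of \<chi> \<psi>]] that by blast
    next
      case False
      then have "(\<psi> \<^bold>\<longrightarrow> \<^bold>\<bottom>) \<in> D" using D_neg that by blast
      moreover have "T \<turnstile> hyps [\<psi>, \<psi> \<^bold>\<longrightarrow> \<^bold>\<bottom>] \<chi>"
        by (rule hyps_FalsumE, rule hyps_MP[of T _ \<psi>]; (rule hyps_mem)?) (use that in auto)
      then have "T \<turnstile> (\<psi> \<^bold>\<longrightarrow> \<^bold>\<bottom>) \<^bold>\<longrightarrow> \<psi> \<^bold>\<longrightarrow> \<chi>" by simp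
      ultimately show ?thesis using D_MP D_deriv by blast
    qed
  qed (use D_MP in blast)
  have D_all: "Forall \<sigma> \<chi> \<in> D \<longleftrightarrow> (\<forall>t. tyof [] t = Some \<sigma> \<longrightarrow> open_fm 0 t \<chi> \<in> D)"
    if wfc: "wf_fm [\<sigma>] \<chi>" for \<sigma> \<chi>
  proof (intro iffI allI impI)
    fix t assume "Forall \<sigma> \<chi> \<in> D" and t: "tyof [] t = Some \<sigma>"
    obtain x where x: "(x, \<sigma>) \<notin> fv \<chi>" using fresh_exists finite_fv by blast
    have "wf_fm [] (open_fm 0 (Fr x \<sigma>) \<chi>)" using wf_open[of "[]" \<sigma> \<chi>] wfc by simp
    then have "T \<turnstile> Forall \<sigma> \<chi> \<^bold>\<longrightarrow> open_fm 0 t \<chi>"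
      using Inst[OF _ t, of "open_fm 0 (Fr x \<sigma>) \<chi>" T x] x by (simp add: all_open subst_open)
    then show "open_fm 0 t \<chi> \<in> D" using D_MP D_deriv \<open>Forall \<sigma> \<chi> \<in> D\<close> by blast
  next
    assume inst: "\<forall>t. tyof [] t = Some \<sigma> \<longrightarrow> open_fm 0 t \<chi> \<in> D"
    let ?\<psi> = "Forall \<sigma> \<chi> \<^bold>\<longrightarrow> \<^bold>\<bottom>"
    show "Forall \<sigma> \<chi> \<in> D"
    proof (rule ccontr)
      assume "Forall \<sigma> \<chi> \<notin> D"
      then have "?\<psi> \<in> D" and "(?\<psi> \<^bold>\<longrightarrow> \<^bold>\<bottom>) \<notin> D" using D_neg wfc by auto
      then obtain x where "(open_fm 0 (Fr x \<sigma>) \<chi> \<^bold>\<longrightarrow> \<^bold>\<bottom>) \<in> D"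
        using D_added[of ?\<psi>] wfc by auto
      moreover have "open_fm 0 (Fr x \<sigma>) \<chi> \<in> D" using inst by simp
      ultimately show False using D_MP D_bot by blast
    qed
  qed
  have "(\<phi> \<^bold>\<longrightarrow> \<^bold>\<bottom>) \<in> D"
    using hyps_mem[of "\<phi> \<^bold>\<longrightarrow> \<^bold>\<bottom>" "\<Gamma> 0" T] wfs[of 0] unfolding D_def \<Gamma>_def by fastforce
  then have "\<phi> \<notin> D" using D_MP D_bot by blast
  then show ?thesis unfolding henkin_def using D_deriv D_bot D_imp D_all by blast
qed

section \<open>Semantics\<close>

text \<open>The interpretation of equality is a parameter because the same evaluation is used twice:
  on raw terms with provable equality, and on the extensional quotient with identity. Evaluation
  applies \<open>cst\<close> to constant symbols only.\<close>

locale semantics =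
  fixes dom :: "ty \<Rightarrow> 'u set" and app :: "'u \<Rightarrow> 'u \<Rightarrow> 'u" and cst :: "tm \<Rightarrow> 'u"
    and eqr :: "'u \<Rightarrow> 'u \<Rightarrow> bool"
begin

primrec evt :: "(string \<times> ty \<Rightarrow> 'u) \<Rightarrow> 'u list \<Rightarrow> tm \<Rightarrow> 'u" where
  "evt \<rho> bs (Fr x \<sigma>) = \<rho> (x, \<sigma>)"
| "evt \<rho> bs (Bd i) = bs ! i"
| "evt \<rho> bs Zero = cst Zero"
| "evt \<rho> bs Succ = cst Succ"
| "evt \<rho> bs (Kc \<sigma> \<tau>) = cst (Kc \<sigma> \<tau>)"
| "evt \<rho> bs (Sc \<sigma> \<tau> \<upsilon>) = cst (Sc \<sigma> \<tau> \<upsilon>)"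
| "evt \<rho> bs Rec = cst Rec"
| "evt \<rho> bs (s \<cdot> t) = app (evt \<rho> bs s) (evt \<rho> bs t)"

primrec ev :: "(string \<times> ty \<Rightarrow> 'u) \<Rightarrow> 'u list \<Rightarrow> fm \<Rightarrow> bool" where
  "ev \<rho> bs (s \<^bold>= t) = eqr (evt \<rho> bs s) (evt \<rho> bs t)"
| "ev \<rho> bs \<^bold>\<bottom> = False"
| "ev \<rho> bs (\<phi> \<^bold>\<longrightarrow> \<psi>) = (ev \<rho> bs \<phi> \<longrightarrow> ev \<rho> bs \<psi>)"
| "ev \<rho> bs (Forall \<sigma> \<phi>) = (\<forall>a\<in>dom \<sigma>. ev \<rho> (a # bs) \<phi>)"

definition typed :: "(string \<times> ty \<Rightarrow> 'u) \<Rightarrow> bool" where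
  "typed \<rho> \<longleftrightarrow> (\<forall>x \<sigma>. \<rho> (x, \<sigma>) \<in> dom \<sigma>)"

lemma typed_upd [simp]: "typed \<rho> \<Longrightarrow> a \<in> dom \<sigma> \<Longrightarrow> typed (\<rho>((x, \<sigma>) := a))"
  by (auto simp: typed_def)

lemma ev_neg [simp]: "ev \<rho> bs (\<^bold>\<not> \<phi>) \<longleftrightarrow> \<not> ev \<rho> bs \<phi>"
  by (simp add: neg_fm_def)

lemma ev_conj [simp]: "ev \<rho> bs (\<phi> \<^bold>\<and> \<psi>) \<longleftrightarrow> ev \<rho> bs \<phi> \<and> ev \<rho> bs \<psi>"
  by (simp add: conj_fm_def)

lemma ev_disj [simp]: "ev \<rho> bs (\<phi> \<^bold>\<or> \<psi>) \<longleftrightarrow> ev \<rho> bs \<phi> \<or> ev \<rho> bs \<psi>"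
  by (auto simp: disj_fm_def)

lemma ev_iff [simp]: "ev \<rho> bs (\<phi> \<^bold>\<longleftrightarrow> \<psi>) \<longleftrightarrow> (ev \<rho> bs \<phi> \<longleftrightarrow> ev \<rho> bs \<psi>)"
  by (auto simp: iff_fm_def)

lemma evt_bind:
  "tyof \<Delta> t = Some \<tau> \<Longrightarrow> length bs = length \<Delta> \<Longrightarrow>
    evt \<rho> (bs @ a # cs) (subst_tm x \<sigma> (Bd (length bs)) t) = evt (\<rho>((x, \<sigma>) := a)) (bs @ ds) t"
  by (induction t arbitrary: \<tau>) (auto simp: nth_append tyof_App simp del: tyof.simps(8) split: if_splits)

text \<open>Generalised over the prefix \<open>bs\<close> of binders that the recursion of
  \<open>bind_fm\<close> has passed. The tails \<open>cs\<close> and \<open>ds\<close> may differ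
  because a formula well-formed in \<open>\<Delta>\<close> never looks beyond
  \<open>bs\<close>.\<close>

lemma ev_bind:
  "wf_fm \<Delta> \<phi> \<Longrightarrow> length bs = length \<Delta> \<Longrightarrow>
    ev \<rho> (bs @ a # cs) (bind_fm (length bs) x \<sigma> \<phi>) \<longleftrightarrow> ev (\<rho>((x, \<sigma>) := a)) (bs @ ds) \<phi>"
proof (induction \<phi> arbitrary: \<Delta> bs)
  case (Eq s t)
  then have "evt \<rho> (bs @ a # cs) (subst_tm x \<sigma> (Bd (length bs)) s) = evt (\<rho>((x, \<sigma>) := a)) (bs @ ds) s"
    "evt \<rho> (bs @ a # cs) (subst_tm x \<sigma> (Bd (length bs)) t) = evt (\<rho>((x, \<sigma>) := a)) (bs @ ds) t"
    using evt_bind[of \<Delta>] by auto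
  then show ?case by (simp only: ev.simps bind_fm.simps)
next
  case (Imp \<phi> \<psi>)
  then show ?case using Imp.IH[of \<Delta> bs] by simp
next
  case (Forall \<tau> \<phi>)
  then show ?case using Forall.IH[of "\<tau> # \<Delta>" "b # bs" for b] by simp
qed simp

lemma ev_all [simp]:
  "wf_fm [] \<phi> \<Longrightarrow> ev \<rho> bs (\<^bold>\<forall>x:\<sigma>. \<phi>) \<longleftrightarrow> (\<forall>a\<in>dom \<sigma>. ev (\<rho>((x, \<sigma>) := a)) [] \<phi>)"
  using ev_bind[of "[]" \<phi> "[]" \<rho> _ bs x \<sigma> "[]"] by (simp add: all_fm_def)

lemma ev_ex [simp]:
  "wf_fm [] \<phi> \<Longrightarrow> ev \<rho> bs (\<^bold>\<exists>x:\<sigma>. \<phi>) \<longleftrightarrow> (\<exists>a\<in>dom \<sigma>. ev (\<rho>((x, \<sigma>) := a)) [] \<phi>)"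
  by (simp add: ex_fm_def)

lemma evt_shift [simp]: "evt \<rho> (a # bs) (shift t) = evt \<rho> bs t"
  by (induction t) auto

lemma evt_closed: "tyof [] t = Some \<tau> \<Longrightarrow> evt \<rho> bs t = evt \<rho> [] t"
  by (induction t arbitrary: \<tau>) (auto simp: tyof_App simp del: tyof.simps(8))

lemma evt_subst:
  "tyof [] u = Some \<upsilon> \<Longrightarrow> evt \<rho> bs (subst_tm x \<sigma> u t) = evt (\<rho>((x, \<sigma>) := evt \<rho> [] u)) bs t"
  by (induction t) (auto intro: evt_closed)

lemma ev_subst:
  "tyof [] u = Some \<upsilon> \<Longrightarrow> ev \<rho> bs (subst x \<sigma> u \<phi>) \<longleftrightarrow> ev (\<rho>((x, \<sigma>) := evt \<rho> [] u)) bs \<phi>"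
  by (induction \<phi> arbitrary: bs) (auto simp: evt_subst)

lemma evt_cong: "(\<And>v. v \<in> fv_tm t \<Longrightarrow> \<rho> v = \<rho>' v) \<Longrightarrow> evt \<rho> bs t = evt \<rho>' bs t"
  by (induction t) auto

lemma ev_cong: "(\<And>v. v \<in> fv \<phi> \<Longrightarrow> \<rho> v = \<rho>' v) \<Longrightarrow> ev \<rho> bs \<phi> \<longleftrightarrow> ev \<rho>' bs \<phi>"
proof (induction \<phi> arbitrary: bs)
  case (Eq s t)
  then show ?case using evt_cong[of s \<rho> \<rho>' bs] evt_cong[of t \<rho> \<rho>' bs] by simp
qed auto

fun eqv :: "ty \<Rightarrow> 'u \<Rightarrow> 'u \<Rightarrow> bool" where
  "eqv TNat a b = eqr a b"
| "eqv (\<sigma> \<Rrightarrow> \<tau>) a b = (\<forall>c\<in>dom \<sigma>. eqv \<tau> (app a c) (app b c))"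

lemma ev_eq_at: "ev \<rho> bs (eq_at \<sigma> s t) \<longleftrightarrow> eqv \<sigma> (evt \<rho> bs s) (evt \<rho> bs t)"
  by (induction \<sigma> arbitrary: s t bs) auto

end

lemma tyof_shift: "tyof (\<sigma> # \<Delta>) (shift t) = tyof \<Delta> t"
proof (induction t)
  case (App s t)
  show ?case unfolding shift.simps tyof.simps(8) App ..
qed auto

lemma tyof_shift_App:
  "tyof (\<sigma> # \<Delta>) (shift s \<cdot> Bd 0) = Some \<tau> \<longleftrightarrow> tyof \<Delta> s = Some (\<sigma> \<Rrightarrow> \<tau>)"
  unfolding tyof_App tyof_shift by simp

lemma wf_eq_at [simp]:
  "wf_fm \<Delta> (eq_at \<sigma> s t) \<longleftrightarrow> tyof \<Delta> s = Some \<sigma> \<and> tyof \<Delta> t = Some \<sigma>"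
  by (induction \<sigma> arbitrary: s t \<Delta>) (simp_all add: tyof_shift_App del: tyof.simps(8))

section \<open>The term model\<close>

text \<open>Evaluation in the model of raw terms is simultaneous substitution: \<open>\<rho>\<close>
  for the free variables and \<open>bs\<close> for the loose indices from \<open>k\<close> upwards,
  where \<open>k\<close> counts the binders already passed.\<close>

primrec inst_tm :: "(string \<times> ty \<Rightarrow> tm) \<Rightarrow> tm list \<Rightarrow> nat \<Rightarrow> tm \<Rightarrow> tm" where
  "inst_tm \<rho> bs k (Fr x \<sigma>) = \<rho> (x, \<sigma>)"
| "inst_tm \<rho> bs k (Bd i) = (if i < k then Bd i else bs ! (i - k))"
| "inst_tm \<rho> bs k Zero = Zero"
| "inst_tm \<rho> bs k Succ = Succ"
| "inst_tm \<rho> bs k (Kc \<sigma> \<tau>) = Kc \<sigma> \<tau>"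
| "inst_tm \<rho> bs k (Sc \<sigma> \<tau> \<upsilon>) = Sc \<sigma> \<tau> \<upsilon>"
| "inst_tm \<rho> bs k Rec = Rec"
| "inst_tm \<rho> bs k (s \<cdot> t) = inst_tm \<rho> bs k s \<cdot> inst_tm \<rho> bs k t"

primrec inst_fm :: "(string \<times> ty \<Rightarrow> tm) \<Rightarrow> tm list \<Rightarrow> nat \<Rightarrow> fm \<Rightarrow> fm" where
  "inst_fm \<rho> bs k (s \<^bold>= t) = (inst_tm \<rho> bs k s \<^bold>= inst_tm \<rho> bs k t)"
| "inst_fm \<rho> bs k \<^bold>\<bottom> = \<^bold>\<bottom>"
| "inst_fm \<rho> bs k (\<phi> \<^bold>\<longrightarrow> \<psi>) = (inst_fm \<rho> bs k \<phi> \<^bold>\<longrightarrow> inst_fm \<rho> bs k \<psi>)"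
| "inst_fm \<rho> bs k (Forall \<sigma> \<phi>) = Forall \<sigma> (inst_fm \<rho> bs (Suc k) \<phi>)"

definition terms :: "ty \<Rightarrow> tm set" where
  "terms \<sigma> = {t. tyof [] t = Some \<sigma>}"

lemma open_closed: "tyof [] t = Some \<tau> \<Longrightarrow> open_tm k u t = t"
  by (induction t arbitrary: \<tau>) (auto simp: tyof_App simp del: tyof.simps(8))

definition typing :: "(string \<times> ty \<Rightarrow> tm) \<Rightarrow> ty list \<Rightarrow> tm list \<Rightarrow> bool" where
  "typing \<rho> \<Delta> bs \<longleftrightarrow> (\<forall>x \<sigma>. tyof [] (\<rho> (x, \<sigma>)) = Some \<sigma>) \<and> list_all2 (\<lambda>u \<sigma>. tyof [] u = Some \<sigma>) bs \<Delta>"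

lemma typing_Cons [simp]: "typing \<rho> (\<sigma> # \<Delta>) (u # bs) \<longleftrightarrow> tyof [] u = Some \<sigma> \<and> typing \<rho> \<Delta> bs"
  by (auto simp: typing_def)

lemma typing_nth: "typing \<rho> \<Delta> bs \<Longrightarrow> i < length \<Delta> \<Longrightarrow> tyof [] (bs ! i) = Some (\<Delta> ! i)"
  by (auto simp: typing_def list_all2_conv_all_nth)

lemma tyof_inst:
  "tyof (\<Gamma> @ \<Delta>) t = Some \<tau> \<Longrightarrow> typing \<rho> \<Delta> bs \<Longrightarrow> tyof \<Gamma> (inst_tm \<rho> bs (length \<Gamma>) t) = Some \<tau>"
proof (induction t arbitrary: \<tau>)
  case (Fr x \<sigma>)
  then have "tyof [] (\<rho> (x, \<sigma>)) = Some \<tau>" by (simp add: typing_def)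
  then show ?case unfolding inst_tm.simps by (rule tyof_closed)
next
  case (Bd i)
  show ?case
  proof (cases "i < length \<Gamma>")
    case False
    then have "tyof [] (bs ! (i - length \<Gamma>)) = Some \<tau>"
      using typing_nth[of \<rho> \<Delta> bs "i - length \<Gamma>"] Bd by (auto simp: nth_append split: if_splits)
    then have "tyof \<Gamma> (bs ! (i - length \<Gamma>)) = Some \<tau>" by (rule tyof_closed)
    then show ?thesis using False by simp
  qed (use Bd in \<open>auto simp: nth_append split: if_splits\<close>)
qed (auto simp: tyof_App simp del: tyof.simps(8))

lemma wf_inst: "wf_fm (\<Gamma> @ \<Delta>) \<phi> \<Longrightarrow> typing \<rho> \<Delta> bs \<Longrightarrow> wf_fm \<Gamma> (inst_fm \<rho> bs (length \<Gamma>) \<phi>)"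
proof (induction \<phi> arbitrary: \<Gamma>)
  case (Forall \<tau> \<phi>)
  then show ?case using Forall.IH[of "\<tau> # \<Gamma>"] by simp
qed (auto simp: tyof_inst)

lemma open_inst_tm:
  "tyof (\<Gamma> @ \<sigma> # \<Delta>) t = Some \<tau> \<Longrightarrow> typing \<rho> \<Delta> bs \<Longrightarrow>
    open_tm (length \<Gamma>) u (inst_tm \<rho> bs (Suc (length \<Gamma>)) t) = inst_tm \<rho> (u # bs) (length \<Gamma>) t"
proof (induction t arbitrary: \<tau>)
  case (Fr x \<upsilon>)
  then show ?case using open_closed[of "\<rho> (x, \<upsilon>)"] by (auto simp: typing_def)
next
  case (Bd i)
  show ?case
  proof (cases "i \<le> length \<Gamma>")
    case False
    then obtain j where i: "i = Suc (length \<Gamma> + j)" by (metis less_imp_Suc_add not_le)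
    then have "tyof [] (bs ! j) = Some (\<Delta> ! j)"
      using Bd typing_nth[of \<rho> \<Delta> bs j] by (auto split: if_splits)
    then show ?thesis using open_closed i by simp
  qed auto
qed (auto simp: tyof_App simp del: tyof.simps(8))

lemma open_inst:
  "wf_fm (\<Gamma> @ \<sigma> # \<Delta>) \<phi> \<Longrightarrow> typing \<rho> \<Delta> bs \<Longrightarrow>
    open_fm (length \<Gamma>) u (inst_fm \<rho> bs (Suc (length \<Gamma>)) \<phi>) = inst_fm \<rho> (u # bs) (length \<Gamma>) \<phi>"
proof (induction \<phi> arbitrary: \<Gamma>)
  case (Eq s t)
  then show ?case using open_inst_tm by fastforce
next
  case (Forall \<tau> \<phi>)
  then show ?case using Forall.IH[of "\<tau> # \<Gamma>"] by simp
qed auto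

lemma inst_id_tm: "tyof \<Gamma> t = Some \<tau> \<Longrightarrow> inst_tm (\<lambda>(x, \<sigma>). Fr x \<sigma>) [] (length \<Gamma>) t = t"
  by (induction t arbitrary: \<tau>) (auto simp: tyof_App simp del: tyof.simps(8) split: if_splits)

lemma inst_id: "wf_fm \<Gamma> \<phi> \<Longrightarrow> inst_fm (\<lambda>(x, \<sigma>). Fr x \<sigma>) [] (length \<Gamma>) \<phi> = \<phi>"
proof (induction \<phi> arbitrary: \<Gamma>)
  case (Forall \<tau> \<phi>)
  then show ?case using Forall.IH[of "\<tau> # \<Gamma>"] by simp
qed (auto simp: inst_id_tm)

text \<open>Soundness is put in as the assumption \<open>valid\<close>, under every assignment. For
  the model constructed below it comes from the Henkin set, so no induction over derivations in a
  structure is needed.\<close>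

locale model = semantics dom app cst "(=)"
  for dom :: "ty \<Rightarrow> 'u set" and app cst +
  fixes T :: "fm set"
  assumes app_dom [simp]: "a \<in> dom (\<sigma> \<Rrightarrow> \<tau>) \<Longrightarrow> b \<in> dom \<sigma> \<Longrightarrow> app a b \<in> dom \<tau>"
    and evt_dom: "typed \<rho> \<Longrightarrow> tyof [] t = Some \<tau> \<Longrightarrow> evt \<rho> [] t \<in> dom \<tau>"
    and ext: "a \<in> dom (\<sigma> \<Rrightarrow> \<tau>) \<Longrightarrow> b \<in> dom (\<sigma> \<Rrightarrow> \<tau>) \<Longrightarrow> (\<And>c. c \<in> dom \<sigma> \<Longrightarrow> app a c = app b c) \<Longrightarrow> a = b"
    and valid: "T \<turnstile> \<phi> \<Longrightarrow> typed \<rho> \<Longrightarrow> ev \<rho> [] \<phi>"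
    and typed_exists: "\<exists>\<rho>. typed \<rho>"

locale term_model =
  fixes T D :: "fm set"
  assumes RCA0w: "RCA0w \<subseteq> T" and henkin: "henkin T D"
begin

sublocale pre: semantics terms App "\<lambda>c. c" "\<lambda>s t. (s \<^bold>= t) \<in> D" .

lemma evt_inst: "pre.evt \<rho> bs t = inst_tm \<rho> bs 0 t"
  by (induction t) auto

lemma truth: "wf_fm \<Delta> \<phi> \<Longrightarrow> typing \<rho> \<Delta> bs \<Longrightarrow> pre.ev \<rho> bs \<phi> \<longleftrightarrow> inst_fm \<rho> bs 0 \<phi> \<in> D"
proof (induction \<phi> arbitrary: \<Delta> bs)
  case (Eq s t)
  then show ?case by (simp add: evt_inst)
next
  case Falsum
  then show ?case using henkin by (simp add: henkin_def)
next
  case (Imp \<phi> \<psi>)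
  then have "wf_fm [] (inst_fm \<rho> bs 0 \<phi>)" "wf_fm [] (inst_fm \<rho> bs 0 \<psi>)"
    using wf_inst[of "[]" \<Delta>] by auto
  then show ?case using Imp henkin by (auto simp: henkin_def)
next
  case (Forall \<sigma> \<phi>)
  then have "wf_fm [\<sigma>] (inst_fm \<rho> bs (Suc 0) \<phi>)"
    using wf_inst[of "[\<sigma>]" \<Delta>] by auto
  then have "inst_fm \<rho> bs 0 (Forall \<sigma> \<phi>) \<in> D \<longleftrightarrow>
      (\<forall>t. tyof [] t = Some \<sigma> \<longrightarrow> open_fm 0 t (inst_fm \<rho> bs (Suc 0) \<phi>) \<in> D)"
    using henkin by (auto simp: henkin_def)
  also have "\<dots> \<longleftrightarrow> (\<forall>t\<in>terms \<sigma>. inst_fm \<rho> (t # bs) 0 \<phi> \<in> D)"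
    using open_inst[of "[]" \<sigma> \<Delta> \<phi> \<rho> bs] Forall.prems by (simp add: terms_def)
  also have "\<dots> \<longleftrightarrow> (\<forall>t\<in>terms \<sigma>. pre.ev \<rho> (t # bs) \<phi>)"
  proof (rule ball_cong[OF refl])
    fix t assume "t \<in> terms \<sigma>"
    then have "typing \<rho> (\<sigma> # \<Delta>) (t # bs)" using Forall.prems by (simp add: terms_def)
    then show "inst_fm \<rho> (t # bs) 0 \<phi> \<in> D \<longleftrightarrow> pre.ev \<rho> (t # bs) \<phi>"
      using Forall.IH Forall.prems by simp
  qed
  finally show ?case by simp
qed

lemma typing_typed: "typing \<rho> [] [] \<longleftrightarrow> pre.typed \<rho>"
  by (simp add: typing_def pre.typed_def terms_def)

text \<open>Membership in \<open>D\<close> decides formulas under the identity assignment only.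
  Other assignments are reached one variable at a time: \<open>Gen\<close> makes the formula
  universal in that variable, and the truth of the universal formula permits changing its
  value.\<close>

lemma pre_valid:
  assumes "T \<turnstile> \<phi>" and \<rho>: "pre.typed \<rho>"
  shows "pre.ev \<rho> [] \<phi>"
proof -
  let ?id = "\<lambda>(x, \<sigma>). Fr x \<sigma>"
  have *: "pre.ev \<rho> [] \<phi>"
    if "T \<turnstile> \<phi>" "pre.typed \<rho>" "\<And>v. v \<notin> set vs \<Longrightarrow> \<rho> v = ?id v" for vs \<rho> \<phi>
    using that
  proof (induction vs arbitrary: \<rho> \<phi>)
    case Nil
    then have "\<rho> = ?id" by auto
    moreover have "wf_fm [] \<phi>" "\<phi> \<in> D" using Nil derivable_wf henkin unfolding henkin_def by blast+
    ultimately show ?case using truth[of "[]" \<phi> ?id "[]"] inst_id[of "[]" \<phi>] by (simp add: typing_def)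
  next
    case (Cons v vs)
    obtain x \<sigma> where v: "v = (x, \<sigma>)" by force
    let ?\<rho> = "\<rho>(v := ?id v)"
    have "pre.typed ?\<rho>"
    proof -
      have "Fr x \<sigma> \<in> terms \<sigma>" by (simp add: terms_def)
      then show ?thesis unfolding v using pre.typed_upd[OF Cons.prems(2)] by simp
    qed
    then have "pre.ev ?\<rho> [] (\<^bold>\<forall>x:\<sigma>. \<phi>)"
      by (rule Cons.IH[OF Gen[OF Cons.prems(1)]]) (use Cons.prems(3) in auto)
    moreover have "\<rho> v \<in> terms \<sigma>" using Cons.prems(2) v by (simp add: pre.typed_def)
    ultimately have "pre.ev (?\<rho>((x, \<sigma>) := \<rho> v)) [] \<phi>"
      using derivable_wf[OF Cons.prems(1)] by simp
    then show ?case using v by simp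
  qed
  obtain vs where vs: "set vs = fv \<phi>" using finite_fv finite_list by blast
  \<comment> \<open>Off the free variables of \<open>\<phi>\<close> the assignment is reset to the
    identity, so that it deviates at finitely many places.\<close>
  let ?\<rho> = "\<lambda>v. if v \<in> fv \<phi> then \<rho> v else ?id v"
  have "pre.ev ?\<rho> [] \<phi>"
    by (rule *[of _ _ vs]) (use assms vs in \<open>auto simp: pre.typed_def terms_def\<close>)
  then show ?thesis using pre.ev_cong[of \<phi> ?\<rho> \<rho> "[]"] by simp
qed

lemma axiom_valid: "\<phi> \<in> RCA0w \<Longrightarrow> wf_fm [] \<phi> \<Longrightarrow> pre.typed \<rho> \<Longrightarrow> pre.ev \<rho> [] \<phi>"
  using RCA0w by (intro pre_valid Ax) auto

definition id_env :: "string \<times> ty \<Rightarrow> tm" where "id_env = (\<lambda>(x, \<sigma>). Fr x \<sigma>)"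

lemma typed_id [simp]: "pre.typed id_env"
  by (simp add: pre.typed_def id_env_def terms_def)

lemma eqr_refl: "a \<in> terms TNat \<Longrightarrow> (a \<^bold>= a) \<in> D"
  using axiom_valid[OF Refl _ typed_id, simplified] by blast

lemma eqr_sym: "a \<in> terms TNat \<Longrightarrow> b \<in> terms TNat \<Longrightarrow> (a \<^bold>= b) \<in> D \<Longrightarrow> (b \<^bold>= a) \<in> D"
  using axiom_valid[OF Sym _ typed_id, simplified] by blast

lemma eqr_trans:
  "a \<in> terms TNat \<Longrightarrow> b \<in> terms TNat \<Longrightarrow> c \<in> terms TNat \<Longrightarrow> (a \<^bold>= b) \<in> D \<Longrightarrow> (b \<^bold>= c) \<in> D \<Longrightarrow> (a \<^bold>= c) \<in> D"
  using axiom_valid[OF Trans _ typed_id, simplified] by blast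

lemma App_terms: "a \<in> terms (\<sigma> \<Rrightarrow> \<tau>) \<Longrightarrow> b \<in> terms \<sigma> \<Longrightarrow> a \<cdot> b \<in> terms \<tau>"
  by (simp add: terms_def)

lemma eqv_refl: "a \<in> terms \<sigma> \<Longrightarrow> pre.eqv \<sigma> a a"
proof (induction \<sigma> arbitrary: a)
  case TNat
  then show ?case using eqr_refl by simp
next
  case (Arr \<sigma> \<tau>)
  have "pre.eqv \<tau> (a \<cdot> d) (a \<cdot> d)" if d: "d \<in> terms \<sigma>" for d
    by (rule Arr.IH(2)) (rule App_terms[OF Arr.prems d])
  then show ?case by simp
qed

lemma eqv_sym: "a \<in> terms \<sigma> \<Longrightarrow> b \<in> terms \<sigma> \<Longrightarrow> pre.eqv \<sigma> a b \<Longrightarrow> pre.eqv \<sigma> b a"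
proof (induction \<sigma> arbitrary: a b)
  case TNat
  then show ?case unfolding pre.eqv.simps using eqr_sym by blast
next
  case (Arr \<sigma> \<tau>)
  have "pre.eqv \<tau> (b \<cdot> d) (a \<cdot> d)" if d: "d \<in> terms \<sigma>" for d
  proof (rule Arr.IH(2)[OF App_terms[OF Arr.prems(1) d] App_terms[OF Arr.prems(2) d]])
    show "pre.eqv \<tau> (a \<cdot> d) (b \<cdot> d)" using Arr.prems(3) d by simp
  qed
  then show ?case by simp
qed

lemma eqv_trans:
  "a \<in> terms \<sigma> \<Longrightarrow> b \<in> terms \<sigma> \<Longrightarrow> c \<in> terms \<sigma> \<Longrightarrow> pre.eqv \<sigma> a b \<Longrightarrow> pre.eqv \<sigma> b c \<Longrightarrow> pre.eqv \<sigma> a c"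
proof (induction \<sigma> arbitrary: a b c)
  case TNat
  then show ?case unfolding pre.eqv.simps using eqr_trans by blast
next
  case (Arr \<sigma> \<tau>)
  have "pre.eqv \<tau> (a \<cdot> d) (c \<cdot> d)" if d: "d \<in> terms \<sigma>" for d
  proof (rule Arr.IH(2)[OF App_terms[OF Arr.prems(1) d] App_terms[OF Arr.prems(2) d] App_terms[OF Arr.prems(3) d]])
    show "pre.eqv \<tau> (a \<cdot> d) (b \<cdot> d)" "pre.eqv \<tau> (b \<cdot> d) (c \<cdot> d)" using Arr.prems(4,5) d by simp_all
  qed
  then show ?case by simp
qed

text \<open>Changing the function is harmless by the definition of \<open>eqv\<close>; changing the
  argument is what the axiom \<open>Ext\<close> permits. Hence application passes to the
  quotient.\<close>

lemma eqv_app: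
  assumes "a \<in> terms (\<sigma> \<Rrightarrow> \<tau>)" "a' \<in> terms (\<sigma> \<Rrightarrow> \<tau>)" "b \<in> terms \<sigma>" "b' \<in> terms \<sigma>"
    "pre.eqv (\<sigma> \<Rrightarrow> \<tau>) a a'" "pre.eqv \<sigma> b b'"
  shows "pre.eqv \<tau> (a \<cdot> b) (a' \<cdot> b')"
proof -
  have "pre.eqv \<tau> (a' \<cdot> b) (a' \<cdot> b')"
    using axiom_valid[OF Ext[of \<sigma> \<tau>] _ typed_id, simplified] assms by (simp add: pre.ev_eq_at)
  moreover have "pre.eqv \<tau> (a \<cdot> b) (a' \<cdot> b)" using assms by simp
  ultimately show ?thesis using eqv_trans assms App_terms by meson
qed

text \<open>Every element is represented by a canonical term, so that equality of the quotient is identity.\<close>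

definition canon :: "tm \<Rightarrow> tm" where
  "canon t = (SOME s. \<exists>\<sigma>. s \<in> terms \<sigma> \<and> t \<in> terms \<sigma> \<and> pre.eqv \<sigma> t s)"

lemma terms_unique: "t \<in> terms \<sigma> \<Longrightarrow> t \<in> terms \<tau> \<Longrightarrow> \<sigma> = \<tau>"
  by (simp add: terms_def)

lemma canon:
  assumes "t \<in> terms \<sigma>"
  shows canon_terms: "canon t \<in> terms \<sigma>" and canon_eqv: "pre.eqv \<sigma> t (canon t)"
proof -
  have "\<exists>s. \<exists>\<sigma>. s \<in> terms \<sigma> \<and> t \<in> terms \<sigma> \<and> pre.eqv \<sigma> t s" using assms eqv_refl by blast
  then have "\<exists>\<sigma>. canon t \<in> terms \<sigma> \<and> t \<in> terms \<sigma> \<and> pre.eqv \<sigma> t (canon t)"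
    unfolding canon_def by (rule someI_ex)
  then show "canon t \<in> terms \<sigma>" "pre.eqv \<sigma> t (canon t)" using assms terms_unique by blast+
qed

text \<open>Equivalent terms have the same candidates for a representative, so the choice operator
  returns the same one for both.\<close>

lemma canon_eq:
  assumes "s \<in> terms \<sigma>" "t \<in> terms \<sigma>"
  shows "canon s = canon t \<longleftrightarrow> pre.eqv \<sigma> s t"
proof
  assume "canon s = canon t"
  then have "pre.eqv \<sigma> s (canon t)" using canon_eqv[OF assms(1)] by simp
  moreover have "pre.eqv \<sigma> (canon t) t"
    using assms(2) canon_terms canon_eqv by (blast intro: eqv_sym)
  ultimately show "pre.eqv \<sigma> s t" using assms canon_terms eqv_trans by blast
next
  assume st: "pre.eqv \<sigma> s t"
  then have ts: "pre.eqv \<sigma> t s" using assms eqv_sym by blast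
  have "(\<exists>\<tau>. u \<in> terms \<tau> \<and> s \<in> terms \<tau> \<and> pre.eqv \<tau> s u) \<longleftrightarrow>
      (\<exists>\<tau>. u \<in> terms \<tau> \<and> t \<in> terms \<tau> \<and> pre.eqv \<tau> t u)" for u
    using assms eqv_trans[OF assms(1,2) _ st] eqv_trans[OF assms(2,1) _ ts] terms_unique by blast
  then show "canon s = canon t" unfolding canon_def by simp
qed

definition qdom :: "ty \<Rightarrow> tm set" where "qdom \<sigma> = canon ` terms \<sigma>"
definition qapp :: "tm \<Rightarrow> tm \<Rightarrow> tm" where "qapp a b = canon (a \<cdot> b)"

lemma canon_idem: "t \<in> terms \<sigma> \<Longrightarrow> canon (canon t) = canon t"
  using canon_eq[of "canon t" \<sigma> t] eqv_sym[of t \<sigma> "canon t"] by (simp add: canon_terms canon_eqv)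

lemma qdom_iff: "a \<in> qdom \<sigma> \<longleftrightarrow> a \<in> terms \<sigma> \<and> canon a = a"
proof
  assume "a \<in> qdom \<sigma>"
  then obtain t where "t \<in> terms \<sigma>" "a = canon t" unfolding qdom_def by blast
  then show "a \<in> terms \<sigma> \<and> canon a = a" using canon_terms canon_idem by simp
next
  assume "a \<in> terms \<sigma> \<and> canon a = a"
  then show "a \<in> qdom \<sigma>" unfolding qdom_def by (simp add: image_iff) (metis)
qed

sublocale q: semantics qdom qapp canon "(=)" .

lemma canon_app:
  assumes "s \<in> terms (\<sigma> \<Rrightarrow> \<tau>)" "t \<in> terms \<sigma>"
  shows "qapp (canon s) (canon t) = canon (s \<cdot> t)"
proof -
  have "pre.eqv \<tau> (s \<cdot> t) (canon s \<cdot> canon t)"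
    by (rule eqv_app) (fact assms canon_terms[OF assms(1)] canon_terms[OF assms(2)]
      canon_eqv[OF assms(1)] canon_eqv[OF assms(2)])+
  moreover have "s \<cdot> t \<in> terms \<tau>" "canon s \<cdot> canon t \<in> terms \<tau>"
    using App_terms canon_terms assms by blast+
  ultimately show ?thesis unfolding qapp_def using canon_eq by metis
qed

lemma q_evt:
  "tyof \<Delta> t = Some \<tau> \<Longrightarrow> typing \<rho> \<Delta> bs \<Longrightarrow> q.evt (canon \<circ> \<rho>) (map canon bs) t = canon (pre.evt \<rho> bs t)"
proof (induction t arbitrary: \<tau>)
  case (Bd i)
  then have "i < length bs" by (auto simp: typing_def dest: list_all2_lengthD split: if_splits)
  then show ?case by simp
next
  case (App s t)
  then obtain \<sigma> where ty: "tyof \<Delta> s = Some (\<sigma> \<Rrightarrow> \<tau>)" "tyof \<Delta> t = Some \<sigma>"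
    by (auto simp: tyof_App simp del: tyof.simps(8))
  then have "pre.evt \<rho> bs s \<in> terms (\<sigma> \<Rrightarrow> \<tau>)" "pre.evt \<rho> bs t \<in> terms \<sigma>"
    using tyof_inst[of "[]" \<Delta> _ _ \<rho> bs] App.prems by (auto simp: evt_inst terms_def)
  then show ?case using App ty canon_app by simp
qed auto

lemma q_ev:
  "wf_fm \<Delta> \<phi> \<Longrightarrow> typing \<rho> \<Delta> bs \<Longrightarrow> q.ev (canon \<circ> \<rho>) (map canon bs) \<phi> \<longleftrightarrow> pre.ev \<rho> bs \<phi>"
proof (induction \<phi> arbitrary: \<Delta> bs)
  case (Eq s t)
  then have "pre.evt \<rho> bs s \<in> terms TNat" "pre.evt \<rho> bs t \<in> terms TNat"
    using tyof_inst[of "[]" \<Delta> _ _ \<rho> bs] by (auto simp: evt_inst terms_def)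
  moreover have "q.evt (canon \<circ> \<rho>) (map canon bs) s = canon (pre.evt \<rho> bs s)"
      "q.evt (canon \<circ> \<rho>) (map canon bs) t = canon (pre.evt \<rho> bs t)"
    using Eq q_evt by auto
  ultimately show ?case unfolding q.ev.simps pre.ev.simps using canon_eq[of _ TNat] by simp
next
  case (Forall \<sigma> \<phi>)
  have "q.ev (canon \<circ> \<rho>) (canon b # map canon bs) \<phi> \<longleftrightarrow> pre.ev \<rho> (b # bs) \<phi>" if "b \<in> terms \<sigma>" for b
  proof (rule Forall.IH[of "\<sigma> # \<Delta>" "b # bs", unfolded list.map])
    show "wf_fm (\<sigma> # \<Delta>) \<phi>" "typing \<rho> (\<sigma> # \<Delta>) (b # bs)" using Forall.prems that by (simp_all add: terms_def)
  qed
  then have "(\<forall>b\<in>terms \<sigma>. q.ev (canon \<circ> \<rho>) (canon b # map canon bs) \<phi>) \<longleftrightarrow> (\<forall>b\<in>terms \<sigma>. pre.ev \<rho> (b # bs) \<phi>)"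
    by (rule ball_cong[OF refl])
  moreover have "(\<forall>a\<in>qdom \<sigma>. P a) \<longleftrightarrow> (\<forall>b\<in>terms \<sigma>. P (canon b))" for P
    unfolding qdom_def by blast
  ultimately show ?case unfolding q.ev.simps pre.ev.simps by simp
next
  case (Imp \<phi> \<psi>)
  then show ?case unfolding q.ev.simps pre.ev.simps wf_fm.simps by blast
qed simp

lemma q_typed:
  assumes "q.typed \<rho>"
  shows "pre.typed \<rho>" "canon \<circ> \<rho> = \<rho>"
  using assms by (auto simp: q.typed_def pre.typed_def qdom_iff)

text \<open>Extensionality is built in: \<open>eqv\<close> at an arrow type compares all values, and
  equivalent terms share their canonical term.\<close>

sublocale q: model qdom qapp canon T
proof
  fix a b \<sigma> \<tau>
  assume "a \<in> qdom (\<sigma> \<Rrightarrow> \<tau>)" "b \<in> qdom \<sigma>"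
  then have "a \<cdot> b \<in> terms \<tau>" unfolding qdom_iff using App_terms by blast
  then show "qapp a b \<in> qdom \<tau>" by (simp add: qapp_def qdom_def)
next
  fix \<rho> t \<tau>
  assume "q.typed \<rho>" and t: "tyof [] t = Some \<tau>"
  then have r: "typing \<rho> [] []" "canon \<circ> \<rho> = \<rho>" using q_typed typing_typed by auto
  then have "pre.evt \<rho> [] t \<in> terms \<tau>"
    using tyof_inst[of "[]" "[]" t \<tau> \<rho> "[]"] t by (auto simp: evt_inst terms_def)
  then show "q.evt \<rho> [] t \<in> qdom \<tau>" using q_evt[OF t r(1)] r(2) by (simp add: qdom_def)
next
  fix a b \<sigma> \<tau>
  assume ab: "a \<in> qdom (\<sigma> \<Rrightarrow> \<tau>)" "b \<in> qdom (\<sigma> \<Rrightarrow> \<tau>)"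
    and eq: "\<And>c. c \<in> qdom \<sigma> \<Longrightarrow> qapp a c = qapp b c"
  have "pre.eqv \<tau> (a \<cdot> c) (b \<cdot> c)" if c: "c \<in> terms \<sigma>" for c
  proof -
    have "canon c \<in> qdom \<sigma>" using c by (simp add: qdom_def)
    then have "qapp (canon a) (canon c) = qapp (canon b) (canon c)" using eq ab by (simp add: qdom_iff)
    then have "canon (a \<cdot> c) = canon (b \<cdot> c)"
      using ab c canon_app[of a \<sigma> \<tau> c] canon_app[of b \<sigma> \<tau> c] unfolding qdom_iff by metis
    moreover have "a \<cdot> c \<in> terms \<tau>" "b \<cdot> c \<in> terms \<tau>" using ab c App_terms unfolding qdom_iff by blast+
    ultimately show ?thesis using canon_eq by blast
  qed
  then have "pre.eqv (\<sigma> \<Rrightarrow> \<tau>) a b" by simp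
  then show "a = b" using ab canon_eq[of a "\<sigma> \<Rrightarrow> \<tau>" b] by (simp add: qdom_iff)
next
  fix \<phi> \<rho>
  assume "T \<turnstile> \<phi>" "q.typed \<rho>"
  then show "q.ev \<rho> [] \<phi>"
    using q_typed q_ev[of "[]" \<phi> \<rho> "[]"] typing_typed pre_valid derivable_wf by auto
next
  show "\<exists>\<rho>. q.typed \<rho>"
    by (rule exI[of _ "canon \<circ> id_env"]) (use typed_id in \<open>auto simp: q.typed_def pre.typed_def qdom_def\<close>)
qed

lemma q_refutes:
  assumes "wf_fm [] \<phi>" "\<phi> \<notin> D"
  shows "\<exists>\<rho>. q.typed \<rho> \<and> \<not> q.ev \<rho> [] \<phi>"
proof (intro exI conjI)
  show "q.typed (canon \<circ> id_env)"
    using typed_id by (auto simp: q.typed_def pre.typed_def qdom_def)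
  show "\<not> q.ev (canon \<circ> id_env) [] \<phi>"
    using q_ev[of "[]" \<phi> id_env "[]"] truth[of "[]" \<phi> id_env "[]"] inst_id[of "[]" \<phi>] assms
    by (simp add: typing_typed) (simp add: id_env_def)
qed

end

theorem countermodel_exists:
  assumes "RCA0w \<subseteq> T" "wf_fm [] \<phi>" "\<not> (T \<turnstile> \<phi>)"
  shows "\<exists>(dom :: ty \<Rightarrow> tm set) app cst. model dom app cst T \<and>
    (\<exists>\<rho>. semantics.typed dom \<rho> \<and> \<not> semantics.ev dom app cst (=) \<rho> [] \<phi>)"
proof -
  obtain D where "henkin T D" "\<phi> \<notin> D" using henkin_exists assms by blast
  then interpret term_model T D using assms by unfold_locales
  show ?thesis using q_refutes[OF assms(2) \<open>\<phi> \<notin> D\<close>] q.model_axioms by blast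
qed

section \<open>Arithmetic in models\<close>

declare lam.simps [simp del]

lemma tyof_lam [simp]: "tyof [] t = Some \<tau> \<Longrightarrow> tyof [] (lam x \<sigma> t) = Some (\<sigma> \<Rrightarrow> \<tau>)"
proof (induction t arbitrary: \<tau>)
  case (App s t)
  then obtain \<upsilon> where "tyof [] s = Some (\<upsilon> \<Rrightarrow> \<tau>)" "tyof [] t = Some \<upsilon>"
    by (auto simp: tyof_App simp del: tyof.simps(8))
  then show ?case using App by (simp add: lam.simps)
qed (auto simp: lam.simps)

lemma fv_lam [simp]: "fv_tm (lam x \<sigma> t) = fv_tm t - {(x, \<sigma>)}"
  by (induction t) (auto simp: lam.simps)

lemma subst_fresh [simp]: "(x, \<sigma>) \<notin> fv_tm t \<Longrightarrow> subst_tm x \<sigma> u t = t"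
  by (induction t) auto

lemma tyof_constants [simp]:
  "tyof \<Delta> add_tm = Some (TNat \<Rrightarrow> T1)"
  "tyof \<Delta> mult_tm = Some (TNat \<Rrightarrow> T1)"
  "tyof \<Delta> pred_tm = Some (T1)"
  "tyof \<Delta> monus_tm = Some (TNat \<Rrightarrow> T1)"
  "tyof \<Delta> pow2_tm = Some (T1)"
  "tyof \<Delta> triangle_tm = Some (T1)"
  "tyof \<Delta> root_tm = Some (T1)"
  "tyof \<Delta> pair_tm = Some (TNat \<Rrightarrow> T1)"
  "tyof \<Delta> fst_tm = Some (T1)"
  "tyof \<Delta> snd_tm = Some (T1)"
  "tyof \<Delta> qadd_tm = Some (TNat \<Rrightarrow> T1)"
  "tyof \<Delta> qminus_tm = Some (T1)"
  "tyof \<Delta> qabs_tm = Some (T1)"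
  "tyof \<Delta> qpow_tm = Some (T1)"
  "tyof \<Delta> zeroR = Some (T1)"
  "tyof \<Delta> oneR = Some (T1)"
  "tyof \<Delta> addR_tm = Some (T1 \<Rrightarrow> T1 \<Rrightarrow> T1)"
  "tyof \<Delta> subR_tm = Some (T1 \<Rrightarrow> T1 \<Rrightarrow> T1)"
proof -
  show t1: "tyof \<Delta> add_tm = Some (TNat \<Rrightarrow> T1)" for \<Delta>
    by (rule tyof_closed) (simp add: add_tm_def)
  show t2: "tyof \<Delta> mult_tm = Some (TNat \<Rrightarrow> T1)" for \<Delta>
    by (rule tyof_closed) (simp add: mult_tm_def t1)
  show t3: "tyof \<Delta> pred_tm = Some (T1)" for \<Delta>
    by (rule tyof_closed) (simp add: pred_tm_def t1 t2)
  show t4: "tyof \<Delta> monus_tm = Some (TNat \<Rrightarrow> T1)" for \<Delta>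
    by (rule tyof_closed) (simp add: monus_tm_def t1 t2 t3)
  show t5: "tyof \<Delta> pow2_tm = Some (T1)" for \<Delta>
    by (rule tyof_closed) (simp add: pow2_tm_def t1 t2 t3 t4)
  show t6: "tyof \<Delta> triangle_tm = Some (T1)" for \<Delta>
    by (rule tyof_closed) (simp add: triangle_tm_def t1 t2 t3 t4 t5)
  show t7: "tyof \<Delta> root_tm = Some (T1)" for \<Delta>
    by (rule tyof_closed) (simp add: root_tm_def t1 t2 t3 t4 t5 t6)
  show t8: "tyof \<Delta> pair_tm = Some (TNat \<Rrightarrow> T1)" for \<Delta>
    by (rule tyof_closed) (simp add: pair_tm_def t1 t2 t3 t4 t5 t6 t7)
  show t9: "tyof \<Delta> fst_tm = Some (T1)" for \<Delta>
    by (rule tyof_closed) (simp add: fst_tm_def t1 t2 t3 t4 t5 t6 t7 t8)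
  show t10: "tyof \<Delta> snd_tm = Some (T1)" for \<Delta>
    by (rule tyof_closed) (simp add: snd_tm_def t1 t2 t3 t4 t5 t6 t7 t8 t9)
  show t11: "tyof \<Delta> qadd_tm = Some (TNat \<Rrightarrow> T1)" for \<Delta>
    by (rule tyof_closed) (simp add: qadd_tm_def t1 t2 t3 t4 t5 t6 t7 t8 t9 t10)
  show t12: "tyof \<Delta> qminus_tm = Some (T1)" for \<Delta>
    by (rule tyof_closed) (simp add: qminus_tm_def t1 t2 t3 t4 t5 t6 t7 t8 t9 t10 t11)
  show t13: "tyof \<Delta> qabs_tm = Some (T1)" for \<Delta>
    by (rule tyof_closed) (simp add: qabs_tm_def t1 t2 t3 t4 t5 t6 t7 t8 t9 t10 t11 t12)
  show t14: "tyof \<Delta> qpow_tm = Some (T1)" for \<Delta>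
    by (rule tyof_closed) (simp add: qpow_tm_def t1 t2 t3 t4 t5 t6 t7 t8 t9 t10 t11 t12 t13)
  show t15: "tyof \<Delta> zeroR = Some (T1)" for \<Delta>
    by (rule tyof_closed) (simp add: zeroR_def t1 t2 t3 t4 t5 t6 t7 t8 t9 t10 t11 t12 t13 t14)
  show t16: "tyof \<Delta> oneR = Some (T1)" for \<Delta>
    by (rule tyof_closed) (simp add: oneR_def t1 t2 t3 t4 t5 t6 t7 t8 t9 t10 t11 t12 t13 t14 t15)
  show t17: "tyof \<Delta> addR_tm = Some (T1 \<Rrightarrow> T1 \<Rrightarrow> T1)" for \<Delta>
    by (rule tyof_closed) (simp add: addR_tm_def t1 t2 t3 t4 t5 t6 t7 t8 t9 t10 t11 t12 t13 t14 t15 t16)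
  show t18: "tyof \<Delta> subR_tm = Some (T1 \<Rrightarrow> T1 \<Rrightarrow> T1)" for \<Delta>
    by (rule tyof_closed) (simp add: subR_tm_def t1 t2 t3 t4 t5 t6 t7 t8 t9 t10 t11 t12 t13 t14 t15 t16 t17)
qed

lemma fv_constants [simp]:
  "fv_tm add_tm = {}"
  "fv_tm mult_tm = {}"
  "fv_tm pred_tm = {}"
  "fv_tm monus_tm = {}"
  "fv_tm pow2_tm = {}"
  "fv_tm triangle_tm = {}"
  "fv_tm root_tm = {}"
  "fv_tm pair_tm = {}"
  "fv_tm fst_tm = {}"
  "fv_tm snd_tm = {}"
  "fv_tm qadd_tm = {}"
  "fv_tm qminus_tm = {}"
  "fv_tm qabs_tm = {}"
  "fv_tm qpow_tm = {}"
  "fv_tm zeroR = {}"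
  "fv_tm oneR = {}"
  "fv_tm addR_tm = {}"
  "fv_tm subR_tm = {}"
proof -
  show f1: "fv_tm add_tm = {}" by (auto simp: add_tm_def)
  show f2: "fv_tm mult_tm = {}" by (auto simp: mult_tm_def f1)
  show f3: "fv_tm pred_tm = {}" by (auto simp: pred_tm_def f1 f2)
  show f4: "fv_tm monus_tm = {}" by (auto simp: monus_tm_def f1 f2 f3)
  show f5: "fv_tm pow2_tm = {}" by (auto simp: pow2_tm_def f1 f2 f3 f4)
  show f6: "fv_tm triangle_tm = {}" by (auto simp: triangle_tm_def f1 f2 f3 f4 f5)
  show f7: "fv_tm root_tm = {}" by (auto simp: root_tm_def f1 f2 f3 f4 f5 f6)
  show f8: "fv_tm pair_tm = {}" by (auto simp: pair_tm_def f1 f2 f3 f4 f5 f6 f7)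
  show f9: "fv_tm fst_tm = {}" by (auto simp: fst_tm_def f1 f2 f3 f4 f5 f6 f7 f8)
  show f10: "fv_tm snd_tm = {}" by (auto simp: snd_tm_def f1 f2 f3 f4 f5 f6 f7 f8 f9)
  show f11: "fv_tm qadd_tm = {}" by (auto simp: qadd_tm_def f1 f2 f3 f4 f5 f6 f7 f8 f9 f10)
  show f12: "fv_tm qminus_tm = {}" by (auto simp: qminus_tm_def f1 f2 f3 f4 f5 f6 f7 f8 f9 f10 f11)
  show f13: "fv_tm qabs_tm = {}" by (auto simp: qabs_tm_def f1 f2 f3 f4 f5 f6 f7 f8 f9 f10 f11 f12)
  show f14: "fv_tm qpow_tm = {}" by (auto simp: qpow_tm_def f1 f2 f3 f4 f5 f6 f7 f8 f9 f10 f11 f12 f13)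
  show f15: "fv_tm zeroR = {}" by (auto simp: zeroR_def f1 f2 f3 f4 f5 f6 f7 f8 f9 f10 f11 f12 f13 f14)
  show f16: "fv_tm oneR = {}" by (auto simp: oneR_def f1 f2 f3 f4 f5 f6 f7 f8 f9 f10 f11 f12 f13 f14 f15)
  show f17: "fv_tm addR_tm = {}" by (auto simp: addR_tm_def f1 f2 f3 f4 f5 f6 f7 f8 f9 f10 f11 f12 f13 f14 f15 f16)
  show f18: "fv_tm subR_tm = {}" by (auto simp: subR_tm_def f1 f2 f3 f4 f5 f6 f7 f8 f9 f10 f11 f12 f13 f14 f15 f16 f17)
qed

lemma wf_le [simp]: "tyof \<Delta> s = Some TNat \<Longrightarrow> tyof \<Delta> t = Some TNat \<Longrightarrow> wf_fm \<Delta> (s \<^bold>\<le> t)"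
  by (simp add: le_fm_def)

lemma wf_less [simp]: "tyof \<Delta> s = Some TNat \<Longrightarrow> tyof \<Delta> t = Some TNat \<Longrightarrow> wf_fm \<Delta> (s \<^bold>< t)"
  by (simp add: less_fm_def)

lemma wf_qle [simp]: "tyof \<Delta> s = Some TNat \<Longrightarrow> tyof \<Delta> t = Some TNat \<Longrightarrow> wf_fm \<Delta> (qle s t)"
  by (simp add: qle_def)

lemma wf_qless [simp]: "tyof \<Delta> s = Some TNat \<Longrightarrow> tyof \<Delta> t = Some TNat \<Longrightarrow> wf_fm \<Delta> (qless s t)"
  by (simp add: qless_def)

lemma wf_is_real [simp]: "tyof [] x = Some T1 \<Longrightarrow> wf_fm [] (is_real x)"
  by (simp add: is_real_def)

lemma wf_eqR [simp]: "tyof [] x = Some T1 \<Longrightarrow> tyof [] y = Some T1 \<Longrightarrow> wf_fm [] (eqR x y)"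
  by (simp add: eqR_def)

lemma wf_leR [simp]: "tyof [] x = Some T1 \<Longrightarrow> tyof [] y = Some T1 \<Longrightarrow> wf_fm [] (leR x y)"
  by (simp add: leR_def)

lemma wf_lessR [simp]: "tyof [] x = Some T1 \<Longrightarrow> tyof [] y = Some T1 \<Longrightarrow> wf_fm [] (lessR x y)"
  by (simp add: lessR_def)

lemma wf_in_unit [simp]: "tyof [] x = Some T1 \<Longrightarrow> wf_fm [] (in_unit x)"
  by (simp add: in_unit_def)

lemma wf_in_ball [simp]:
  "tyof [] z = Some T1 \<Longrightarrow> tyof [] y = Some T1 \<Longrightarrow> tyof [] r = Some T1 \<Longrightarrow> wf_fm [] (in_ball z y r)"
  by (simp add: in_ball_def)

lemma wf_psi_is_function [simp]: "wf_fm [] psi_is_function"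
  by (simp add: psi_is_function_def)

lemma wf_HBT: "wf_fm [] HBT"
  by (simp add: HBT_def)

locale rca_model = model dom app cst T
  for dom :: "ty \<Rightarrow> 'u set" and app cst T +
  assumes RCA0w: "RCA0w \<subseteq> T"
begin

definition env :: "string \<times> ty \<Rightarrow> 'u" where "env = (SOME \<rho>. typed \<rho>)"

lemma typed_env [simp]: "typed env"
  unfolding env_def using typed_exists by (rule someI_ex)

lemma axiom: "\<phi> \<in> RCA0w \<Longrightarrow> wf_fm [] \<phi> \<Longrightarrow> typed \<rho> \<Longrightarrow> ev \<rho> [] \<phi>"
  using RCA0w by (intro valid Ax) auto

lemma cst_dom_simps [simp]:
  "cst Zero \<in> dom TNat" "cst Succ \<in> dom T1"
  "cst (Kc \<sigma> \<tau>) \<in> dom (\<sigma> \<Rrightarrow> \<tau> \<Rrightarrow> \<sigma>)"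
  "cst (Sc \<sigma> \<tau> \<upsilon>) \<in> dom ((\<sigma> \<Rrightarrow> \<tau> \<Rrightarrow> \<upsilon>) \<Rrightarrow> (\<sigma> \<Rrightarrow> \<tau>) \<Rrightarrow> \<sigma> \<Rrightarrow> \<upsilon>)"
  "cst Rec \<in> dom (TNat \<Rrightarrow> TNat \<Rrightarrow> (TNat \<Rrightarrow> TNat \<Rrightarrow> TNat) \<Rrightarrow> TNat)"
  using evt_dom[OF typed_env, of Zero] evt_dom[OF typed_env, of Succ] evt_dom[OF typed_env, of "Kc \<sigma> \<tau>"]
    evt_dom[OF typed_env, of "Sc \<sigma> \<tau> \<upsilon>"] evt_dom[OF typed_env, of Rec] by simp_all

lemma eqv_eq: "a \<in> dom \<sigma> \<Longrightarrow> b \<in> dom \<sigma> \<Longrightarrow> eqv \<sigma> a b \<longleftrightarrow> a = b"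
proof (induction \<sigma> arbitrary: a b)
  case (Arr \<sigma> \<tau>)
  have "eqv \<tau> (app a c) (app b c) \<longleftrightarrow> app a c = app b c" if "c \<in> dom \<sigma>" for c
    using Arr.prems that by (intro Arr.IH(2) app_dom)
  then show ?case using ext[OF Arr.prems] by auto
qed simp

lemma K_app:
  assumes "a \<in> dom \<sigma>" "b \<in> dom \<tau>"
  shows "app (app (cst (Kc \<sigma> \<tau>)) a) b = a"
proof -
  have "app (app (cst (Kc \<sigma> \<tau>)) a) b \<in> dom \<sigma>"
    using assms by (meson app_dom cst_dom_simps)
  moreover have "eqv \<sigma> (app (app (cst (Kc \<sigma> \<tau>)) a) b) a"
    using axiom[OF K_eq[of \<sigma> \<tau>] _ typed_env, simplified] assms by (simp add: ev_eq_at)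
  ultimately show ?thesis using eqv_eq assms by blast
qed

lemma S_app:
  assumes "a \<in> dom (\<sigma> \<Rrightarrow> \<tau> \<Rrightarrow> \<upsilon>)" "b \<in> dom (\<sigma> \<Rrightarrow> \<tau>)" "c \<in> dom \<sigma>"
  shows "app (app (app (cst (Sc \<sigma> \<tau> \<upsilon>)) a) b) c = app (app a c) (app b c)"
proof -
  have "app (app (app (cst (Sc \<sigma> \<tau> \<upsilon>)) a) b) c \<in> dom \<upsilon>" "app (app a c) (app b c) \<in> dom \<upsilon>"
    using assms by (meson app_dom cst_dom_simps)+
  moreover have "eqv \<upsilon> (app (app (app (cst (Sc \<sigma> \<tau> \<upsilon>)) a) b) c) (app (app a c) (app b c))"
    using axiom[OF S_eq[of \<sigma> \<tau> \<upsilon>] _ typed_env, simplified] assms by (simp add: ev_eq_at)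
  ultimately show ?thesis using eqv_eq by blast
qed

text \<open>The induction follows the clauses of bracket abstraction: \<open>K\<close> for terms
  without the variable, \<open>S\<close> for applications containing it, and \<open>S K K\<close>
  for the variable itself. The list \<open>bs\<close> is arbitrary because a term typed in the empty
  context has no loose index.\<close>

lemma beta [simp]:
  "typed \<rho> \<Longrightarrow> tyof [] t = Some \<tau> \<Longrightarrow> a \<in> dom \<sigma> \<Longrightarrow>
    app (evt \<rho> bs (lam x \<sigma> t)) a = evt (\<rho>((x, \<sigma>) := a)) [] t"
proof -
  assume \<rho>: "typed \<rho>" and a: "a \<in> dom \<sigma>"
  have K: "app (evt \<rho> [] (Kc \<tau> \<sigma> \<cdot> t)) a = evt (\<rho>((x, \<sigma>) := a)) [] t"
    if "tyof [] t = Some \<tau>" "(x, \<sigma>) \<notin> fv_tm t" for t \<tau>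
  proof -
    have "evt \<rho> [] t = evt (\<rho>((x, \<sigma>) := a)) [] t" by (rule evt_cong) (use that in auto)
    then show ?thesis using K_app[OF evt_dom[OF \<rho> that(1)] a] by simp
  qed
  have main: "app (evt \<rho> [] (lam x \<sigma> t)) a = evt (\<rho>((x, \<sigma>) := a)) [] t" if "tyof [] t = Some \<tau>" for t \<tau>
    using that
  proof (induction t arbitrary: \<tau>)
    case (Fr y \<upsilon>)
    show ?case
    proof (cases "y = x \<and> \<upsilon> = \<sigma>")
      case True
      have "app (app (app (cst (Sc \<sigma> (\<sigma> \<Rrightarrow> \<sigma>) \<sigma>)) (cst (Kc \<sigma> (\<sigma> \<Rrightarrow> \<sigma>)))) (cst (Kc \<sigma> \<sigma>))) a = a"
        using S_app[of "cst (Kc \<sigma> (\<sigma> \<Rrightarrow> \<sigma>))" \<sigma> "\<sigma> \<Rrightarrow> \<sigma>" \<sigma> "cst (Kc \<sigma> \<sigma>)" a] a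
          K_app[OF a, of "app (cst (Kc \<sigma> \<sigma>)) a" "\<sigma> \<Rrightarrow> \<sigma>"] app_dom[OF cst_dom_simps(3) a] by simp
      then show ?thesis using True by (simp add: lam.simps)
    next
      case False
      then show ?thesis using K[of "Fr y \<upsilon>" \<upsilon>] by (auto simp: lam.simps)
    qed
  next
    case (App s t)
    then obtain \<upsilon> where ty: "tyof [] s = Some (\<upsilon> \<Rrightarrow> \<tau>)" "tyof [] t = Some \<upsilon>"
      by (auto simp: tyof_App simp del: tyof.simps(8))
    show ?case
    proof (cases "(x, \<sigma>) \<in> fv_tm (s \<cdot> t)")
      case True
      have "app (evt \<rho> [] (lam x \<sigma> (s \<cdot> t))) a =
          app (app (evt \<rho> [] (lam x \<sigma> s)) a) (app (evt \<rho> [] (lam x \<sigma> t)) a)"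
        using True ty a S_app[of "evt \<rho> [] (lam x \<sigma> s)" \<sigma> \<upsilon> \<tau> "evt \<rho> [] (lam x \<sigma> t)" a]
        by (simp add: lam.simps evt_dom[OF \<rho>])
      then show ?thesis using App.IH ty by simp
    next
      case False
      then have "lam x \<sigma> (s \<cdot> t) = Kc \<tau> \<sigma> \<cdot> (s \<cdot> t)"
        using App.prems by (simp add: lam.simps(1) del: tyof.simps)
      then show ?thesis using K[OF App.prems False] by (simp only:)
    qed
  qed (use K[of Zero TNat] K[of Succ T1] K[of Rec] K[of "Kc _ _"] K[of "Sc _ _ _"] in \<open>auto simp: lam.simps\<close>)
  assume "tyof [] t = Some \<tau>"
  then show ?thesis using main evt_closed[OF tyof_lam[of t \<tau> x \<sigma>], of \<rho> bs] by simp
qed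

end

text \<open>The parameter \<open>num\<close> names the natural numbers of the model by the elements of a type.\<close>

locale numbered_model = rca_model dom app cst T
  for dom :: "ty \<Rightarrow> 'u set" and app cst T +
  fixes num :: "'n \<Rightarrow> 'u"
  assumes num: "bij_betw num UNIV (dom TNat)"
begin

lemma num_dom [simp]: "num a \<in> dom TNat"
  using num by (auto simp: bij_betw_def)

lemma num_eq [simp]: "num a = num b \<longleftrightarrow> a = b"
  using num by (auto simp: bij_betw_def inj_eq)

lemma num_cases: "x \<in> dom TNat \<Longrightarrow> \<exists>a. x = num a"
  using num by (auto simp: bij_betw_def)

lemma ball_TNat [simp]: "(\<forall>x\<in>dom TNat. P x) \<longleftrightarrow> (\<forall>a. P (num a))"
  using num_cases num_dom by metis

lemma bex_TNat [simp]: "(\<exists>x\<in>dom TNat. P x) \<longleftrightarrow> (\<exists>a. P (num a))"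
  using num_cases num_dom by metis

definition den :: "'u \<Rightarrow> 'n" where "den x = (THE a. x = num a)"

lemma den_num [simp]: "den (num a) = a"
  by (simp add: den_def)

lemma num_den: "x \<in> dom TNat \<Longrightarrow> num (den x) = x"
  using num_cases by fastforce

definition fn :: "'u \<Rightarrow> 'n \<Rightarrow> 'n" where "fn f a = den (app f (num a))"

lemma app_num [simp]: "f \<in> dom T1 \<Longrightarrow> app f (num a) = num (fn f a)"
  by (simp add: fn_def num_den)

lemma fn_lam [simp]:
  "typed \<rho> \<Longrightarrow> tyof [] t = Some TNat \<Longrightarrow> fn (evt \<rho> bs (\<^bold>\<lambda>x. t)) a = den (evt (\<rho>((x, TNat) := num a)) [] t)"
  by (simp add: fn_def)

lemma fn_ext: "f \<in> dom T1 \<Longrightarrow> g \<in> dom T1 \<Longrightarrow> (\<And>a. fn f a = fn g a) \<Longrightarrow> f = g"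
proof (rule ext)
  fix x assume "f \<in> dom T1" "g \<in> dom T1" "\<And>a. fn f a = fn g a" "x \<in> dom TNat"
  then show "app f x = app g x" using num_cases by fastforce
qed

definition Z :: 'n where "Z = den (cst Zero)"
definition S :: "'n \<Rightarrow> 'n" where "S = fn (cst Succ)"

lemma cst_Zero [simp]: "cst Zero = num Z"
  by (simp add: Z_def num_den)

lemma fn_Succ [simp]: "fn (cst Succ) = S"
  by (simp add: S_def)

lemma S_neq [simp]: "S a \<noteq> Z" "Z \<noteq> S a"
  using axiom[OF Succ_nonzero _ typed_env, simplified] by (auto simp: cst_Zero)

definition rec :: "'n \<Rightarrow> 'n \<Rightarrow> 'u \<Rightarrow> 'n" where
  "rec a b h = den (app (app (app (cst Rec) (num a)) (num b)) h)"

lemma app_Rec: "h \<in> dom (TNat \<Rrightarrow> T1) \<Longrightarrow> app (app (app (cst Rec) (num a)) (num b)) h = num (rec a b h)"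
  unfolding rec_def by (rule num_den[symmetric]) (meson app_dom cst_dom_simps num_dom)

lemma rec_Z: "h \<in> dom (TNat \<Rrightarrow> T1) \<Longrightarrow> rec Z b h = b"
  using axiom[OF Rec_Zero _ typed_env, simplified] by (simp add: cst_Zero app_Rec)

lemma rec_S: "h \<in> dom (TNat \<Rrightarrow> T1) \<Longrightarrow> rec (S a) b h = den (app (app h (num (rec a b h))) (num a))"
proof -
  assume h: "h \<in> dom (TNat \<Rrightarrow> T1)"
  then have "num (rec (S a) b h) = app (app h (num (rec a b h))) (num a)"
    using axiom[OF Rec_Succ _ typed_env, simplified] by (simp add: app_Rec)
  then show ?thesis by (metis den_num)
qed

text \<open>As in \<open>Rec_Succ\<close>, the outer variable of the step function receives the
  previous value and the inner one the counter.\<close>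

lemma rec_lam:
  fixes x y :: string and bs :: "'u list"
  assumes "typed \<rho>" "tyof [] t = Some TNat"
  defines "h \<equiv> evt \<rho> bs (\<^bold>\<lambda>x. \<^bold>\<lambda>y. t)"
  shows "h \<in> dom (TNat \<Rrightarrow> T1)" "rec Z b h = b"
    "rec (S a) b h = den (evt (\<rho>((x, TNat) := num (rec a b h), (y, TNat) := num a)) [] t)"
proof -
  have "tyof [] (\<^bold>\<lambda>x. \<^bold>\<lambda>y. t) = Some (TNat \<Rrightarrow> T1)" using assms by simp
  then show h: "h \<in> dom (TNat \<Rrightarrow> T1)"
    unfolding h_def using assms(1) evt_dom evt_closed by metis
  then show "rec Z b h = b" by (rule rec_Z)
  show "rec (S a) b h = den (evt (\<rho>((x, TNat) := num (rec a b h), (y, TNat) := num a)) [] t)"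
    using rec_S[OF h] assms by (simp add: h_def)
qed

text \<open>These are the functions that the model knows. Since its numbers may be nonstandard,
  induction is legitimate only for properties expressed with them.\<close>

definition rep :: "('n \<Rightarrow> 'n) \<Rightarrow> bool" where
  "rep F \<longleftrightarrow> (\<exists>f\<in>dom T1. F = fn f)"

lemma repI:
  assumes "typed \<rho>" "tyof [] t = Some TNat" "\<And>a. evt (\<rho>((x, TNat) := num a)) [] t = num (F a)"
  shows "rep F"
  unfolding rep_def
proof
  let ?f = "evt \<rho> [] (\<^bold>\<lambda>x. t)"
  show f: "?f \<in> dom T1" using assms by (simp add: evt_dom)
  show "F = fn ?f" using assms by (auto simp: fn_def)
qed

text \<open>\<open>QF_IND\<close> for an equation between two type-1 parameters. Arithmetical
  identities then follow by showing that both sides are internal and obey the same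
  recursion.\<close>

lemma rep_induct:
  assumes "rep F" "rep G" "F Z = G Z" "\<And>a. F a = G a \<Longrightarrow> F (S a) = G (S a)"
  shows "F a = G a"
proof -
  obtain f g where fg: "f \<in> dom T1" "g \<in> dom T1" "F = fn f" "G = fn g" using assms unfolding rep_def by blast
  let ?\<phi> = "fnv ''f'' \<cdot> nv ''n'' \<^bold>= fnv ''g'' \<cdot> nv ''n''"
  let ?\<rho> = "env((''f'', T1) := f, (''g'', T1) := g)"
  have "ev ?\<rho> [] (subst ''n'' TNat Zero ?\<phi> \<^bold>\<and>
      (\<^bold>\<forall>''n'':TNat. ?\<phi> \<^bold>\<longrightarrow> subst ''n'' TNat (Succ \<cdot> nv ''n'') ?\<phi>) \<^bold>\<longrightarrow> (\<^bold>\<forall>''n'':TNat. ?\<phi>))"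
    by (rule axiom[OF QF_IND]) (use fg in simp_all)
  then have "fn f Z = fn g Z \<Longrightarrow> \<forall>a. fn f a = fn g a \<longrightarrow> fn f (S a) = fn g (S a) \<Longrightarrow> fn f a = fn g a"
    using fg by simp
  then show ?thesis using assms(3,4) fg by blast
qed

lemma rep_const: "rep (\<lambda>a. b)"
  by (rule repI[of "env((''b'', TNat) := num b)" "nv ''b''" "''x''"]) auto

lemma rep_id: "rep (\<lambda>a. a)"
  by (rule repI[of env "nv ''x''" "''x''"]) auto

lemma rep_comp: "f \<in> dom T1 \<Longrightarrow> rep G \<Longrightarrow> rep (\<lambda>a. fn f (G a))"
proof -
  assume f: "f \<in> dom T1" and "rep G"
  then obtain g where g: "g \<in> dom T1" "G = fn g" unfolding rep_def by blast
  show ?thesis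
    by (rule repI[of "env((''f'', T1) := f, (''g'', T1) := g)" "fnv ''f'' \<cdot> (fnv ''g'' \<cdot> nv ''x'')" "''x''"])
      (use f g in auto)
qed

lemma rep_S: "rep G \<Longrightarrow> rep (\<lambda>a. S (G a))"
  unfolding S_def by (rule rep_comp) simp_all

lemma rep_comp2:
  assumes t: "tyof [] t = Some (TNat \<Rrightarrow> T1)" and "rep F" "rep G"
  shows "rep (\<lambda>a. fn (app (evt env [] t) (num (F a))) (G a))"
proof -
  obtain f g where fg: "f \<in> dom T1" "g \<in> dom T1" "F = fn f" "G = fn g" using assms unfolding rep_def by blast
  let ?\<rho> = "env((''h'', TNat \<Rrightarrow> T1) := evt env [] t, (''f'', T1) := f, (''g'', T1) := g)"
  have h: "evt env [] t \<in> dom (TNat \<Rrightarrow> T1)" using t evt_dom by simp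
  then have "app (evt env [] t) (num b) \<in> dom T1" for b by (rule app_dom) simp
  then show ?thesis
    by (intro repI[of ?\<rho> "Fr ''h'' (TNat \<Rrightarrow> T1) \<cdot> (fnv ''f'' \<cdot> nv ''x'') \<cdot> (fnv ''g'' \<cdot> nv ''x'')" "''x''"])
      (use fg h in auto)
qed

lemma evt_drop: "v \<notin> fv_tm t \<Longrightarrow> evt (\<rho>(v := a)) bs t = evt \<rho> bs t"
  by (rule evt_cong) auto

lemma evt_const: "fv_tm t = {} \<Longrightarrow> tyof [] t = Some \<tau> \<Longrightarrow> evt \<rho> bs t = evt env [] t"
  using evt_cong[of t \<rho> env bs] evt_closed[of t \<tau> env bs] by simp

section \<open>Primitive recursive arithmetic: semiring laws and truncated subtraction\<close>

definition add :: "'n \<Rightarrow> 'n \<Rightarrow> 'n" where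
  "add a b = rec b a (evt env [] (\<^bold>\<lambda>''u''. \<^bold>\<lambda>''v''. Succ \<cdot> nv ''u''))"

definition mul :: "'n \<Rightarrow> 'n \<Rightarrow> 'n" where
  "mul a b = rec b Z (evt (env((''x'', TNat) := num a)) [] (\<^bold>\<lambda>''u''. \<^bold>\<lambda>''v''. (nv ''u'' \<^bold>+ nv ''x'')))"

definition pre :: "'n \<Rightarrow> 'n" where
  "pre a = rec a Z (evt env [] (\<^bold>\<lambda>''u''. \<^bold>\<lambda>''v''. nv ''v''))"

definition sub :: "'n \<Rightarrow> 'n \<Rightarrow> 'n" where
  "sub a b = rec b a (evt env [] (\<^bold>\<lambda>''u''. \<^bold>\<lambda>''v''. pred_tm \<cdot> nv ''u''))"

lemma app_add [simp]: "app (app (evt \<rho> bs add_tm) (num a)) (num b) = num (add a b)"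
proof -
  have *: "evt \<rho> bs add_tm = evt env [] add_tm" by (rule evt_const) simp_all
  show ?thesis unfolding * by (simp add: add_tm_def app_Rec evt_dom evt_drop add_def)
qed

lemma app_mul [simp]: "app (app (evt \<rho> bs mult_tm) (num a)) (num b) = num (mul a b)"
proof -
  have *: "evt \<rho> bs mult_tm = evt env [] mult_tm" by (rule evt_const) simp_all
  show ?thesis unfolding * by (simp add: mult_tm_def app_Rec evt_dom evt_drop mul_def)
qed

lemma app_pre [simp]: "app (evt \<rho> bs pred_tm) (num a) = num (pre a)"
proof -
  have *: "evt \<rho> bs pred_tm = evt env [] pred_tm" by (rule evt_const) simp_all
  show ?thesis unfolding * by (simp add: pred_tm_def app_Rec evt_dom evt_drop pre_def)
qed

lemma app_sub [simp]: "app (app (evt \<rho> bs monus_tm) (num a)) (num b) = num (sub a b)"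
proof -
  have *: "evt \<rho> bs monus_tm = evt env [] monus_tm" by (rule evt_const) simp_all
  show ?thesis unfolding * by (simp add: monus_tm_def app_Rec evt_dom evt_drop sub_def)
qed

lemma add_Z [simp]: "add a Z = a" and add_S: "add a (S b) = S (add a b)"
  unfolding add_def by (simp_all add: rec_lam)

lemma mul_Z [simp]: "mul a Z = Z" and mul_S: "mul a (S b) = add (mul a b) a"
  unfolding mul_def by (simp_all add: rec_lam)

lemma pre_Z [simp]: "pre Z = Z" and pre_S [simp]: "pre (S a) = a"
  unfolding pre_def by (simp_all add: rec_lam)

lemma sub_Z [simp]: "sub a Z = a" and sub_S: "sub a (S b) = pre (sub a b)"
  unfolding sub_def by (simp_all add: rec_lam)

lemma rep_add: "rep F \<Longrightarrow> rep G \<Longrightarrow> rep (\<lambda>a. add (F a) (G a))"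
  using rep_comp2[of add_tm F G] by (simp add: fn_def)

lemma rep_mul: "rep F \<Longrightarrow> rep G \<Longrightarrow> rep (\<lambda>a. mul (F a) (G a))"
  using rep_comp2[of mult_tm F G] by (simp add: fn_def)

lemma rep_sub: "rep F \<Longrightarrow> rep G \<Longrightarrow> rep (\<lambda>a. sub (F a) (G a))"
  using rep_comp2[of monus_tm F G] by (simp add: fn_def)

lemma rep_pre: "rep F \<Longrightarrow> rep (\<lambda>a. pre (F a))"
  using rep_comp[of "evt env [] pred_tm" F] by (simp add: fn_def evt_dom)

lemmas rep_intros = rep_const rep_id rep_S rep_add rep_mul rep_sub rep_pre

lemma add_assoc: "add (add a b) c = add a (add b c)"
  by (rule rep_induct[of "\<lambda>c. add (add a b) c"]) (auto intro!: rep_intros simp: add_S)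

lemma Z_add [simp]: "add Z a = a"
  by (rule rep_induct[of "\<lambda>a. add Z a"]) (auto intro!: rep_intros simp: add_S)

lemma S_add: "add (S a) b = S (add a b)"
  by (rule rep_induct[of "\<lambda>b. add (S a) b"]) (auto intro!: rep_intros simp: add_S)

lemma add_commute: "add a b = add b a"
  by (rule rep_induct[of "\<lambda>b. add a b"]) (auto intro!: rep_intros simp: add_S S_add)

lemma add_left_commute: "add a (add b c) = add b (add a c)"
  by (metis add_assoc add_commute)

lemma Z_mul [simp]: "mul Z a = Z"
  by (rule rep_induct[of "\<lambda>a. mul Z a"]) (auto intro!: rep_intros simp: mul_S)

lemma S_mul: "mul (S a) b = add (mul a b) b"
  by (rule rep_induct[of "\<lambda>b. mul (S a) b"])
    (auto intro!: rep_intros simp: mul_S add_S add_assoc add_commute[of a])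

lemma mul_commute: "mul a b = mul b a"
  by (rule rep_induct[of "\<lambda>b. mul a b"]) (auto intro!: rep_intros simp: mul_S S_mul)

lemma mul_distrib_right: "mul (add a b) c = add (mul a c) (mul b c)"
  by (rule rep_induct[of "\<lambda>c. mul (add a b) c"])
    (auto intro!: rep_intros simp: mul_S add_assoc add_commute add_left_commute)

lemma mul_distrib_left: "mul c (add a b) = add (mul c a) (mul c b)"
  using mul_distrib_right[of a b c] by (simp add: mul_commute)

lemma mul_assoc: "mul (mul a b) c = mul a (mul b c)"
  by (rule rep_induct[of "\<lambda>c. mul (mul a b) c"]) (auto intro!: rep_intros simp: mul_S mul_distrib_left)

text \<open>The case distinction is a disjunction of two equations, hence quantifier-free, and
  \<open>QF_IND\<close> applies to it directly; the induction step holds outright by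
  \<open>pre_S\<close>.\<close>

lemma zero_or_S: "a = Z \<or> a = S (pre a)"
proof -
  let ?\<phi> = "nv ''n'' \<^bold>= Zero \<^bold>\<or> nv ''n'' \<^bold>= Succ \<cdot> (pred_tm \<cdot> nv ''n'')"
  have "ev env [] (subst ''n'' TNat Zero ?\<phi> \<^bold>\<and>
      (\<^bold>\<forall>''n'':TNat. ?\<phi> \<^bold>\<longrightarrow> subst ''n'' TNat (Succ \<cdot> nv ''n'') ?\<phi>) \<^bold>\<longrightarrow> (\<^bold>\<forall>''n'':TNat. ?\<phi>))"
    by (rule axiom[OF QF_IND]) (auto simp: disj_fm_def neg_fm_def)
  then have "\<forall>a. a \<noteq> Z \<longrightarrow> a = S (pre a)" by (simp add: disj_fm_def neg_fm_def)
  then show ?thesis by blast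
qed

lemma S_sub_S [simp]: "sub (S a) (S b) = sub a b"
  by (rule rep_induct[of "\<lambda>b. sub (S a) (S b)"]) (auto intro!: rep_intros simp: sub_S)

lemma add_sub [simp]: "sub (add a b) b = a"
  by (rule rep_induct[of "\<lambda>b. sub (add a b) b"]) (auto intro!: rep_intros simp: add_S)

lemma sub_self [simp]: "sub a a = Z"
  using add_sub[of Z a] by simp

lemma sub_add: "sub a (add b c) = sub (sub a b) c"
  by (rule rep_induct[of "\<lambda>c. sub a (add b c)"]) (auto intro!: rep_intros simp: add_S sub_S)

lemma Z_sub [simp]: "sub Z a = Z"
  by (rule rep_induct[of "\<lambda>a. sub Z a"]) (auto intro!: rep_intros simp: sub_S)

text \<open>
  The following two identities are proved at \<open>a - k\<close>, \<open>b - k\<close>, with \<open>k\<close> descending from \<open>a\<close> to \<open>0\<close>, which makes the statement quantifier-free in the induction variable \<open>j = a - k\<close>.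
\<close>

lemma sub_sub_cases:
  obtains "sub a j = Z" "sub a (S j) = Z" | k where "sub a j = S k" "sub a (S j) = k"
  using zero_or_S[of "sub a j"] by (metis pre_S pre_Z sub_S)

lemma add_sub_max: "add a (sub b a) = add b (sub a b)"
proof -
  define x where "x = (\<lambda>j. sub a (sub a j))"
  define y where "y = (\<lambda>j. sub b (sub a j))"
  have "add (x a) (sub (y a) (x a)) = add (y a) (sub (x a) (y a))"
  proof (rule rep_induct[of "\<lambda>j. add (x j) (sub (y j) (x j))"])
    fix j
    assume IH: "add (x j) (sub (y j) (x j)) = add (y j) (sub (x j) (y j))"
    \<comment> \<open>Once \<open>j\<close> has reached \<open>a\<close>, neither value moves any
      more; before that, \<open>a - j\<close> drops by one, so the values at \<open>j\<close> are
      the predecessors of those at \<open>S j\<close>.\<close>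
    consider "x (S j) = x j" "y (S j) = y j" | "x j = pre (x (S j))" "y j = pre (y (S j))"
      by (rule sub_sub_cases[of a j]) (auto simp: x_def y_def sub_S)
    then show "add (x (S j)) (sub (y (S j)) (x (S j))) = add (y (S j)) (sub (x (S j)) (y (S j)))"
    proof cases
      case 2
      show ?thesis
      proof (cases "x (S j) = Z \<or> y (S j) = Z")
        case False
        then have "x (S j) = S (x j)" "y (S j) = S (y j)" using 2 zero_or_S by metis+
        then show ?thesis using IH by (simp add: S_add)
      qed auto
    qed (use IH in simp)
  qed (auto intro!: rep_intros simp: x_def y_def)
  then show ?thesis by (simp add: x_def y_def)
qed

lemma sub_mul_sub: "mul (sub b a) (sub a b) = Z"
proof -
  define x where "x = (\<lambda>j. sub a (sub a j))"
  define y where "y = (\<lambda>j. sub b (sub a j))"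
  have "mul (sub (y a) (x a)) (sub (x a) (y a)) = Z"
  proof (rule rep_induct[of "\<lambda>j. mul (sub (y j) (x j)) (sub (x j) (y j))"])
    fix j
    assume IH: "mul (sub (y j) (x j)) (sub (x j) (y j)) = Z"
    consider "x (S j) = x j" "y (S j) = y j" | "x j = pre (x (S j))" "y j = pre (y (S j))"
      by (rule sub_sub_cases[of a j]) (auto simp: x_def y_def sub_S)
    then show "mul (sub (y (S j)) (x (S j))) (sub (x (S j)) (y (S j))) = Z"
    proof cases
      case 2
      show ?thesis
      proof (cases "x (S j) = Z \<or> y (S j) = Z")
        case False
        then have "x (S j) = S (x j)" "y (S j) = S (y j)" using 2 zero_or_S by metis+
        then show ?thesis using IH by simp
      qed auto
    qed (use IH in simp)
  qed (auto intro!: rep_intros simp: x_def y_def)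
  then show ?thesis by (simp add: x_def y_def)
qed

lemma mul_eq_Z: "mul a b = Z \<Longrightarrow> a = Z \<or> b = Z"
  using zero_or_S[of a] zero_or_S[of b] by (metis S_neq(1) add_S mul_S)

text \<open>Linearity is a disjunction, out of reach of equational induction.
  \<open>sub_mul_sub\<close> packs it into one equation, and the absence of zero divisors unpacks it
  again.\<close>

lemma sub_linear: "sub a b = Z \<or> sub b a = Z"
  using sub_mul_sub mul_eq_Z by blast

lemma sub_antisym: "sub a b = Z \<Longrightarrow> sub b a = Z \<Longrightarrow> a = b"
  using add_sub_max[of a b] by simp

lemma sub_inverse: "sub b a = Z \<Longrightarrow> add (sub a b) b = a"
  using add_sub_max[of a b] by (simp add: add_commute)

lemma mul_sub: "mul a (sub b c) = sub (mul a b) (mul a c)"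
proof (cases "sub b c = Z")
  case True
  have "mul a c = mul a (add (sub c b) b)" using sub_inverse[OF True] by simp
  also have "\<dots> = add (mul a b) (mul a (sub c b))" unfolding mul_distrib_left by (rule add_commute)
  finally have "sub (mul a b) (mul a c) = Z" by (simp add: sub_add)
  then show ?thesis using True by simp
next
  case False
  then have "sub c b = Z" using sub_linear by blast
  have "mul a b = mul a (add (sub b c) c)" using sub_inverse[OF \<open>sub c b = Z\<close>] by simp
  also have "\<dots> = add (mul a (sub b c)) (mul a c)" by (rule mul_distrib_left)
  finally show ?thesis by simp
qed

lemma sub_discrete: "sub a b \<noteq> Z \<Longrightarrow> sub (add b (S Z)) a = Z"
proof -
  assume ne: "sub a b \<noteq> Z"
  then have "sub b a = Z" using sub_linear by blast
  have "a = add (sub a b) b" using sub_inverse[OF \<open>sub b a = Z\<close>] by simp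
  also have "sub a b = S (pre (sub a b))" using ne zero_or_S by blast
  finally have "a = add (add b (S Z)) (pre (sub a b))" by (simp add: add_S S_add add_commute)
  then have "sub (add b (S Z)) a = sub (add b (S Z)) (add (add b (S Z)) (pre (sub a b)))" by simp
  also have "\<dots> = Z" by (simp only: sub_add sub_self Z_sub)
  finally show ?thesis .
qed

end

text \<open>The laws behind the class \<open>linordered_semidom\<close>, with explicit operations,
  so that they can be verified inside the model first and moved to a type instance afterwards. The
  order is coded by vanishing truncated differences.\<close>

locale semidom_structure =
  fixes z e :: 'n and add mul sub :: "'n \<Rightarrow> 'n \<Rightarrow> 'n"
  assumes assoc: "add (add a b) c = add a (add b c)" and comm: "add a b = add b a" and zero: "add z a = a"
    and massoc: "mul (mul a b) c = mul a (mul b c)" and mcomm: "mul a b = mul b a" and one: "mul e a = a"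
    and dist: "mul (add a b) c = add (mul a c) (mul b c)" and mzero: "mul z a = z"
    and cancel: "sub (add a b) a = b" and sub_sub: "sub (sub a b) c = sub a (add b c)"
    and mult_sub: "mul a (sub b c) = sub (mul a b) (mul a c)" and z_neq_e: "z \<noteq> e"
    and nodiv: "mul a b = z \<Longrightarrow> a = z \<or> b = z" and linear: "sub a b = z \<or> sub b a = z"
    and antisym: "sub a b = z \<Longrightarrow> sub b a = z \<Longrightarrow> a = b"
    and inv: "sub b a = z \<Longrightarrow> add (sub a b) b = a"
    and zsub: "sub z a = z"

lemma (in numbered_model) semidom_structure: "semidom_structure Z (S Z) add mul sub"
proof
  fix a b c
  show "mul (S Z) a = a" by (simp add: S_mul)
  show "sub (add a b) a = b" using add_sub[of b a] by (simp add: add_commute)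
  show "add (add a b) c = add a (add b c)" by (rule add_assoc)
  show "add a b = add b a" by (rule add_commute)
  show "mul (mul a b) c = mul a (mul b c)" by (rule mul_assoc)
  show "mul a b = mul b a" by (rule mul_commute)
  show "mul (add a b) c = add (mul a c) (mul b c)" by (rule mul_distrib_right)
  show "sub (sub a b) c = sub a (add b c)" by (rule sub_add[symmetric])
  show "mul a (sub b c) = sub (mul a b) (mul a c)" by (rule mul_sub)
  show "sub a b = Z \<or> sub b a = Z" by (rule sub_linear)
qed (simp_all add: mul_eq_Z sub_antisym sub_inverse)

section \<open>The ordered field of differences and quotients\<close>

text \<open>A pair \<open>(x, y)\<close> stands for x - y. This ring completion is needed because
  \<open>fract\<close> carries an ordered field only over an ordered integral domain. Addition is
  cancellative, so the relation needs no auxiliary summand.\<close>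

definition diff_rel :: "'a::linordered_semidom \<times> 'a \<Rightarrow> 'a \<times> 'a \<Rightarrow> bool" where
  "diff_rel = (\<lambda>(x, y) (u, v). x + v = u + y)"

lemma diff_rel_iff [simp]: "diff_rel (x, y) (u, v) \<longleftrightarrow> x + v = u + y"
  by (simp add: diff_rel_def)

quotient_type (overloaded) 'a difference = "'a::linordered_semidom \<times> 'a" / diff_rel
  morphisms Rep_difference Abs_difference
proof (rule equivpI)
  show "reflp diff_rel" by (auto simp: reflp_def)
  show "symp diff_rel" by (auto simp: symp_def)
  show "transp (diff_rel :: 'a \<times> 'a \<Rightarrow> _)"
  proof (rule transpI, clarsimp)
    fix a b c d e f :: 'a
    assume "a + d = c + b" "c + f = e + d"
    then have "(a + f) + (c + d) = (e + b) + (c + d)" by (simp add: algebra_simps) (metis add.assoc add.commute)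
    then show "a + f = e + b" by (simp only: add_right_cancel)
  qed
qed

instantiation difference :: (linordered_semidom) comm_ring_1
begin

lift_definition zero_difference :: "'a difference" is "(0, 0)" .
lift_definition one_difference :: "'a difference" is "(1, 0)" .

lift_definition plus_difference :: "'a difference \<Rightarrow> 'a difference \<Rightarrow> 'a difference"
  is "\<lambda>(x, y) (u, v). (x + u, y + v)"
  by (clarsimp simp: algebra_simps) (metis add.assoc add.commute)

lift_definition uminus_difference :: "'a difference \<Rightarrow> 'a difference" is "\<lambda>(x, y). (y, x)"
  by (clarsimp simp: algebra_simps)

lift_definition minus_difference :: "'a difference \<Rightarrow> 'a difference \<Rightarrow> 'a difference"
  is "\<lambda>(x, y) (u, v). (x + v, y + u)"
  by (clarsimp simp: algebra_simps) (metis add.assoc add.commute)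

lift_definition times_difference :: "'a difference \<Rightarrow> 'a difference \<Rightarrow> 'a difference"
  is "\<lambda>(x, y) (u, v). (x * u + y * v, x * v + y * u)"
proof clarsimp
  fix s t u v w x y z :: 'a
  assume "s + v = u + t" "w + z = y + x"
  then have "(s + v) * w + (u + t) * x + u * (w + z) + v * (y + x) =
    (u + t) * w + (s + v) * x + u * (y + x) + v * (w + z)"
    by simp
  then have "((s * w + t * x) + (u * z + v * y)) + (u * w + v * w + u * x + v * x) =
      ((u * y + v * z) + (s * x + t * w)) + (u * w + v * w + u * x + v * x)"
    by (simp add: algebra_simps)
  then show "s * w + t * x + (u * z + v * y) = u * y + v * z + (s * x + t * w)"
    by (simp only: add_right_cancel)
qed

instance
  by standard (transfer; clarsimp simp: algebra_simps)+

end

text \<open>Multiplication of a strict inequality of differences by the positive difference e - f.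
  Writing e = f + g with g > 0, all products with f occur on both sides and only the factor g
  remains.\<close>

lemma difference_mult_less:
  fixes a b c d e f :: "'a::linordered_semidom"
  assumes "a + d < c + b" "f < e"
  shows "e * a + f * b + (e * d + f * c) < e * c + f * d + (e * b + f * a)"
proof -
  define g where "g = e - f"
  have g: "e = f + g" unfolding g_def using assms(2) by (simp add: less_imp_le)
  then have "0 < g" using assms(2) by simp
  then have "g * (a + d) < g * (c + b)" using assms(1) by (intro mult_strict_left_mono)
  then have "g * (a + d) + (f * a + f * d + f * c + f * b) < g * (c + b) + (f * a + f * d + f * c + f * b)"
    by simp
  then show ?thesis unfolding g by (simp add: algebra_simps)
qed

instantiation difference :: (linordered_semidom) linordered_idom
begin

lift_definition less_eq_difference :: "'a difference \<Rightarrow> 'a difference \<Rightarrow> bool"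
  is "\<lambda>(x, y) (u, v). x + v \<le> u + y"
proof clarsimp
  fix a b a' b' c d c' d' :: 'a
  assume eq: "a + b' = a' + b" "c + d' = c' + d"
  have "a + d \<le> c + b \<longleftrightarrow> (a + d) + (b' + d') \<le> (c + b) + (b' + d')" by simp
  also have "(a + d) + (b' + d') = (a + b') + (d + d')" by (simp add: algebra_simps)
  also have "\<dots> = (a' + d') + (b + d)" unfolding eq by (simp add: algebra_simps)
  also have "(c + b) + (b' + d') = (c + d') + (b + b')" by (simp add: algebra_simps)
  also have "\<dots> = (c' + b') + (b + d)" unfolding eq by (simp add: algebra_simps)
  finally show "a + d \<le> c + b \<longleftrightarrow> a' + d' \<le> c' + b'" by simp
qed

definition less_difference :: "'a difference \<Rightarrow> 'a difference \<Rightarrow> bool" where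
  "less_difference x y \<longleftrightarrow> x \<le> y \<and> \<not> y \<le> x"

definition abs_difference :: "'a difference \<Rightarrow> 'a difference" where
  "abs_difference x = (if x < 0 then - x else x)"

definition sgn_difference :: "'a difference \<Rightarrow> 'a difference" where
  "sgn_difference x = (if x = 0 then 0 else if 0 < x then 1 else - 1)"


instance
proof
  fix x y z :: "'a difference"
  show "x < y \<longleftrightarrow> x \<le> y \<and> \<not> y \<le> x" by (simp add: less_difference_def)
  show "x \<le> x" by transfer auto
  show "x \<le> z" if "x \<le> y" "y \<le> z"
    using that
  proof (transfer, clarsimp)
    fix a b c d e f :: 'a
    assume "a + d \<le> c + b" "c + f \<le> e + d"
    then have "(a + d) + (c + f) \<le> (c + b) + (e + d)" by (rule add_mono)
    then have "(a + f) + (c + d) \<le> (e + b) + (c + d)" by (simp add: algebra_simps)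
    then show "a + f \<le> e + b" by (simp only: add_le_cancel_right)
  qed
  show "x = y" if "x \<le> y" "y \<le> x" using that by transfer auto
  show "x \<le> y \<or> y \<le> x" by transfer auto
  show "z + x \<le> z + y" if "x \<le> y"
    using that
  proof (transfer, clarsimp)
    fix a b c d e f :: 'a
    assume "a + d \<le> c + b"
    then have "(a + d) + (e + f) \<le> (c + b) + (e + f)" by simp
    then show "e + a + (f + d) \<le> e + c + (f + b)" by (simp only: ac_simps)
  qed
  show "z * x < z * y" if "x < y" "0 < z"
    using that unfolding less_difference_def
    by (transfer, clarsimp simp: not_le) (intro conjI less_imp_le difference_mult_less; simp add: less_le)
qed (simp_all add: abs_difference_def sgn_difference_def)

end

lift_definition difference_of :: "'a::linordered_semidom \<Rightarrow> 'a difference" is "\<lambda>a. (a, 0)" .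

type_synonym 'a quotient_field = "'a difference fract"

definition emb :: "'a::linordered_semidom \<Rightarrow> 'a quotient_field" where
  "emb a = Fract (difference_of a) 1"

lemma difference_of_hom:
  "difference_of 0 = 0" "difference_of 1 = 1"
  "difference_of (a + b) = difference_of a + difference_of b"
  "difference_of (a * b) = difference_of a * difference_of b"
  "difference_of a \<le> difference_of b \<longleftrightarrow> a \<le> b"
  by (transfer, simp)+

lemma emb_0 [simp]: "emb 0 = 0"
  by (simp add: emb_def difference_of_hom Zero_fract_def)

lemma emb_1 [simp]: "emb 1 = 1"
  by (simp add: emb_def difference_of_hom One_fract_def)

lemma emb_add [simp]: "emb (a + b) = emb a + emb b"
  by (simp add: emb_def difference_of_hom)

lemma emb_mult [simp]: "emb (a * b) = emb a * emb b"
  by (simp add: emb_def difference_of_hom)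

lemma emb_le [simp]: "emb a \<le> emb b \<longleftrightarrow> a \<le> b"
  by (simp add: emb_def difference_of_hom)

lemma emb_less [simp]: "emb a < emb b \<longleftrightarrow> a < b"
  by (simp add: less_le_not_le)

lemma emb_eq [simp]: "emb a = emb b \<longleftrightarrow> a = b"
  by (simp add: eq_iff)

lemma emb_diff: "b \<le> a \<Longrightarrow> emb (a - b) = emb a - emb b"
  using emb_add[of "a - b" b] by (simp del: emb_add)

section \<open>The numbers of a countermodel\<close>

definition Th :: "fm set" where "Th = ACA0w \<union> {Sigma_IND} \<union> ENCw"

lemma Th_RCA0w: "RCA0w \<subseteq> Th"
  by (auto simp: Th_def ACA0w_def)

definition countermodel :: "(ty \<Rightarrow> tm set) \<times> (tm \<Rightarrow> tm \<Rightarrow> tm) \<times> (tm \<Rightarrow> tm) \<Rightarrow> bool" where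
  "countermodel = (\<lambda>(dom, app, cst). model dom app cst Th \<and>
    (\<exists>\<rho>. semantics.typed dom \<rho> \<and> \<not> semantics.ev dom app cst (=) \<rho> [] HBT))"

definition the_countermodel :: "(ty \<Rightarrow> tm set) \<times> (tm \<Rightarrow> tm \<Rightarrow> tm) \<times> (tm \<Rightarrow> tm)" where
  "the_countermodel = (SOME M. countermodel M)"

definition Dom :: "ty \<Rightarrow> tm set" where "Dom = fst the_countermodel"
definition Ap :: "tm \<Rightarrow> tm \<Rightarrow> tm" where "Ap = fst (snd the_countermodel)"
definition Cst :: "tm \<Rightarrow> tm" where "Cst = snd (snd the_countermodel)"

text \<open>
  Type classes can only be instantiated unconditionally. So the numbers of the countermodel are
  transferred to a copy of the type \<open>nat\<close>, which carries the usual structure if \<open>HBT\<close> is derivable.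
\<close>

typedef nn = "UNIV :: nat set" ..

definition Num :: "nn \<Rightarrow> tm" where "Num = (SOME num. bij_betw num UNIV (Dom TNat))"

text \<open>The successor maps the numbers injectively into the nonzero ones, impossible on a finite
  set. Together with countability of the syntax this lets the numbers be indexed by a copy of
  \<open>nat\<close>.\<close>

lemma (in rca_model) infinite_TNat: "infinite (dom TNat)"
proof
  assume fin: "finite (dom TNat)"
  let ?S = "app (cst Succ)"
  have "?S ` dom TNat \<subseteq> dom TNat - {cst Zero}"
    using axiom[OF Succ_nonzero _ typed_env, simplified] app_dom[OF cst_dom_simps(2)] by auto
  moreover have "inj_on ?S (dom TNat)"
    using axiom[OF Succ_inj _ typed_env, simplified] by (auto simp: inj_on_def)
  ultimately have "card (dom TNat) \<le> card (dom TNat - {cst Zero})"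
    using fin by (metis card_image card_mono finite_Diff)
  moreover have "card (dom TNat - {cst Zero}) < card (dom TNat)"
    using fin by (intro card_Diff1_less) auto
  ultimately show False by simp
qed

lemma numbering_exists: "infinite (A :: tm set) \<Longrightarrow> \<exists>num :: nn \<Rightarrow> tm. bij_betw num UNIV A"
proof -
  assume "infinite A"
  then have "bij_betw (from_nat_into A) UNIV A" by (intro bij_betw_from_nat_into) auto
  moreover have "bij_betw Rep_nn UNIV UNIV"
    by (metis bijI' Rep_nn_inject Abs_nn_inverse UNIV_I)
  ultimately show ?thesis using bij_betw_trans by blast
qed

lemma countermodel_nn:
  assumes "\<not> (Th \<turnstile> HBT)"
  shows "numbered_model Dom Ap Cst Th Num" "\<exists>\<rho>. semantics.typed Dom \<rho> \<and> \<not> semantics.ev Dom Ap Cst (=) \<rho> [] HBT"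
proof -
  have "\<exists>M. countermodel M"
    using countermodel_exists[OF Th_RCA0w wf_HBT assms] by (auto simp: countermodel_def)
  then have "countermodel the_countermodel" unfolding the_countermodel_def by (rule someI_ex)
  then have M: "model Dom Ap Cst Th"
    and "\<exists>\<rho>. semantics.typed Dom \<rho> \<and> \<not> semantics.ev Dom Ap Cst (=) \<rho> [] HBT"
    unfolding countermodel_def Dom_def Ap_def Cst_def case_prod_beta by blast+
  then show "\<exists>\<rho>. semantics.typed Dom \<rho> \<and> \<not> semantics.ev Dom Ap Cst (=) \<rho> [] HBT" by blast
  interpret model Dom Ap Cst Th by (rule M)
  interpret rca_model Dom Ap Cst Th by unfold_locales (rule Th_RCA0w)
  have "bij_betw Num UNIV (Dom TNat)"
    unfolding Num_def using numbering_exists[OF infinite_TNat] by (rule someI_ex)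
  then show "numbered_model Dom Ap Cst Th Num" by unfold_locales
qed

type_synonym nn_ops = "nn \<times> nn \<times> (nn \<Rightarrow> nn \<Rightarrow> nn) \<times> (nn \<Rightarrow> nn \<Rightarrow> nn) \<times> (nn \<Rightarrow> nn \<Rightarrow> nn)"

definition standard_ops :: nn_ops where
  "standard_ops = (Abs_nn 0, Abs_nn 1, \<lambda>a b. Abs_nn (Rep_nn a + Rep_nn b),
    \<lambda>a b. Abs_nn (Rep_nn a * Rep_nn b), \<lambda>a b. Abs_nn (Rep_nn a - Rep_nn b))"

definition model_ops :: nn_ops where
  "model_ops = (numbered_model.Z Cst Num, numbered_model.S Ap Cst Num (numbered_model.Z Cst Num),
    numbered_model.add Dom Ap Cst Num, numbered_model.mul Dom Ap Cst Num, numbered_model.sub Dom Ap Cst Num)"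

definition ops :: nn_ops where "ops = (if Th \<turnstile> HBT then standard_ops else model_ops)"

lemma ops_structure: "case ops of (z, e, add, mul, sub) \<Rightarrow> semidom_structure z e add mul sub"
proof (cases "Th \<turnstile> HBT")
  case True
  have "semidom_structure (Abs_nn 0) (Abs_nn 1) (\<lambda>a b. Abs_nn (Rep_nn a + Rep_nn b))
      (\<lambda>a b. Abs_nn (Rep_nn a * Rep_nn b)) (\<lambda>a b. Abs_nn (Rep_nn a - Rep_nn b))"
    by unfold_locales
      (auto simp: Abs_nn_inverse Abs_nn_inject Rep_nn_inverse Rep_nn_inject[symmetric] algebra_simps diff_mult_distrib2)
  then show ?thesis using True by (simp add: ops_def standard_ops_def)
next
  case False
  interpret numbered_model Dom Ap Cst Th Num by (rule countermodel_nn(1)[OF False])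
  show ?thesis using semidom_structure False by (simp add: ops_def model_ops_def)
qed

instantiation nn :: linordered_semidom
begin

definition zero_nn :: nn where "zero_nn = fst ops"
definition one_nn :: nn where "one_nn = fst (snd ops)"
definition plus_nn :: "nn \<Rightarrow> nn \<Rightarrow> nn" where "plus_nn = fst (snd (snd ops))"
definition times_nn :: "nn \<Rightarrow> nn \<Rightarrow> nn" where "times_nn = fst (snd (snd (snd ops)))"
definition minus_nn :: "nn \<Rightarrow> nn \<Rightarrow> nn" where "minus_nn = snd (snd (snd (snd ops)))"
definition less_eq_nn :: "nn \<Rightarrow> nn \<Rightarrow> bool" where "less_eq_nn a b \<longleftrightarrow> a - b = 0"
definition less_nn :: "nn \<Rightarrow> nn \<Rightarrow> bool" where "less_nn a b \<longleftrightarrow> a \<le> b \<and> \<not> b \<le> a"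

lemma nn_structure: "semidom_structure (0::nn) 1 (+) (*) (-)"
  using ops_structure
  by (simp add: zero_nn_def one_nn_def plus_nn_def times_nn_def minus_nn_def case_prod_beta)

instance
proof
  interpret s: semidom_structure "0::nn" 1 "(+)" "(*)" "(-)" by (rule nn_structure)
  fix a b c :: nn
  note assoc = s.assoc and comm = s.comm and zero = s.zero and mcomm = s.mcomm and dist = s.dist
    and cancel = s.cancel and sub = s.sub_sub and nodiv = s.nodiv and lin = s.linear
    and antisym = s.antisym and inv = s.inv and zsub = s.zsub
  have zr: "a + 0 = a" for a :: nn by (rule trans[OF comm zero])
  \<comment> \<open>In this form, with an explicit difference as witness, transitivity and
    monotonicity reduce to associativity and distributivity.\<close>
  have le: "a \<le> b \<longleftrightarrow> (\<exists>c. b = a + c)" for a b :: nn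
    unfolding less_eq_nn_def
  proof
    assume "a - b = 0"
    from inv[OF this] have "a + (b - a) = b" by (rule trans[OF comm])
    from this[symmetric] show "\<exists>c. b = a + c" by blast
  next
    assume "\<exists>c. b = a + c"
    then obtain c where "b = a + c" by blast
    have "a - a = 0" using cancel[of a 0] unfolding zr .
    then show "a - b = 0" unfolding \<open>b = a + c\<close> sub[symmetric] by (simp only: zsub)
  qed
  have addc: "a + b = a + c \<Longrightarrow> b = c" for a b c :: nn
    by (metis cancel)
  show "a + b + c = a + (b + c)" by (rule assoc)
  show "a + b = b + a" by (rule comm)
  show "0 + a = a" by (rule zero)
  show "a * b * c = a * (b * c)" "1 * a = a" by (rule s.massoc, rule s.one)
  show "a * b = b * a" by (rule mcomm)
  show "(a + b) * c = a * c + b * c" by (rule dist)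
  show "c * (a + b) = c * a + c * b" unfolding mcomm[of c] by (rule dist)
  show "a + b - a = b" by (rule cancel)
  show "a - b - c = a - (b + c)" by (rule sub)
  show "a * (b - c) = a * b - a * c" "(0::nn) \<noteq> 1" "0 * a = 0" by (rule s.mult_sub, rule s.z_neq_e, rule s.mzero)
  then show "a * 0 = 0" using mcomm[of a 0] by simp
  show "a * b \<noteq> 0" if "a \<noteq> 0" "b \<noteq> 0" using that nodiv by blast
  show "a < b \<longleftrightarrow> a \<le> b \<and> \<not> b \<le> a" by (rule less_nn_def)
  show "a \<le> a" unfolding le using zr[of a, symmetric] by blast
  show "a \<le> c" if ab: "a \<le> b" and bc: "b \<le> c"
  proof -
    obtain d e where "b = a + d" "c = b + e" using ab bc unfolding le by blast
    then show ?thesis unfolding le using assoc[of a d e] by blast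
  qed
  show anti: "a = b" if "a \<le> b" "b \<le> a" for a b :: nn using that antisym unfolding less_eq_nn_def by blast
  show "a \<le> b \<or> b \<le> a" unfolding less_eq_nn_def by (rule lin)
  show "c + a \<le> c + b" if "a \<le> b"
  proof -
    obtain d where "b = a + d" using \<open>a \<le> b\<close> unfolding le by blast
    then show ?thesis unfolding le using assoc[of c a d, symmetric] by blast
  qed
  show "c * a < c * b" if lt: "a < b" and c: "0 < c"
  proof -
    obtain d where b: "b = a + d" using lt unfolding less_nn_def le by blast
    have d: "d \<noteq> 0"
    proof
      assume "d = 0"
      then have "b = a" using b zr by simp
      then show False using lt unfolding less_nn_def by blast
    qed
    have "c \<noteq> 0" using c unfolding less_nn_def by blast
    then have cd: "c * d \<noteq> 0" using d nodiv by blast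
    have eq: "c * b = c * a + c * d"
      unfolding b using dist[of a d c] mcomm[of c "a + d"] mcomm[of c a] mcomm[of c d] by simp
    have "\<not> c * b \<le> c * a"
    proof
      assume "c * b \<le> c * a"
      moreover have "c * a \<le> c * b" unfolding le eq by blast
      ultimately have "c * b = c * a" by (rule anti)
      then have "c * a + c * d = c * a + 0" unfolding eq zr .
      then show False using cd addc by blast
    qed
    then show ?thesis unfolding less_nn_def using eq le[of "c * a" "c * b"] by blast
  qed
  show "(0::nn) < 1"
    unfolding less_nn_def le
  proof
    show "\<exists>c. (1::nn) = 0 + c" using zero[of 1, symmetric] by blast
    show "\<nexists>c. (0::nn) = 1 + c"
    proof
      assume "\<exists>c. (0::nn) = 1 + c"
      then have "1 \<le> (0::nn)" unfolding le .
      moreover have "0 \<le> (1::nn)" unfolding le using zero[of 1, symmetric] by blast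
      ultimately have "1 = (0::nn)" by (rule anti)
      then show False using s.z_neq_e by simp
    qed
  qed
  show "a - b + b = a" if "b \<le> a" using that inv unfolding less_eq_nn_def by blast
qed

end

section \<open>Models over a discretely ordered semiring\<close>

text \<open>The class \<open>linordered_semidom\<close> admits negative elements and leaves a - b
  open for a < b, so \<open>sub_zero\<close> is added. It makes all numbers nonnegative and, with
  \<open>sub_discrete\<close>, the order discrete.\<close>

locale arith_model = numbered_model dom app cst T num
  for dom :: "ty \<Rightarrow> 'u set" and app cst T and num :: "'n::linordered_semidom \<Rightarrow> 'u" +
  assumes Z: "Z = 0" and S_Z: "S Z = 1" and add: "add = (+)" and mul: "mul = (*)" and sub: "sub = (-)"
    and sub_zero: "\<And>a b :: 'n. a \<le> b \<longleftrightarrow> a - b = 0"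

lemma countermodel_arith:
  assumes "\<not> (Th \<turnstile> HBT)"
  shows "arith_model Dom Ap Cst Th Num"
proof -
  interpret numbered_model Dom Ap Cst Th Num by (rule countermodel_nn(1)[OF assms])
  show ?thesis
    using assms
    by unfold_locales (auto simp: zero_nn_def one_nn_def plus_nn_def times_nn_def minus_nn_def ops_def
        model_ops_def less_eq_nn_def)
qed

context arith_model
begin

declare Z [simp] add [simp] mul [simp] sub [simp]

lemma S_eq [simp]: "S a = a + 1"
  using add_S[of a Z] S_Z by simp

lemma pre_eq [simp]: "pre a = a - 1"
  using sub_S[of a Z] S_Z by simp

lemma nonneg [simp]: "0 \<le> (a::'n)"
  using Z_sub[of a] by (simp add: sub_zero)

lemma discrete: "(a::'n) < b \<longleftrightarrow> a + 1 \<le> b"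
proof
  assume "a < b"
  then have "b - a \<noteq> 0" using sub_zero[of b a] by auto
  then show "a + 1 \<le> b" using sub_discrete[of b a] by (simp add: sub_zero)
next
  assume "a + 1 \<le> b"
  then show "a < b" using less_le_trans[of a "a + 1" b] by simp
qed

lemma less_add_1: "(a::'n) < b + 1 \<longleftrightarrow> a \<le> b"
  by (simp add: discrete)

lemma zero_or_pos: "(a::'n) = 0 \<or> 1 \<le> a"
  using discrete[of 0 a] by (auto simp: less_le)

lemma sub_eq_zero [simp]: "(a::'n) - b = 0 \<longleftrightarrow> a \<le> b"
  by (simp add: sub_zero)

lemma add_eq_zero [simp]: "(a::'n) + b = 0 \<longleftrightarrow> a = 0 \<and> b = 0"
  by (simp add: add_nonneg_eq_0_iff)

text \<open>A property is admissible if it is the zero set of an internal function: truncated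
  subtraction expresses an inequality, and a sum expresses a conjunction.\<close>

lemma nat_induct:
  assumes "rep F" "\<And>a. P a \<longleftrightarrow> F a = 0" "P 0" "\<And>a. P a \<Longrightarrow> P (a + 1)"
  shows "P a"
proof -
  have "F a = 0"
    by (rule rep_induct[OF assms(1) rep_const[of 0]]) (use assms in auto)
  then show ?thesis using assms(2) by blast
qed

lemma rep_plus: "rep F \<Longrightarrow> rep G \<Longrightarrow> rep (\<lambda>a. F a + G a)"
  using rep_add by simp

lemma rep_times: "rep F \<Longrightarrow> rep G \<Longrightarrow> rep (\<lambda>a. F a * G a)"
  using rep_mul by simp

lemma rep_minus: "rep F \<Longrightarrow> rep G \<Longrightarrow> rep (\<lambda>a. F a - G a)"
  using rep_sub by simp

lemma rep_app:
  assumes "fv_tm t = {}" "tyof [] t = Some T1" "\<And>a. app (evt env [] t) (num a) = num (H a)" "rep G"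
  shows "rep (\<lambda>a. H (G a))"
  using rep_comp[OF evt_dom[OF typed_env assms(2)] assms(4)] assms(3) by (simp add: fn_def)

lemmas rep_rules = rep_const rep_id rep_plus rep_times rep_minus

text \<open>The claim is existential, so it is not proved by induction itself. If no quotient
  existed, the inequality \<open>i * d \<le> a\<close> would be inductive in \<open>i\<close>; at i
  = a + 1 it contradicts 1 \<le> d.\<close>

lemma division: "0 < d \<Longrightarrow> \<exists>i. i * d \<le> a \<and> a < (i + 1) * (d::'n)"
proof (rule ccontr)
  assume d: "0 < d" and no: "\<nexists>i. i * d \<le> a \<and> a < (i + 1) * d"
  have "(a + 1) * d \<le> a"
  proof (rule nat_induct[of "\<lambda>i. i * d - a" "\<lambda>i. i * d \<le> a"])
    show "(i + 1) * d \<le> a" if "i * d \<le> a" for i using no that by (auto simp: not_less)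
  qed (auto intro!: rep_rules)
  moreover have "(a + 1) * 1 \<le> (a + 1) * d"
    using d discrete[of 0 d] by (intro mult_left_mono) auto
  ultimately have "(a + 1) * 1 \<le> a" by (rule order_trans[rotated])
  then show False by (simp add: discrete[symmetric])
qed

definition pow2 :: "'n \<Rightarrow> 'n" where
  "pow2 a = rec a 1 (evt env [] (\<^bold>\<lambda>''u''. \<^bold>\<lambda>''v''. (nv ''u'' \<^bold>+ nv ''u'')))"

lemma app_pow2 [simp]: "app (evt \<rho> bs pow2_tm) (num a) = num (pow2 a)"
proof -
  have *: "evt \<rho> bs pow2_tm = evt env [] pow2_tm" by (rule evt_const) simp_all
  show ?thesis unfolding * by (simp add: pow2_tm_def app_Rec evt_dom evt_drop pow2_def)
qed

lemma pow2_0 [simp]: "pow2 0 = 1" and pow2_S: "pow2 (a + 1) = pow2 a + pow2 a"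
  using rec_lam(2)[OF typed_env, of "nv ''u'' \<^bold>+ nv ''u''" 1 "[]" "''u''" "''v''"]
    rec_lam(3)[OF typed_env, of "nv ''u'' \<^bold>+ nv ''u''" a 1 "[]" "''u''" "''v''"]
  by (simp_all add: pow2_def)

lemma rep_pow2: "rep G \<Longrightarrow> rep (\<lambda>a. pow2 (G a))"
  by (rule rep_app[of pow2_tm]) simp_all

text \<open>This makes the powers of two unbounded among the numbers of the model, the source of the
  Archimedean property \<open>pw_small\<close>.\<close>

lemma pow2_gt: "a < pow2 a"
proof -
  have "a + 1 \<le> pow2 a"
  proof (rule nat_induct[of "\<lambda>a. a + 1 - pow2 a" "\<lambda>a. a + 1 \<le> pow2 a"])
    fix a assume le: "a + 1 \<le> pow2 a"
    have "(a + 1) + (a + 1) \<le> pow2 a + pow2 a" by (rule add_mono[OF le le])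
    moreover have "(a + 1) + 1 \<le> (a + 1) + (a + 1)" by (intro add_left_mono) simp
    ultimately show "a + 1 + 1 \<le> pow2 (a + 1)" unfolding pow2_S by (rule order_trans[rotated])
  qed (auto intro!: rep_rules rep_pow2)
  then show ?thesis by (simp add: discrete)
qed

lemma pow2_pos [simp]: "0 < pow2 a"
  by (rule le_less_trans[OF _ pow2_gt[of a]]) simp

lemma pow2_ge_1 [simp]: "1 \<le> pow2 a"
  using discrete[of 0 "pow2 a"] by simp

lemma pow2_add: "pow2 (a + b) = pow2 a * pow2 b"
proof (rule rep_induct[of "\<lambda>b. pow2 (a + b)" "\<lambda>b. pow2 a * pow2 b"])
  fix b assume IH: "pow2 (a + b) = pow2 a * pow2 b"
  have "pow2 (a + S b) = pow2 ((a + b) + 1)" by (simp only: S_eq add.assoc)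
  also have "\<dots> = pow2 a * pow2 (S b)" unfolding S_eq pow2_S IH by (rule distrib_left[symmetric])
  finally show "pow2 (a + S b) = pow2 a * pow2 (S b)" .
qed (auto intro!: rep_rules rep_pow2)

section \<open>Pairing\<close>

definition tri :: "'n \<Rightarrow> 'n" where
  "tri a = rec a 0 (evt env [] (\<^bold>\<lambda>''u''. \<^bold>\<lambda>''v''. (nv ''u'' \<^bold>+ (Succ \<cdot> nv ''v''))))"

lemma app_tri [simp]: "app (evt \<rho> bs triangle_tm) (num a) = num (tri a)"
proof -
  have *: "evt \<rho> bs triangle_tm = evt env [] triangle_tm" by (rule evt_const) simp_all
  show ?thesis unfolding * by (simp add: triangle_tm_def app_Rec evt_dom evt_drop tri_def)
qed

lemma tri_0 [simp]: "tri 0 = 0" and tri_S: "tri (a + 1) = tri a + (a + 1)"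
  using rec_lam(2)[OF typed_env, of "nv ''u'' \<^bold>+ (Succ \<cdot> nv ''v'')" 0 "[]" "''u''" "''v''"]
    rec_lam(3)[OF typed_env, of "nv ''u'' \<^bold>+ (Succ \<cdot> nv ''v'')" a 0 "[]" "''u''" "''v''"]
  by (simp_all add: tri_def)

lemma rep_tri: "rep G \<Longrightarrow> rep (\<lambda>a. tri (G a))"
  by (rule rep_app[of triangle_tm]) simp_all

text \<open>The factor after the plus sign is 1 or 0: it is 1 exactly when the triangular number of
  u + 1 is at most v + 1, that is, when the root has to grow.\<close>

abbreviation (input) root_step :: tm where
  "root_step \<equiv> nv ''u'' \<^bold>+ (Succ \<cdot> Zero \<^bold>- (triangle_tm \<cdot> (Succ \<cdot> nv ''u'') \<^bold>- (Succ \<cdot> nv ''v'')))"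

definition root :: "'n \<Rightarrow> 'n" where
  "root a = rec a 0 (evt env [] (\<^bold>\<lambda>''u''. \<^bold>\<lambda>''v''. root_step))"

lemma app_root [simp]: "app (evt \<rho> bs root_tm) (num a) = num (root a)"
proof -
  have *: "evt \<rho> bs root_tm = evt env [] root_tm" by (rule evt_const) simp_all
  show ?thesis unfolding * by (simp add: root_tm_def app_Rec evt_dom evt_drop root_def)
qed

lemma root_0 [simp]: "root 0 = 0" and root_S: "root (a + 1) = root a + (1 - (tri (root a + 1) - (a + 1)))"
  using rec_lam(2)[OF typed_env, of root_step 0 "[]" "''u''" "''v''"]
    rec_lam(3)[OF typed_env, of root_step a 0 "[]" "''u''" "''v''"]
  by (simp_all add: root_def)

lemma rep_root: "rep G \<Longrightarrow> rep (\<lambda>a. root (G a))"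
  by (rule rep_app[of root_tm]) simp_all

text \<open>Both bounds together are one equation, the vanishing of a sum of truncated differences,
  so internal induction applies. In the step the root moves exactly when the next triangular number
  is reached.\<close>

lemma root_bounds: "tri (root a) \<le> a \<and> a \<le> tri (root a) + root a"
proof (rule nat_induct[of "\<lambda>a. (tri (root a) - a) + (a - (tri (root a) + root a))"
      "\<lambda>a. tri (root a) \<le> a \<and> a \<le> tri (root a) + root a"])
  fix a
  assume IH: "tri (root a) \<le> a \<and> a \<le> tri (root a) + root a"
  show "tri (root (a + 1)) \<le> a + 1 \<and> a + 1 \<le> tri (root (a + 1)) + root (a + 1)"
  proof (cases "tri (root a + 1) \<le> a + 1")
    case True
    then have "root (a + 1) = root a + 1" using sub_eq_zero[of "tri (root a + 1)" "a + 1"] by (simp add: root_S del: sub_eq_zero)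
    moreover have "a + 1 \<le> tri (root a + 1) + (root a + 1)"
    proof -
      have "a + 1 \<le> tri (root a) + root a + 1" using IH by simp
      also have "\<dots> = tri (root a + 1)" by (simp add: tri_S add.assoc)
      also have "\<dots> \<le> tri (root a + 1) + (root a + 1)" by simp
      finally show ?thesis .
    qed
    ultimately show ?thesis using True by simp
  next
    case False
    then have "1 \<le> tri (root a + 1) - (a + 1)"
      using zero_or_pos[of "tri (root a + 1) - (a + 1)"] by simp
    then have "root (a + 1) = root a" using sub_eq_zero[of 1 "tri (root a + 1) - (a + 1)"]
      by (simp add: root_S del: sub_eq_zero)
    moreover have "a + 1 < tri (root a) + root a + 1" using False by (simp add: tri_S add.assoc not_le)
    moreover have "tri (root a) \<le> a + 1" using IH by (meson less_add_1 less_imp_le order_trans order_refl add_increasing2 zero_le_one)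
    ultimately show ?thesis by (simp add: less_add_1)
  qed
qed (auto intro!: rep_rules rep_tri rep_root)

lemma tri_mono: "a \<le> b \<Longrightarrow> tri a \<le> tri b"
proof -
  assume "a \<le> b"
  have "tri a \<le> tri (a + d)" for d
  proof (rule nat_induct[of "\<lambda>d. tri a - tri (a + d)" "\<lambda>d. tri a \<le> tri (a + d)"])
    fix d assume "tri a \<le> tri (a + d)"
    also have "\<dots> \<le> tri (a + d + 1)" by (simp add: tri_S)
    finally show "tri a \<le> tri (a + (d + 1))" by (simp add: add.assoc)
  qed (auto intro!: rep_rules rep_tri)
  from this[of "b - a"] show ?thesis using \<open>a \<le> b\<close> by (simp add: le_add_diff_inverse)
qed

lemma root_unique:
  assumes "tri r \<le> a" "a \<le> tri r + r"
  shows "root a = r"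
proof (rule antisym)
  show "root a \<le> r"
  proof (rule ccontr)
    assume "\<not> root a \<le> r"
    then have "tri (r + 1) \<le> tri (root a)" by (intro tri_mono) (simp add: not_le discrete)
    also have "\<dots> \<le> a" using root_bounds by blast
    also have "a < tri (r + 1)" using assms(2) by (simp add: tri_S add.assoc[symmetric] less_add_1)
    finally show False by simp
  qed
  show "r \<le> root a"
  proof (rule ccontr)
    assume "\<not> r \<le> root a"
    then have "tri (root a + 1) \<le> tri r" by (intro tri_mono) (simp add: not_le discrete)
    also have "\<dots> \<le> a" by (rule assms(1))
    also have "a < tri (root a + 1)" using root_bounds[of a] by (simp add: tri_S add.assoc[symmetric] less_add_1)
    finally show False by simp
  qed
qed

definition Pair :: "'n \<Rightarrow> 'n \<Rightarrow> 'n" where "Pair a b = tri (a + b) + a"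
definition Fst :: "'n \<Rightarrow> 'n" where "Fst a = a - tri (root a)"
definition Snd :: "'n \<Rightarrow> 'n" where "Snd a = root a - Fst a"

lemma root_Pair: "root (Pair a b) = a + b"
  by (rule root_unique) (auto simp: Pair_def)

lemma Fst_Pair [simp]: "Fst (Pair a b) = a"
  unfolding Fst_def root_Pair by (simp add: Pair_def)

lemma Snd_Pair [simp]: "Snd (Pair a b) = b"
  unfolding Snd_def root_Pair by simp

lemma app_pair [simp]: "app (app (evt \<rho> bs pair_tm) (num a)) (num b) = num (Pair a b)"
proof -
  have *: "evt \<rho> bs pair_tm = evt env [] pair_tm" by (rule evt_const) simp_all
  show ?thesis unfolding * by (simp add: pair_tm_def Pair_def)
qed

lemma app_fst [simp]: "app (evt \<rho> bs fst_tm) (num a) = num (Fst a)"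
proof -
  have *: "evt \<rho> bs fst_tm = evt env [] fst_tm" by (rule evt_const) simp_all
  show ?thesis unfolding * by (simp add: fst_tm_def Fst_def)
qed

lemma app_snd [simp]: "app (evt \<rho> bs snd_tm) (num a) = num (Snd a)"
proof -
  have *: "evt \<rho> bs snd_tm = evt env [] snd_tm" by (rule evt_const) simp_all
  show ?thesis unfolding * by (simp add: snd_tm_def Snd_def)
qed

end

context arith_model
begin

section \<open>Rational and real numbers of the model\<close>

definition dn :: "'n \<Rightarrow> 'n" where "dn q = Snd q + 1"

lemma dn_pos [simp]: "0 < dn q"
  unfolding dn_def by (rule add_nonneg_pos) simp_all

definition val :: "'n \<Rightarrow> 'n quotient_field" where
  "val q = (emb (Fst (Fst q)) - emb (Snd (Fst q))) / emb (dn q)"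

definition code :: "'n \<Rightarrow> 'n \<Rightarrow> 'n \<Rightarrow> 'n" where
  "code a b d = Pair (Pair a b) (d - 1)"

lemma emb_pos [simp]: "0 < emb a \<longleftrightarrow> 0 < (a::'n)"
  using emb_less[of 0 a] by (simp del: emb_less)

lemma emb_nonneg [simp]: "0 \<le> emb (a::'n)"
  using emb_le[of 0 a] by (simp del: emb_le)

lemma emb_eq_0 [simp]: "emb a = 0 \<longleftrightarrow> a = (0::'n)"
  using emb_eq[of a 0] by (simp del: emb_eq)

lemma val_code: "0 < d \<Longrightarrow> val (code a b d) = (emb a - emb b) / emb d"
proof -
  assume "0 < d"
  then have "d - 1 + 1 = d" by (intro le_add_diff_inverse2) (simp add: discrete)
  then have "emb (d - 1) + 1 = emb d" by (metis emb_add emb_1)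
  then show ?thesis by (simp add: val_def code_def dn_def)
qed

definition Qadd :: "'n \<Rightarrow> 'n \<Rightarrow> 'n" where
  "Qadd p q = code (Fst (Fst p) * dn q + Fst (Fst q) * dn p) (Snd (Fst p) * dn q + Snd (Fst q) * dn p) (dn p * dn q)"

definition Qminus :: "'n \<Rightarrow> 'n" where
  "Qminus q = code (Snd (Fst q)) (Fst (Fst q)) (dn q)"

definition Qabs :: "'n \<Rightarrow> 'n" where
  "Qabs q = code ((Fst (Fst q) - Snd (Fst q)) + (Snd (Fst q) - Fst (Fst q))) 0 (dn q)"

definition Qpow :: "'n \<Rightarrow> 'n" where
  "Qpow k = code 1 0 (pow2 k)"

lemma val_Qadd [simp]: "val (Qadd p q) = val p + val q"
proof -
  have "(x1 * d2 + x2 * d1 - (y1 * d2 + y2 * d1)) / (d1 * d2) = (x1 - y1) / d1 + (x2 - y2) / d2"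
    if "d1 \<noteq> 0" "d2 \<noteq> 0" for x1 x2 y1 y2 d1 d2 :: "'n quotient_field"
    using that by (simp add: field_simps)
  moreover have "emb (dn p) \<noteq> 0" "emb (dn q) \<noteq> 0" using dn_pos[of p] dn_pos[of q] by (simp_all del: dn_pos)
  moreover have "0 < dn p * dn q" by (intro mult_pos_pos dn_pos)
  ultimately show ?thesis 
    unfolding Qadd_def val_code[OF \<open>0 < dn p * dn q\<close>] val_def[of p] val_def[of q] emb_mult emb_add by blast
qed

lemma val_Qminus [simp]: "val (Qminus q) = - val q"
  unfolding Qminus_def val_code[OF dn_pos] val_def[of q] by (metis minus_diff_eq minus_divide_left)

lemma emb_diff_abs: "emb ((a - b) + (b - a)) = \<bar>emb a - emb (b::'n)\<bar>"
proof (cases "a \<le> b")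
  case True
  then have "a - b = 0" by simp
  then show ?thesis using True emb_diff[OF True] by simp
next
  case False
  then have "b \<le> a" "b - a = 0" by simp_all
  then show ?thesis using emb_diff[of b a] by simp
qed

lemma val_Qabs [simp]: "val (Qabs q) = \<bar>val q\<bar>"
  unfolding Qabs_def val_code[OF dn_pos] emb_diff_abs val_def[of q] by (simp add: abs_divide)

definition pw :: "'n \<Rightarrow> 'n quotient_field" where "pw k = 1 / emb (pow2 k)"

lemma val_Qpow [simp]: "val (Qpow k) = pw k"
  by (simp add: Qpow_def val_code pw_def)

lemma pw_pos [simp]: "0 < pw k"
  by (simp add: pw_def)

lemma pw_add: "pw (k + l) = pw k * pw l"
  by (simp add: pw_def pow2_add)

lemma pw_le_1 [simp]: "pw k \<le> 1"
  using emb_le[of 1 "pow2 k"] by (simp add: pw_def del: emb_le)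

lemma pw_Suc: "pw (k + 1) + pw (k + 1) = pw k"
proof -
  have "1 / (e + e) + 1 / (e + e) = 1 / e" if "e \<noteq> 0" for e :: "'n quotient_field"
    using that by (simp add: field_simps)
  then show ?thesis unfolding pw_def pow2_S emb_add using pow2_pos[of k] by (simp del: pow2_pos)
qed

lemma pw_antimono: "k \<le> l \<Longrightarrow> pw l \<le> pw k"
proof -
  assume "k \<le> l"
  then have "pw l = pw k * pw (l - k)" by (simp add: pw_add[symmetric])
  also have "\<dots> \<le> pw k * 1" by (intro mult_left_mono) (simp_all add: less_imp_le)
  finally show ?thesis by simp
qed

lemma app_qadd [simp]: "app (app (evt \<rho> bs qadd_tm) (num p)) (num q) = num (Qadd p q)"
proof -
  have *: "evt \<rho> bs qadd_tm = evt env [] qadd_tm" by (rule evt_const) simp_all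
  show ?thesis unfolding * by (simp add: qadd_tm_def Qadd_def code_def dn_def)
qed

lemma app_qminus [simp]: "app (evt \<rho> bs qminus_tm) (num q) = num (Qminus q)"
proof -
  have *: "evt \<rho> bs qminus_tm = evt env [] qminus_tm" by (rule evt_const) simp_all
  show ?thesis unfolding * by (simp add: qminus_tm_def Qminus_def code_def dn_def)
qed

lemma app_qabs [simp]: "app (evt \<rho> bs qabs_tm) (num q) = num (Qabs q)"
proof -
  have *: "evt \<rho> bs qabs_tm = evt env [] qabs_tm" by (rule evt_const) simp_all
  show ?thesis unfolding * by (simp add: qabs_tm_def Qabs_def code_def dn_def)
qed

lemma app_qpow [simp]: "app (evt \<rho> bs qpow_tm) (num k) = num (Qpow k)"
proof -
  have *: "evt \<rho> bs qpow_tm = evt env [] qpow_tm" by (rule evt_const) simp_all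
  show ?thesis unfolding * by (simp add: qpow_tm_def Qpow_def code_def)
qed

lemma evt_num: "typed \<rho> \<Longrightarrow> tyof [] s = Some TNat \<Longrightarrow> \<exists>a. evt \<rho> [] s = num a"
  using evt_dom num_cases by blast

lemma ev_le [simp]:
  assumes "typed \<rho>" "tyof [] s = Some TNat" "tyof [] t = Some TNat"
  shows "ev \<rho> [] (s \<^bold>\<le> t) \<longleftrightarrow> den (evt \<rho> [] s) \<le> den (evt \<rho> [] t)"
proof -
  obtain a b where "evt \<rho> [] s = num a" "evt \<rho> [] t = num b" using evt_num assms by blast
  then show ?thesis by (simp add: le_fm_def)
qed

lemma ev_less [simp]:
  assumes "typed \<rho>" "tyof [] s = Some TNat" "tyof [] t = Some TNat"
  shows "ev \<rho> [] (s \<^bold>< t) \<longleftrightarrow> den (evt \<rho> [] s) < den (evt \<rho> [] t)"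
proof -
  obtain a b where "evt \<rho> [] s = num a" "evt \<rho> [] t = num b" using evt_num assms by blast
  then show ?thesis by (simp add: le_fm_def less_fm_def discrete)
qed

text \<open>Cross-multiplication, with the subtracted parts moved to the other side so that only
  sums of numbers are compared, as in \<open>qle\<close>.\<close>

lemma val_le_iff:
  "val p \<le> val q \<longleftrightarrow> Fst (Fst p) * dn q + Snd (Fst q) * dn p \<le> Fst (Fst q) * dn p + Snd (Fst p) * dn q"
proof -
  have "(x1 - y1) / d1 \<le> (x2 - y2) / d2 \<longleftrightarrow> x1 * d2 + y2 * d1 \<le> x2 * d1 + y1 * d2"
    if "0 < d1" "0 < d2" for x1 x2 y1 y2 d1 d2 :: "'n quotient_field"
    using that by (simp add: field_simps)
  note frac = this
  show ?thesis
    unfolding val_def emb_le[symmetric, where 'a = 'n] emb_add emb_mult by (rule frac) simp_all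
qed

lemma val_less_iff:
  "val p < val q \<longleftrightarrow> Fst (Fst p) * dn q + Snd (Fst q) * dn p < Fst (Fst q) * dn p + Snd (Fst p) * dn q"
  by (simp only: not_le[symmetric] val_le_iff)

lemma ev_qle [simp]:
  assumes "typed \<rho>" "tyof [] s = Some TNat" "tyof [] t = Some TNat"
  shows "ev \<rho> [] (qle s t) \<longleftrightarrow> val (den (evt \<rho> [] s)) \<le> val (den (evt \<rho> [] t))"
proof -
  obtain a b where "evt \<rho> [] s = num a" "evt \<rho> [] t = num b" using evt_num assms by blast
  then show ?thesis using assms by (simp add: qle_def val_le_iff dn_def)
qed

lemma ev_qless [simp]:
  assumes "typed \<rho>" "tyof [] s = Some TNat" "tyof [] t = Some TNat"
  shows "ev \<rho> [] (qless s t) \<longleftrightarrow> val (den (evt \<rho> [] s)) < val (den (evt \<rho> [] t))"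
proof -
  obtain a b where "evt \<rho> [] s = num a" "evt \<rho> [] t = num b" using evt_num assms by blast
  then show ?thesis using assms by (simp add: qless_def val_less_iff dn_def)
qed

definition seq :: "'u \<Rightarrow> 'n \<Rightarrow> 'n quotient_field" where "seq x k = val (fn x k)"

definition isR :: "'u \<Rightarrow> bool" where
  "isR x \<longleftrightarrow> (\<forall>k l. \<bar>seq x k - seq x (k + l)\<bar> < pw k)"

definition leq :: "'u \<Rightarrow> 'u \<Rightarrow> bool" where
  "leq x y \<longleftrightarrow> (\<forall>k. seq x k \<le> seq y k + (pw k + pw k))"

lemma ev_is_real [simp]:
  assumes "typed \<rho>" "tyof [] s = Some T1" "(''k'', TNat) \<notin> fv_tm s" "(''l'', TNat) \<notin> fv_tm s"
  shows "ev \<rho> bs (is_real s) \<longleftrightarrow> isR (evt \<rho> [] s)"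
  using assms evt_dom[OF assms(1,2)]
  by (simp add: is_real_def isR_def seq_def evt_drop)

lemma ev_leR [simp]:
  assumes "typed \<rho>" "tyof [] s = Some T1" "tyof [] t = Some T1" "(''k'', TNat) \<notin> fv_tm s" "(''k'', TNat) \<notin> fv_tm t"
  shows "ev \<rho> bs (leR s t) \<longleftrightarrow> leq (evt \<rho> [] s) (evt \<rho> [] t)"
  using assms evt_dom[OF assms(1,2)] evt_dom[OF assms(1,3)]
  by (simp add: leR_def leq_def seq_def evt_drop)

lemma ev_lessR [simp]:
  assumes "typed \<rho>" "tyof [] s = Some T1" "tyof [] t = Some T1" "(''k'', TNat) \<notin> fv_tm s" "(''k'', TNat) \<notin> fv_tm t"
  shows "ev \<rho> bs (lessR s t) \<longleftrightarrow> \<not> leq (evt \<rho> [] t) (evt \<rho> [] s)"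
  using assms by (simp add: lessR_def)

definition add_real :: "'u \<Rightarrow> 'u \<Rightarrow> 'u" where "add_real x y = app (app (evt env [] addR_tm) x) y"
definition sub_real :: "'u \<Rightarrow> 'u \<Rightarrow> 'u" where "sub_real x y = app (app (evt env [] subR_tm) x) y"

lemma evt_real_ops:
  "app (app (evt \<rho> bs addR_tm) x) y = add_real x y" "app (app (evt \<rho> bs subR_tm) x) y = sub_real x y"
proof -
  have "evt \<rho> bs addR_tm = evt env [] addR_tm" "evt \<rho> bs subR_tm = evt env [] subR_tm"
    by (rule evt_const; simp)+
  then show "app (app (evt \<rho> bs addR_tm) x) y = add_real x y" "app (app (evt \<rho> bs subR_tm) x) y = sub_real x y"
    unfolding add_real_def sub_real_def by (simp_all only:)
qed

lemma seq_add_real: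
  "x \<in> dom T1 \<Longrightarrow> y \<in> dom T1 \<Longrightarrow> seq (add_real x y) k = seq x (k + 1) + seq y (k + 1)"
  by (simp add: add_real_def addR_tm_def seq_def)

lemma seq_sub_real:
  "x \<in> dom T1 \<Longrightarrow> y \<in> dom T1 \<Longrightarrow> seq (sub_real x y) k = seq x (k + 1) - seq y (k + 1)"
  by (simp add: sub_real_def subR_tm_def seq_def)

lemma seq_zero: "seq (evt \<rho> bs zeroR) k = 0"
proof -
  have *: "evt \<rho> bs zeroR = evt env [] zeroR" by (rule evt_const) simp_all
  have "fn (evt env [] zeroR) k = code 0 0 1" by (simp add: zeroR_def code_def)
  then show ?thesis unfolding * seq_def by (simp add: val_code)
qed

lemma seq_one: "seq (evt \<rho> bs oneR) k = 1"
proof -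
  have *: "evt \<rho> bs oneR = evt env [] oneR" by (rule evt_const) simp_all
  have "fn (evt env [] oneR) k = code 1 0 1" by (simp add: oneR_def code_def)
  then show ?thesis unfolding * seq_def by (simp add: val_code)
qed

definition inU :: "'u \<Rightarrow> bool" where
  "inU x \<longleftrightarrow> isR x \<and> (\<forall>k. 0 \<le> seq x k + (pw k + pw k)) \<and> (\<forall>k. seq x k \<le> 1 + (pw k + pw k))"

lemma ev_in_unit [simp]:
  assumes "typed \<rho>" "tyof [] s = Some T1" "(''k'', TNat) \<notin> fv_tm s" "(''l'', TNat) \<notin> fv_tm s"
  shows "ev \<rho> bs (in_unit s) \<longleftrightarrow> inU (evt \<rho> [] s)"
  using assms by (simp add: in_unit_def inU_def leq_def seq_zero seq_one)

text \<open>Strict inequality of reals is a negated \<open>leq\<close>, that is, a gap of more than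
  2 * 2^-k at some index k. The index k + 1 comes from the real addition and subtraction
  terms.\<close>

definition ball :: "'u \<Rightarrow> 'u \<Rightarrow> 'u \<Rightarrow> bool" where
  "ball z y r \<longleftrightarrow> (\<exists>k. seq y (k + 1) - seq r (k + 1) + (pw k + pw k) < seq z k) \<and>
    (\<exists>k. seq z k + (pw k + pw k) < seq y (k + 1) + seq r (k + 1))"

lemma ev_in_ball [simp]:
  assumes "typed \<rho>" "tyof [] z = Some T1" "tyof [] y = Some T1" "tyof [] r = Some T1"
    "(''k'', TNat) \<notin> fv_tm z" "(''k'', TNat) \<notin> fv_tm y" "(''k'', TNat) \<notin> fv_tm r"
  shows "ev \<rho> bs (in_ball z y r) \<longleftrightarrow> ball (evt \<rho> [] z) (evt \<rho> [] y) (evt \<rho> [] r)"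
  using assms evt_dom[OF assms(1,3)] evt_dom[OF assms(1,4)]
  by (simp add: in_ball_def ball_def evt_real_ops leq_def seq_add_real seq_sub_real not_le)

end

section \<open>Arithmetical comprehension, choice and induction in the model\<close>

text \<open>A measure of the logical structure alone. Opening leaves it unchanged, so induction may
  pass from a quantified formula to an instance of its body.\<close>

fun height :: "fm \<Rightarrow> nat" where
  "height (s \<^bold>= t) = 0"
| "height \<^bold>\<bottom> = 0"
| "height (\<phi> \<^bold>\<longrightarrow> \<psi>) = Suc (height \<phi> + height \<psi>)"
| "height (Forall \<sigma> \<phi>) = Suc (height \<phi>)"

lemma height_open [simp]: "height (open_fm k u \<phi>) = height \<phi>"
  by (induction \<phi> arbitrary: k) auto

lemma arithmetical_open [simp]: "arithmetical (open_fm k u \<phi>) = arithmetical \<phi>"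
  by (induction \<phi> arbitrary: k) auto

lemma arithmetical_bind [simp]: "arithmetical (bind_fm k x \<sigma> \<phi>) = arithmetical \<phi>"
  by (induction \<phi> arbitrary: k) auto

lemma arithmetical_simps [simp]:
  "arithmetical (\<^bold>\<not> \<phi>) = arithmetical \<phi>"
  "arithmetical (\<phi> \<^bold>\<and> \<psi>) \<longleftrightarrow> arithmetical \<phi> \<and> arithmetical \<psi>"
  "arithmetical (\<^bold>\<forall>x:\<sigma>. \<phi>) \<longleftrightarrow> \<sigma> = TNat \<and> arithmetical \<phi>"
  "arithmetical (\<^bold>\<exists>x:\<sigma>. \<phi>) \<longleftrightarrow> \<sigma> = TNat \<and> arithmetical \<phi>"
  by (auto simp: neg_fm_def conj_fm_def all_fm_def ex_fm_def)

lemma arithmetical_le [simp]: "arithmetical (s \<^bold>\<le> t)" "arithmetical (s \<^bold>< t)"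
  by (simp_all add: le_fm_def less_fm_def)

lemma arithmetical_real [simp]:
  "arithmetical (is_real x)" "arithmetical (leR x y)" "arithmetical (lessR x y)" "arithmetical (in_unit x)"
  by (simp_all add: is_real_def leR_def lessR_def in_unit_def qless_def qle_def)

locale full_model = arith_model dom app cst T num
  for dom :: "ty \<Rightarrow> 'u set" and app cst T and num :: "'n::linordered_semidom \<Rightarrow> 'u" +
  assumes Th: "Th \<subseteq> T"
begin

lemma Th_axiom: "\<phi> \<in> Th \<Longrightarrow> wf_fm [] \<phi> \<Longrightarrow> typed \<rho> \<Longrightarrow> ev \<rho> [] \<phi>"
  using Th by (intro valid Ax) auto

definition is_jump :: "'u \<Rightarrow> bool" where
  "is_jump E \<longleftrightarrow> E \<in> dom (T1 \<Rrightarrow> TNat) \<and> (\<forall>f\<in>dom T1. (app E f = num 0 \<or> app E f = num 1) \<and>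
    (app E f = num 0 \<longleftrightarrow> (\<exists>n. fn f n = 0)))"

definition jump :: 'u where "jump = (SOME E. is_jump E)"

lemma is_jump: "is_jump jump"
proof -
  have "ev env [] Exists2" by (rule Th_axiom) (simp_all add: Th_def ACA0w_def Exists2_def)
  then have "\<exists>E\<in>dom (T1 \<Rrightarrow> TNat). \<forall>f\<in>dom T1. (app E f = num 0 \<or> app E f = num 1) \<and>
      (app E f = num 0 \<longleftrightarrow> (\<exists>n. fn f n = 0))"
    by (simp add: Exists2_def)
  then have "\<exists>E. is_jump E" unfolding is_jump_def by blast
  then show ?thesis unfolding jump_def by (rule someI_ex)
qed

lemma jump_dom [simp]: "jump \<in> dom (T1 \<Rrightarrow> TNat)"
  using is_jump by (simp add: is_jump_def)

text \<open>\<open>jump\<close> detects zeros, and 1 - t turns a counterexample, a nonzero value of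
  \<open>t\<close>, into a zero. The outer subtraction restores the convention that 0 means
  true.\<close>

lemma char_all:
  fixes x e :: string
  assumes \<rho>: "typed \<rho>" "\<rho> (e, T1 \<Rrightarrow> TNat) = jump" and t: "tyof [] t = Some TNat"
  defines "u \<equiv> Succ \<cdot> Zero \<^bold>- Fr e (T1 \<Rrightarrow> TNat) \<cdot> (\<^bold>\<lambda>x. (Succ \<cdot> Zero \<^bold>- t))"
  shows "den (evt \<rho> [] u) = 0 \<longleftrightarrow> (\<forall>a. den (evt (\<rho>((x, TNat) := num a)) [] t) = 0)"
proof -
  let ?d = "\<lambda>a. den (evt (\<rho>((x, TNat) := num a)) [] t)"
  define g where "g = evt \<rho> [] (\<^bold>\<lambda>x. (Succ \<cdot> Zero \<^bold>- t))"
  have g: "g \<in> dom T1" unfolding g_def using \<rho> t by (intro evt_dom) simp_all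
  have "fn g a = 1 - ?d a" for a
  proof -
    obtain b where b: "evt (\<rho>((x, TNat) := num a)) [] t = num b"
      using evt_num[of "\<rho>((x, TNat) := num a)" t] \<rho> t by auto
    then have "evt (\<rho>((x, TNat) := num a)) [] (Succ \<cdot> Zero \<^bold>- t) = num (1 - ?d a)" by simp
    then show ?thesis unfolding g_def using \<rho> t by simp
  qed
  then have g0: "(\<exists>a. fn g a = 0) \<longleftrightarrow> (\<exists>a. ?d a \<noteq> 0)"
    using zero_or_pos by (metis not_le one_neq_zero le_zero_eq sub_eq_zero zero_le_one order_antisym)
  have u: "evt \<rho> [] u = app (app (evt \<rho> [] monus_tm) (num 1)) (app jump g)"
    unfolding u_def g_def using \<rho> by simp
  consider "app jump g = num 0" "\<exists>a. ?d a \<noteq> 0" | "app jump g = num 1" "\<forall>a. ?d a = 0"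
    using is_jump g g0 unfolding is_jump_def by (metis num_eq zero_neq_one)
  then show ?thesis unfolding u by cases auto
qed

text \<open>Arithmetical formulas become terms with value 0 for truth: a sum of both truncated
  differences for an equation, the product (1 - s) t for an implication, \<open>char_all\<close> for
  a quantifier. The language has no constant for the functional of \<open>Exists2\<close>, so a
  variable \<open>e\<close> stands for it.\<close>

lemma arith_char:
  assumes "arithmetical \<phi>" "wf_fm [] \<phi>"
  shows "\<exists>t. tyof [] t = Some TNat \<and>
    (\<forall>\<rho>. typed \<rho> \<longrightarrow> \<rho> (e, T1 \<Rrightarrow> TNat) = jump \<longrightarrow> (den (evt \<rho> [] t) = 0 \<longleftrightarrow> ev \<rho> [] \<phi>))"
  using assms
proof (induction "height \<phi>" arbitrary: \<phi> rule: less_induct)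
  case less
  show ?case
  proof (cases \<phi>)
    case (Eq s t)
    have "den (evt \<rho> [] ((s \<^bold>- t) \<^bold>+ (t \<^bold>- s))) = 0 \<longleftrightarrow> ev \<rho> [] \<phi>" if \<rho>: "typed \<rho>" for \<rho>
    proof -
      obtain a b where "evt \<rho> [] s = num a" "evt \<rho> [] t = num b"
        using evt_num[OF \<rho>, of s] evt_num[OF \<rho>, of t] less.prems Eq by auto
      then show ?thesis unfolding Eq by auto
    qed
    then show ?thesis
      by (intro exI[of _ "(s \<^bold>- t) \<^bold>+ (t \<^bold>- s)"]) (use less.prems Eq in simp)
  next
    case Falsum
    then show ?thesis by (intro exI[of _ "Succ \<cdot> Zero"]) simp
  next
    case (Imp \<psi> \<chi>)
    obtain s where s: "tyof [] s = Some TNat"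
      "\<And>\<rho>. typed \<rho> \<Longrightarrow> \<rho> (e, T1 \<Rrightarrow> TNat) = jump \<Longrightarrow> den (evt \<rho> [] s) = 0 \<longleftrightarrow> ev \<rho> [] \<psi>"
      using less.hyps[of \<psi>] less.prems Imp by auto
    obtain t where t: "tyof [] t = Some TNat"
      "\<And>\<rho>. typed \<rho> \<Longrightarrow> \<rho> (e, T1 \<Rrightarrow> TNat) = jump \<Longrightarrow> den (evt \<rho> [] t) = 0 \<longleftrightarrow> ev \<rho> [] \<chi>"
      using less.hyps[of \<chi>] less.prems Imp by auto
    let ?t = "(Succ \<cdot> Zero \<^bold>- s) \<^bold>* t"
    have "den (evt \<rho> [] ?t) = 0 \<longleftrightarrow> ev \<rho> [] \<phi>" if \<rho>: "typed \<rho>" "\<rho> (e, T1 \<Rrightarrow> TNat) = jump" for \<rho>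
    proof -
      obtain a b where ab: "evt \<rho> [] s = num a" "evt \<rho> [] t = num b"
        using evt_num[OF \<rho>(1)] s t by blast
      then have "den (evt \<rho> [] ?t) = 0 \<longleftrightarrow> 1 \<le> a \<or> b = 0" by simp
      also have "\<dots> \<longleftrightarrow> (a = 0 \<longrightarrow> b = 0)"
        using zero_or_pos[of a] by auto
      also have "\<dots> \<longleftrightarrow> ev \<rho> [] \<phi>" using s(2)[OF \<rho>] t(2)[OF \<rho>] ab Imp by simp
      finally show ?thesis .
    qed
    then show ?thesis by (intro exI[of _ ?t]) (use s t in simp)
  next
    case (Forall \<sigma> \<chi>)
    then have \<sigma>: "\<sigma> = TNat" using less.prems by simp
    obtain x where x: "(x, TNat) \<notin> fv \<chi>" using fresh_exists finite_fv by blast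
    define \<psi> where "\<psi> = open_fm 0 (Fr x TNat) \<chi>"
    have \<phi>: "\<phi> = (\<^bold>\<forall>x:TNat. \<psi>)" unfolding \<psi>_def all_open[OF x] by (simp add: Forall \<sigma>)
    have wf: "wf_fm [] \<psi>" unfolding \<psi>_def
      using wf_open[of "[]" TNat \<chi> "Fr x TNat"] less.prems Forall \<sigma> by simp
    obtain t where t: "tyof [] t = Some TNat"
      "\<And>\<rho>. typed \<rho> \<Longrightarrow> \<rho> (e, T1 \<Rrightarrow> TNat) = jump \<Longrightarrow> den (evt \<rho> [] t) = 0 \<longleftrightarrow> ev \<rho> [] \<psi>"
      using less.hyps[of \<psi>] less.prems Forall wf by (auto simp: \<psi>_def)
    let ?t = "Succ \<cdot> Zero \<^bold>- Fr e (T1 \<Rrightarrow> TNat) \<cdot> (\<^bold>\<lambda>x. (Succ \<cdot> Zero \<^bold>- t))"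
    have "den (evt \<rho> [] ?t) = 0 \<longleftrightarrow> ev \<rho> [] \<phi>" if \<rho>: "typed \<rho>" "\<rho> (e, T1 \<Rrightarrow> TNat) = jump" for \<rho>
    proof -
      have "den (evt (\<rho>((x, TNat) := num a)) [] t) = 0 \<longleftrightarrow> ev (\<rho>((x, TNat) := num a)) [] \<psi>" for a
        using \<rho> by (intro t(2)) simp_all
      then show ?thesis unfolding char_all[OF \<rho> t(1)] \<phi> using wf by simp
    qed
    then show ?thesis by (intro exI[of _ ?t]) (use t in simp)
  qed
qed

text \<open>The characteristic term makes the property the zero set of an internal function; the
  parameters, including \<open>jump\<close>, are supplied by the assignment.\<close>

lemma arith_induct:
  assumes \<phi>: "arithmetical \<phi>" "wf_fm [] \<phi>" and \<rho>: "typed \<rho>"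
    and zero: "ev (\<rho>((n, TNat) := num 0)) [] \<phi>"
    and step: "\<And>a. ev (\<rho>((n, TNat) := num a)) [] \<phi> \<Longrightarrow> ev (\<rho>((n, TNat) := num (a + 1))) [] \<phi>"
  shows "ev (\<rho>((n, TNat) := num a)) [] \<phi>"
proof -
  obtain e where e: "(e, T1 \<Rrightarrow> TNat) \<notin> fv \<phi>" using fresh_exists finite_fv by blast
  obtain t where t: "tyof [] t = Some TNat"
    "\<And>\<rho>. typed \<rho> \<Longrightarrow> \<rho> (e, T1 \<Rrightarrow> TNat) = jump \<Longrightarrow> den (evt \<rho> [] t) = 0 \<longleftrightarrow> ev \<rho> [] \<phi>"
    using arith_char \<phi> by blast
  let ?\<rho> = "\<rho>((e, T1 \<Rrightarrow> TNat) := jump)"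
  have ev: "ev (\<rho>((n, TNat) := num a)) [] \<phi> \<longleftrightarrow> den (evt (?\<rho>((n, TNat) := num a)) [] t) = 0" for a
  proof -
    have "ev (\<rho>((n, TNat) := num a)) [] \<phi> \<longleftrightarrow> ev (?\<rho>((n, TNat) := num a)) [] \<phi>"
      by (rule ev_cong) (use e in auto)
    also have "\<dots> \<longleftrightarrow> den (evt (?\<rho>((n, TNat) := num a)) [] t) = 0"
      using \<rho> by (intro t(2)[symmetric]) simp_all
    finally show ?thesis .
  qed
  have "rep (\<lambda>a. den (evt (?\<rho>((n, TNat) := num a)) [] t))"
    by (rule repI[of ?\<rho> t n]) (use \<rho> t in \<open>auto intro!: num_den[symmetric] evt_dom\<close>)
  then show ?thesis
    by (rule nat_induct[where P = "\<lambda>a. ev (\<rho>((n, TNat) := num a)) [] \<phi>"]) (use ev zero step in auto)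
qed

text \<open>The scheme read in the model, with its fresh function variable hidden; the assignment
  supplies the parameters of higher type.\<close>

lemma enc:
  assumes \<psi>: "arithmetical \<psi>" "wf_fm [] \<psi>" and \<rho>: "typed \<rho>" and nm: "n \<noteq> m"
    and ex: "\<And>a. \<exists>b. \<forall>f'\<in>dom T1. ev (\<rho>((n, TNat) := num a, (m, TNat) := num b, (f, T1) := f')) [] \<psi>"
  shows "\<exists>g\<in>dom T1. \<forall>a. \<forall>f'\<in>dom T1. ev (\<rho>((n, TNat) := num a, (m, TNat) := num (fn g a), (f, T1) := f')) [] \<psi>"
proof -
  define \<phi> where "\<phi> = (\<^bold>\<forall>f:T1. \<psi>)"
  have wf: "wf_fm [] \<phi>" using \<psi> by (simp add: \<phi>_def)
  obtain g where g: "(g, T1) \<notin> fv \<phi> \<union> fv \<psi> \<union> {(f, T1)}"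
    using fresh_exists[of "fv \<phi> \<union> fv \<psi> \<union> {(f, T1)}" T1] finite_fv by blast
  let ?\<theta> = "subst m TNat (fnv g \<cdot> nv n) \<phi>"
  have wf': "wf_fm [] ?\<theta>" using wf by (intro wf_subst) simp_all
  have "((\<^bold>\<forall>n:TNat. \<^bold>\<exists>m:TNat. \<phi>) \<^bold>\<longrightarrow> (\<^bold>\<exists>g:T1. \<^bold>\<forall>n:TNat. ?\<theta>)) \<in> ENCw"
    by (rule ENCw.intros[OF \<phi>_def]) (use \<psi> nm g in auto)
  then have "ev \<rho> [] ((\<^bold>\<forall>n:TNat. \<^bold>\<exists>m:TNat. \<phi>) \<^bold>\<longrightarrow> (\<^bold>\<exists>g:T1. \<^bold>\<forall>n:TNat. ?\<theta>))"
    using wf wf' \<rho> by (intro Th_axiom) (simp_all add: Th_def)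
  moreover have "ev \<rho> [] (\<^bold>\<forall>n:TNat. \<^bold>\<exists>m:TNat. \<phi>)" using ex wf \<psi>(2) by (simp add: \<phi>_def)
  ultimately have "ev \<rho> [] (\<^bold>\<exists>g:T1. \<^bold>\<forall>n:TNat. ?\<theta>)" by simp
  then obtain g' where g': "g' \<in> dom T1" "\<And>a. ev (\<rho>((g, T1) := g', (n, TNat) := num a)) [] ?\<theta>"
    using wf' by auto
  have "ev (\<rho>((n, TNat) := num a, (m, TNat) := num (fn g' a), (f, T1) := f')) [] \<psi>" if f': "f' \<in> dom T1" for a f'
  proof -
    have "ev (\<rho>((g, T1) := g', (n, TNat) := num a, (m, TNat) := num (fn g' a))) [] \<phi>"
      using g'(2)[of a] g'(1) by (simp add: ev_subst[where \<upsilon> = TNat])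
    then have "ev (\<rho>((g, T1) := g', (n, TNat) := num a, (m, TNat) := num (fn g' a), (f, T1) := f')) [] \<psi>"
      unfolding \<phi>_def using \<psi>(2) f' by simp
    moreover have "ev (\<rho>((g, T1) := g', (n, TNat) := num a, (m, TNat) := num (fn g' a), (f, T1) := f')) [] \<psi> \<longleftrightarrow>
        ev (\<rho>((n, TNat) := num a, (m, TNat) := num (fn g' a), (f, T1) := f')) [] \<psi>"
      by (rule ev_cong) (use g in auto)
    ultimately show ?thesis by blast
  qed
  then show ?thesis using g'(1) by blast
qed

lemma wf_Sigma_formula: "tyof [] t = Some TNat \<Longrightarrow> wf_fm [] (Sigma_formula t)"
  by (simp add: Sigma_formula_def)

lemma ev_Sigma_formula:
  assumes "typed \<rho>" "tyof [] t = Some TNat" "(''f'', T1) \<notin> fv_tm t"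
  shows "ev \<rho> bs (Sigma_formula t) \<longleftrightarrow>
    (\<exists>f\<in>dom T1. app (app (\<rho> (''Y'', T1 \<Rrightarrow> TNat \<Rrightarrow> TNat)) f) (evt \<rho> [] t) = num 0)"
  using assms by (simp add: Sigma_formula_def evt_drop)

text \<open>\<open>Sigma_IND\<close> covers only matrices Y(f, n) = 0. The characteristic term of an
  arithmetical matrix, abstracted over \<open>f\<close> and \<open>n\<close>, is such a
  \<open>Y\<close>.\<close>

lemma sigma_induct:
  assumes \<phi>: "arithmetical \<phi>" "wf_fm [] \<phi>" and \<rho>: "typed \<rho>"
    and zero: "\<exists>f'\<in>dom T1. ev (\<rho>((f, T1) := f', (n, TNat) := num 0)) [] \<phi>"
    and step: "\<And>a f'. f' \<in> dom T1 \<Longrightarrow> ev (\<rho>((f, T1) := f', (n, TNat) := num a)) [] \<phi> \<Longrightarrow>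
      \<exists>f'\<in>dom T1. ev (\<rho>((f, T1) := f', (n, TNat) := num (a + 1))) [] \<phi>"
  shows "\<exists>f'\<in>dom T1. ev (\<rho>((f, T1) := f', (n, TNat) := num a)) [] \<phi>"
proof -
  obtain e where e: "(e, T1 \<Rrightarrow> TNat) \<notin> fv \<phi>" using fresh_exists finite_fv by blast
  obtain t where t: "tyof [] t = Some TNat"
    "\<And>\<rho>. typed \<rho> \<Longrightarrow> \<rho> (e, T1 \<Rrightarrow> TNat) = jump \<Longrightarrow> den (evt \<rho> [] t) = 0 \<longleftrightarrow> ev \<rho> [] \<phi>"
    using arith_char \<phi> by blast
  let ?\<rho> = "\<rho>((e, T1 \<Rrightarrow> TNat) := jump)"
  define Y where "Y = evt ?\<rho> [] (lam f T1 (\<^bold>\<lambda>n. t))"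
  have Y: "Y \<in> dom (T1 \<Rrightarrow> TNat \<Rrightarrow> TNat)" unfolding Y_def using \<rho> t by (intro evt_dom) simp_all
  have ev: "app (app Y f') (num a) = num 0 \<longleftrightarrow> ev (\<rho>((f, T1) := f', (n, TNat) := num a)) [] \<phi>"
    if f': "f' \<in> dom T1" for f' a
  proof -
    let ?\<rho>' = "?\<rho>((f, T1) := f', (n, TNat) := num a)"
    have "app (app Y f') (num a) = num (den (evt ?\<rho>' [] t))"
      unfolding Y_def using \<rho> t(1) f' evt_dom[of ?\<rho>' t TNat] by (simp add: num_den fn_def)
    moreover have "den (evt ?\<rho>' [] t) = 0 \<longleftrightarrow> ev ?\<rho>' [] \<phi>" using \<rho> f' by (intro t(2)) simp_all
    moreover have "ev ?\<rho>' [] \<phi> \<longleftrightarrow> ev (\<rho>((f, T1) := f', (n, TNat) := num a)) [] \<phi>"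
      by (rule ev_cong) (use e in auto)
    ultimately show ?thesis by simp
  qed
  have wf: "wf_fm [] Sigma_IND" by (simp add: Sigma_IND_def wf_Sigma_formula)
  have Succ: "app (cst Succ) (num a) = num (a + 1)" for a by simp
  have "ev env [] Sigma_IND" by (rule Th_axiom) (simp_all add: Th_def wf)
  moreover have "ev env [] Sigma_IND \<longleftrightarrow> (\<forall>Y\<in>dom (T1 \<Rrightarrow> TNat \<Rrightarrow> TNat). (\<exists>f\<in>dom T1. app (app Y f) (num 0) = num 0) \<and>
      (\<forall>a. (\<exists>f\<in>dom T1. app (app Y f) (num a) = num 0) \<longrightarrow> (\<exists>f\<in>dom T1. app (app Y f) (num (a + 1)) = num 0)) \<longrightarrow>
      (\<forall>a. \<exists>f\<in>dom T1. app (app Y f) (num a) = num 0))"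
    by (simp add: Sigma_IND_def wf_Sigma_formula ev_Sigma_formula Succ del: app_num)
  ultimately have "\<forall>Y\<in>dom (T1 \<Rrightarrow> TNat \<Rrightarrow> TNat). (\<exists>f\<in>dom T1. app (app Y f) (num 0) = num 0) \<and>
      (\<forall>a. (\<exists>f\<in>dom T1. app (app Y f) (num a) = num 0) \<longrightarrow> (\<exists>f\<in>dom T1. app (app Y f) (num (a + 1)) = num 0)) \<longrightarrow>
      (\<forall>a. \<exists>f\<in>dom T1. app (app Y f) (num a) = num 0)"
    by (rule iffD1[rotated])
  note ind = bspec[OF this Y]
  have B: "(\<exists>f'\<in>dom T1. app (app Y f') (num a) = num 0) \<longleftrightarrow>
      (\<exists>f'\<in>dom T1. ev (\<rho>((f, T1) := f', (n, TNat) := num a)) [] \<phi>)" for a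
    by (rule bex_cong[OF refl ev])
  have "\<forall>a. (\<exists>f'\<in>dom T1. ev (\<rho>((f, T1) := f', (n, TNat) := num a)) [] \<phi>) \<longrightarrow>
      (\<exists>f'\<in>dom T1. ev (\<rho>((f, T1) := f', (n, TNat) := num (a + 1))) [] \<phi>)"
    using step by blast
  then show ?thesis using mp[OF ind[unfolded B] conjI[OF zero]] by blast
qed

end

lemma difference_cases: "\<exists>p q. x = difference_of p - difference_of q"
  by transfer auto

context full_model
begin

section \<open>Approximation in the unit interval\<close>

lemma difference_of_discrete: "0 < (x :: 'n difference) \<Longrightarrow> 1 \<le> x"
proof -
  assume "0 < x"
  obtain p q where x: "x = difference_of p - difference_of q" using difference_cases by blast
  then have "\<not> p \<le> q" using \<open>0 < x\<close> difference_of_hom(5)[of p q] by simp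
  then have "difference_of (q + 1) \<le> difference_of p"
    unfolding difference_of_hom(5) discrete[symmetric] by simp
  then show ?thesis unfolding x difference_of_hom by (simp add: algebra_simps)
qed

text \<open>The Archimedean property relative to the numbers of the model, not to the standard ones.
  Write t = a / b with positive differences; then 1 \<le> a by discreteness and b \<le> p for some
  number p of the model, and p < 2^p.\<close>

lemma pw_small: "0 < (t :: 'n quotient_field) \<Longrightarrow> \<exists>k. pw k < t"
proof -
  assume t: "0 < t"
  obtain a b where ab: "t = Fract a b" "0 < b"
  proof (cases t)
    case (Fract a b)
    then show ?thesis using that[of a b] that[of "- a" "- b"] by (cases "0 < b") auto
  qed
  then have "0 < a" using t by (simp add: zero_less_Fract_iff)
  obtain p q where "b = difference_of p - difference_of q" using difference_cases by blast
  moreover have "0 \<le> difference_of q" using difference_of_hom(5)[of 0 q] by (simp add: difference_of_hom)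
  ultimately have b: "b \<le> difference_of p" by simp
  have "0 < emb p"
  proof -
    have "0 < difference_of p" using ab b by simp
    then show ?thesis by (simp add: emb_def zero_less_Fract_iff)
  qed
  have "pw p < 1 / emb p"
    unfolding pw_def using \<open>0 < emb p\<close> pow2_gt[of p] by (intro divide_strict_left_mono mult_pos_pos) simp_all
  also have "\<dots> = Fract 1 (difference_of p)" by (simp add: emb_def One_fract_def)
  also have "\<dots> \<le> Fract a b"
  proof -
    have "1 * b \<le> a * difference_of p"
      using difference_of_discrete[OF \<open>0 < a\<close>] b ab(2) by (intro mult_mono) simp_all
    moreover have "0 < difference_of p" using ab b by simp
    ultimately show ?thesis using ab(2)
      by (simp add: mult.commute)
  qed
  finally show ?thesis using ab by blast
qed

lemma emb_pow2_pw [simp]: "emb (pow2 k) * pw k = 1" "pw k * emb (pow2 k) = 1"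
  using pow2_pos[of k] by (simp_all add: pw_def del: pow2_pos)

lemma pw_half: "pw (k + 1) = pw k / 2"
  using pw_Suc[of k] by simp

lemma pw_quarter: "pw (k + 2) = pw k / 4"
proof -
  have "k + 2 = (k + 1) + 1" by (simp add: add.assoc)
  then show ?thesis by (simp add: pw_half)
qed

text \<open>Nonnegativity makes the truncated difference in the numerator exact;
  \<open>division\<close> of 2^n times it by the denominator then gives the grid index.\<close>

lemma floor_exists:
  assumes "0 \<le> val c"
  shows "\<exists>i. emb i * pw n \<le> val c \<and> val c < (emb i + 1) * pw n"
proof -
  let ?p = "Fst (Fst c)" and ?q = "Snd (Fst c)"
  have d: "0 < emb (dn c)" by simp
  then have "emb ?q \<le> emb ?p" using assms unfolding val_def by (simp add: pos_le_divide_eq)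
  then have "emb (?p - ?q) = emb ?p - emb ?q" by (intro emb_diff) simp
  then have v: "val c * emb (dn c) = emb (?p - ?q)"
    using dn_pos[of c, THEN less_imp_neq] unfolding val_def by simp
  obtain i where i: "i * dn c \<le> (?p - ?q) * pow2 n" "(?p - ?q) * pow2 n < (i + 1) * dn c"
    using division[OF dn_pos] by blast
  have "emb i * emb (dn c) \<le> (val c * emb (dn c)) * emb (pow2 n)"
    using i(1) unfolding v emb_mult[symmetric] emb_le .
  then have "(emb i) * emb (dn c) \<le> (val c * emb (pow2 n)) * emb (dn c)" by (simp add: ac_simps)
  then have 1: "emb i \<le> val c * emb (pow2 n)" using d by (simp only: mult_le_cancel_right_pos)
  have "(val c * emb (dn c)) * emb (pow2 n) < emb (i + 1) * emb (dn c)"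
    using i(2) unfolding v emb_mult[symmetric] emb_less .
  then have "(val c * emb (pow2 n)) * emb (dn c) < (emb i + 1) * emb (dn c)" by (simp add: ac_simps)
  then have 2: "val c * emb (pow2 n) < emb i + 1" using d by (simp only: mult_less_cancel_right_pos)
  have "emb i * pw n \<le> (val c * emb (pow2 n)) * pw n" using 1 by (intro mult_right_mono) (simp_all add: less_imp_le)
  moreover have "(val c * emb (pow2 n)) * pw n < (emb i + 1) * pw n" using 2 by (intro mult_strict_right_mono) simp_all
  ultimately show ?thesis by (auto simp: mult.assoc)
qed

lemma isR_near: "isR x \<Longrightarrow> k \<le> l \<Longrightarrow> \<bar>seq x k - seq x l\<bar> < pw k"
  unfolding isR_def by (metis le_add_diff_inverse)

text \<open>All later approximations lie within one cell of the n-th, so its cell widened by one on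
  either side contains them. Approximations of a point of [0,1] may leave [0,1] slightly, so the
  first and the last index serve for values below 0 and from 1 on.\<close>

lemma interval_exists:
  assumes "inU x"
  shows "\<exists>i < pow2 n. \<forall>k. n + 2 \<le> k \<longrightarrow> (emb i - 1) * pw n \<le> seq x k \<and> seq x k \<le> (emb i + 2) * pw n"
proof -
  define v where "v = seq x n"
  have near: "\<bar>v - seq x k\<bar> < pw n" and lo: "- (pw n / 2) \<le> seq x k" and hi: "seq x k \<le> 1 + pw n / 2"
    if k: "n + 2 \<le> k" for k
  proof -
    have "n \<le> n + 2" by simp
    then have "n \<le> k" using k by (rule order_trans)
    then show "\<bar>v - seq x k\<bar> < pw n" unfolding v_def using assms by (intro isR_near) (simp_all add: inU_def)
    \<comment> \<open>From index n + 2 on, the tolerance 2 * 2^-k in the comparisons with 0 and 1 is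
      at most half a cell.\<close>
    have "pw k \<le> pw n / 4" using pw_antimono[OF k] by (simp add: pw_quarter)
    moreover have "0 \<le> seq x k + (pw k + pw k)" "seq x k \<le> 1 + (pw k + pw k)" using assms unfolding inU_def by blast+
    ultimately show "- (pw n / 2) \<le> seq x k" "seq x k \<le> 1 + pw n / 2" by linarith+
  qed
  consider "v < 0" | "1 \<le> v" | "0 \<le> v" "v < 1" by linarith
  then show ?thesis
  proof cases
    case 1
    have "(emb 0 - 1) * pw n \<le> seq x k \<and> seq x k \<le> (emb 0 + 2) * pw n" if "n + 2 \<le> k" for k
      using near[OF that] lo[OF that] 1 pw_pos[of n] unfolding emb_0 by (auto simp: abs_less_iff)
    then show ?thesis by (intro exI[of _ 0]) auto
  next
    case 2
    have P: "emb (pow2 n - 1) = emb (pow2 n) - 1" using emb_diff[of 1 "pow2 n"] by simp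
    have "(emb (pow2 n - 1) - 1) * pw n \<le> seq x k \<and> seq x k \<le> (emb (pow2 n - 1) + 2) * pw n" if "n + 2 \<le> k" for k
    proof -
      have "(emb (pow2 n - 1) - 1) * pw n = 1 - 2 * pw n" "(emb (pow2 n - 1) + 2) * pw n = 1 + pw n"
        unfolding P by (simp_all add: algebra_simps)
      then show ?thesis
        using near[OF that] hi[OF that] 2 pw_pos[of n] by (auto simp: abs_less_iff)
    qed
    moreover have "pow2 n - 1 < pow2 n"
    proof -
      have "pow2 n - 1 + 1 = pow2 n" by (intro le_add_diff_inverse2) simp
      then show ?thesis by (metis discrete order_refl)
    qed
    ultimately show ?thesis by blast
  next
    case 3
    obtain i where i: "emb i * pw n \<le> v" "v < (emb i + 1) * pw n"
      using floor_exists[of "fn x n" n] 3(1) unfolding v_def seq_def by blast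
    have "emb i * pw n < 1" using i(1) 3(2) by (rule le_less_trans)
    then have "emb i * pw n < emb (pow2 n) * pw n" by simp
    then have "i < pow2 n" using pw_pos[of n] by (simp only: mult_less_cancel_right_pos emb_less)
    moreover have "(emb i - 1) * pw n \<le> seq x k \<and> seq x k \<le> (emb i + 2) * pw n" if "n + 2 \<le> k" for k
      using near[OF that] i pw_pos[of n] by (auto simp: abs_less_iff algebra_simps)
    ultimately show ?thesis by blast
  qed
qed

text \<open>
  The interval from \<open>(i - 1) / 2\<^sup>n\<close> to \<open>(i + 2) / 2\<^sup>n\<close> is so long that, for every real of \<open>[0,1]\<close>, all late
  approximations stay in one of these intervals with \<open>i < 2\<^sup>n\<close>.
\<close>

definition captures :: "'u \<Rightarrow> 'u \<Rightarrow> 'n \<Rightarrow> 'n \<Rightarrow> bool" where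
  "captures y r n i \<longleftrightarrow>
    (\<exists>k. seq y (k + 1) - seq r (k + 1) + (pw k + pw k) < (emb i - 1) * pw n) \<and>
    (\<exists>k. (emb i + 2) * pw n + (pw k + pw k) < seq y (k + 1) + seq r (k + 1))"

text \<open>The index k + 1 halves each error, so the errors of \<open>y\<close> and
  \<open>r\<close> add up to less than 2^-k.\<close>

lemma sum_near:
  assumes "isR y" "isR r" "k \<le> l"
  shows "\<bar>(seq y (k + 1) - seq r (k + 1)) - (seq y (l + 1) - seq r (l + 1))\<bar> < pw k"
    "\<bar>(seq y (k + 1) + seq r (k + 1)) - (seq y (l + 1) + seq r (l + 1))\<bar> < pw k"
proof -
  have "k + 1 \<le> l + 1" using assms(3) by simp
  then have "\<bar>seq y (k + 1) - seq y (l + 1)\<bar> < pw (k + 1)" "\<bar>seq r (k + 1) - seq r (l + 1)\<bar> < pw (k + 1)"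
    using assms isR_near by blast+
  then show "\<bar>(seq y (k + 1) - seq r (k + 1)) - (seq y (l + 1) - seq r (l + 1))\<bar> < pw k"
    "\<bar>(seq y (k + 1) + seq r (k + 1)) - (seq y (l + 1) + seq r (l + 1))\<bar> < pw k"
    unfolding pw_half by linarith+
qed

lemma captures_ball:
  assumes y: "isR y" "isR r" and c: "captures y r n i"
    and x: "\<And>k. n + 2 \<le> k \<Longrightarrow> (emb i - 1) * pw n \<le> seq x k \<and> seq x k \<le> (emb i + 2) * pw n"
  shows "ball x y r"
proof -
  obtain k1 k2 where k1: "seq y (k1 + 1) - seq r (k1 + 1) + (pw k1 + pw k1) < (emb i - 1) * pw n"
    and k2: "(emb i + 2) * pw n + (pw k2 + pw k2) < seq y (k2 + 1) + seq r (k2 + 1)"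
    using c unfolding captures_def by blast
  \<comment> \<open>At index k + 1 + (n + 2) the bounds on \<open>x\<close> are in force and the
    tolerance of the ball is at most 2^-k. The gap 2 * 2^-k granted by \<open>captures\<close> pays
    for it and for moving the endpoint.\<close>
  have ge: "n + 2 \<le> (k + 1) + (n + 2)" "k + 1 \<le> (k + 1) + (n + 2)" "k \<le> (k + 1) + (n + 2)" for k
    by (rule add_increasing[OF nonneg order_refl], rule add_increasing2[OF nonneg order_refl],
      simp add: add.assoc)
  have "seq y (k1 + 1 + (n + 2) + 1) - seq r (k1 + 1 + (n + 2) + 1) +
      (pw (k1 + 1 + (n + 2)) + pw (k1 + 1 + (n + 2))) < seq x (k1 + 1 + (n + 2))"
    using sum_near(1)[OF y ge(3)[of k1]] k1 x[OF ge(1)[of k1]] pw_antimono[OF ge(2)[of k1]]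
    unfolding pw_half by linarith
  moreover have "seq x (k2 + 1 + (n + 2)) + (pw (k2 + 1 + (n + 2)) + pw (k2 + 1 + (n + 2))) <
      seq y (k2 + 1 + (n + 2) + 1) + seq r (k2 + 1 + (n + 2) + 1)"
    using sum_near(2)[OF y ge(3)[of k2]] k2 x[OF ge(1)[of k2]] pw_antimono[OF ge(2)[of k2]]
    unfolding pw_half by linarith
  ultimately show ?thesis unfolding ball_def by blast
qed

lemma ball_captures:
  assumes y: "isR y" "isR r" and x: "isR x" and b: "ball x y r"
  shows "\<exists>K. \<forall>n i. K \<le> n \<longrightarrow> seq x K \<le> emb i * pw n \<longrightarrow> emb i * pw n < seq x K + pw K \<longrightarrow> captures y r n i"
proof -
  obtain k1 k2 where k1: "seq y (k1 + 1) - seq r (k1 + 1) + (pw k1 + pw k1) < seq x k1"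
    and k2: "seq x k2 + (pw k2 + pw k2) < seq y (k2 + 1) + seq r (k2 + 1)"
    using b unfolding ball_def by blast
  define d1 where "d1 = seq x k1 - (seq y (k1 + 1) - seq r (k1 + 1) + (pw k1 + pw k1))"
  define d2 where "d2 = seq y (k2 + 1) + seq r (k2 + 1) - (seq x k2 + (pw k2 + pw k2))"
  have "0 < d1" "0 < d2" using k1 k2 unfolding d1_def d2_def by linarith+
  \<comment> \<open>The five comes from the upper side: one 2^-K because i / 2^n may exceed
    \<open>seq x K\<close>, two for the two cells to its right, two for the gap in
    \<open>captures\<close>. The gap already subtracted in \<open>d1\<close> and \<open>d2\<close>
    pays for moving \<open>x\<close> and the endpoint to index \<open>K\<close>.\<close>
  then have "0 < min d1 d2 / 5" by simp
  then obtain k3 where k3: "pw k3 < min d1 d2 / 5" using pw_small by blast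
  define K where "K = k1 + k2 + k3"
  have K: "k1 \<le> K" "k2 \<le> K" "k3 \<le> K" unfolding K_def by (simp_all add: add.assoc add_increasing)
  have small: "5 * pw K < d1" "5 * pw K < d2" using k3 pw_antimono[OF K(3)] by linarith+
  have "captures y r n i" if n: "K \<le> n" and i: "seq x K \<le> emb i * pw n" "emb i * pw n < seq x K + pw K" for n i
  proof -
    have "seq y (K + 1) - seq r (K + 1) + (pw K + pw K) < (emb i - 1) * pw n"
      using sum_near(1)[OF y K(1)] isR_near[OF x K(1)] small(1) i(1) pw_antimono[OF n] pw_pos[of K]
      unfolding d1_def left_diff_distrib by linarith
    moreover have "(emb i + 2) * pw n + (pw K + pw K) < seq y (K + 1) + seq r (K + 1)"
      using sum_near(2)[OF y K(2)] isR_near[OF x K(2)] small(2) i(2) pw_antimono[OF n] pw_pos[of K]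
      unfolding d2_def ring_distribs by linarith
    ultimately show ?thesis unfolding captures_def by blast
  qed
  then show ?thesis by blast
qed

end

section \<open>Cousin's lemma in the model\<close>

text \<open>The inequality is j / 2^k \<le> g(n) / 2^n multiplied out, with \<open>g\<close> and
  \<open>k\<close> left as free variables.\<close>

definition inf_fm :: "tm \<Rightarrow> fm" where
  "inf_fm j = (\<^bold>\<forall>''N'':TNat. \<^bold>\<exists>''n'':TNat. nv ''N'' \<^bold>\<le> nv ''n'' \<^bold>\<and>
    j \<^bold>* (pow2_tm \<cdot> nv ''n'') \<^bold>\<le> (fnv ''g'' \<cdot> nv ''n'') \<^bold>* (pow2_tm \<cdot> nv ''k''))"

definition const_tm :: "tm \<Rightarrow> tm \<Rightarrow> tm \<Rightarrow> tm" where
  "const_tm a b n = (\<^bold>\<lambda>''k''. qcode a b (pow2_tm \<cdot> n))"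

text \<open>The endpoint i - 1 is entered as a difference of \<open>i\<close> and 1, since truncated
  subtraction would lose its negative value at i = 0. Membership in [0,1] is included because the
  quantifiers of \<open>ENCw\<close> and \<open>Sigma_IND\<close> range over all type-1
  objects.\<close>

definition captures_fm :: "tm \<Rightarrow> tm \<Rightarrow> tm \<Rightarrow> fm" where
  "captures_fm y n i = (in_unit y \<^bold>\<and>
    lessR (subR_tm \<cdot> y \<cdot> (psi \<cdot> y)) (const_tm i (Succ \<cdot> Zero) n) \<^bold>\<and>
    lessR (const_tm (Succ \<cdot> (Succ \<cdot> i)) Zero n) (addR_tm \<cdot> y \<cdot> (psi \<cdot> y)))"

lemma inf_fm_simps [simp]:
  "arithmetical (inf_fm j)" "tyof [] j = Some TNat \<Longrightarrow> wf_fm [] (inf_fm j)"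
  by (simp_all add: inf_fm_def)

lemma const_tm_simps [simp]:
  "tyof [] a = Some TNat \<Longrightarrow> tyof [] b = Some TNat \<Longrightarrow> tyof [] n = Some TNat \<Longrightarrow> tyof [] (const_tm a b n) = Some T1"
  "fv_tm (const_tm a b n) = fv_tm a \<union> fv_tm b \<union> fv_tm n - {(''k'', TNat)}"
  by (auto simp: const_tm_def)

lemma captures_fm_simps [simp]:
  "arithmetical (captures_fm y n i)"
  "tyof [] y = Some T1 \<Longrightarrow> tyof [] n = Some TNat \<Longrightarrow> tyof [] i = Some TNat \<Longrightarrow> wf_fm [] (captures_fm y n i)"
  by (simp_all add: captures_fm_def)

context full_model
begin

definition inf_often :: "'u \<Rightarrow> 'n \<Rightarrow> 'n \<Rightarrow> bool" where
  "inf_often g k j \<longleftrightarrow> (\<forall>N. \<exists>n. N \<le> n \<and> j * pow2 n \<le> fn g n * pow2 k)"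

lemma ev_inf_fm:
  assumes "typed \<rho>" "tyof [] j = Some TNat" "(''N'', TNat) \<notin> fv_tm j" "(''n'', TNat) \<notin> fv_tm j"
    "\<rho> (''g'', T1) = g" "\<rho> (''k'', TNat) = num k" "g \<in> dom T1"
  shows "ev \<rho> bs (inf_fm j) \<longleftrightarrow> inf_often g k (den (evt \<rho> [] j))"
proof -
  obtain a where "evt \<rho> [] j = num a" using evt_num assms by blast
  then show ?thesis using assms by (simp add: inf_fm_def inf_often_def evt_drop)
qed

lemma inf_often_antimono: "inf_often g k j \<Longrightarrow> i \<le> j \<Longrightarrow> inf_often g k i"
  unfolding inf_often_def by (meson mult_right_mono nonneg order_trans)

lemma pow2_cancel: "a * pow2 l \<le> b * pow2 l \<longleftrightarrow> a \<le> b"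
  using mult_right_le_imp_le[OF _ pow2_pos] mult_right_mono[OF _ nonneg] by blast

text \<open>Refining the grid by \<open>l\<close> halvings multiplies both sides by
  \<open>pow2 l\<close>; this makes the largest indices on different grids comparable.\<close>

lemma inf_often_scale: "inf_often g (k + l) (j * pow2 l) \<longleftrightarrow> inf_often g k j"
proof -
  have "j * pow2 l * pow2 n \<le> fn g n * pow2 (k + l) \<longleftrightarrow> j * pow2 n \<le> fn g n * pow2 k" for n
  proof -
    have "j * pow2 l * pow2 n = (j * pow2 n) * pow2 l" "fn g n * pow2 (k + l) = (fn g n * pow2 k) * pow2 l"
      by (simp_all add: pow2_add ac_simps)
    then show ?thesis by (simp only: pow2_cancel)
  qed
  then show ?thesis by (simp add: inf_often_def)
qed

text \<open>The limit superior of \<open>g n / 2\<^sup>n\<close>: its \<open>k\<close>-th approximation is the largest \<open>j / 2\<^sup>k\<close> reached infinitely often.\<close>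

lemma limit_point:
  assumes g: "g \<in> dom T1" and bound: "\<And>n. fn g n < pow2 n"
  shows "\<exists>x\<in>dom T1. inU x \<and>
    (\<forall>K. \<exists>n. K \<le> n \<and> seq x K \<le> emb (fn g n) * pw n \<and> emb (fn g n) * pw n < seq x K + pw K)"
proof -
  let ?\<rho> = "env((''g'', T1) := g)"
  have inf0: "inf_often g k 0" for k
    unfolding inf_often_def by auto
  have top: "\<not> inf_often g k (pow2 k)" for k
  proof
    assume "inf_often g k (pow2 k)"
    then obtain n where "pow2 k * pow2 n \<le> fn g n * pow2 k" unfolding inf_often_def by blast
    then have "pow2 n * pow2 k \<le> fn g n * pow2 k" by (simp add: mult.commute)
    then have "pow2 n \<le> fn g n" by (simp only: pow2_cancel)
    then show False using bound[of n] by simp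
  qed
  have "\<exists>j. inf_often g k j \<and> \<not> inf_often g k (j + 1)" for k
  proof (rule ccontr)
    assume no: "\<nexists>j. inf_often g k j \<and> \<not> inf_often g k (j + 1)"
    let ?\<rho>' = "?\<rho>((''k'', TNat) := num k)"
    have ev: "ev (?\<rho>'((''j'', TNat) := num j)) [] (inf_fm (nv ''j'')) \<longleftrightarrow> inf_often g k j" for j
      using ev_inf_fm[of "?\<rho>'((''j'', TNat) := num j)" "nv ''j''" g k] g by simp
    \<comment> \<open>Without a largest \<open>j\<close> the property would be inductive and reach
      \<open>pow2 k\<close>, contradicting \<open>top\<close>. It is arithmetical but not
      quantifier-free, hence \<open>arith_induct\<close>.\<close>
    have "ev (?\<rho>'((''j'', TNat) := num (pow2 k))) [] (inf_fm (nv ''j''))"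
      by (rule arith_induct) (use no inf0 g in \<open>simp_all add: ev\<close>)
    then show False using ev top by blast
  qed
  note ex = this
  \<comment> \<open>The function variable demanded by ENC does not occur here: with a dummy
    quantifier, ENC acts as arithmetical choice and collects the largest \<open>j\<close> for each
    \<open>k\<close> into one function.\<close>
  let ?\<psi> = "inf_fm (nv ''j'') \<^bold>\<and> \<^bold>\<not> inf_fm (Succ \<cdot> nv ''j'')"
  have ev: "ev (?\<rho>((''k'', TNat) := num k, (''j'', TNat) := num j, (''f'', T1) := f)) [] ?\<psi> \<longleftrightarrow>
      inf_often g k j \<and> \<not> inf_often g k (j + 1)" if "f \<in> dom T1" for k j f
    using ev_inf_fm[of "?\<rho>((''k'', TNat) := num k, (''j'', TNat) := num j, (''f'', T1) := f)" "nv ''j''" g k]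
      ev_inf_fm[of "?\<rho>((''k'', TNat) := num k, (''j'', TNat) := num j, (''f'', T1) := f)" "Succ \<cdot> nv ''j''" g k]
      g that by simp
  have "\<exists>h\<in>dom T1. \<forall>k. \<forall>f\<in>dom T1.
      ev (?\<rho>((''k'', TNat) := num k, (''j'', TNat) := num (fn h k), (''f'', T1) := f)) [] ?\<psi>"
  proof (rule enc)
    fix k
    obtain j where "inf_often g k j \<and> \<not> inf_often g k (j + 1)" using ex by blast
    then have "\<forall>f\<in>dom T1. ev (?\<rho>((''k'', TNat) := num k, (''j'', TNat) := num j, (''f'', T1) := f)) [] ?\<psi>"
      using ev by blast
    then show "\<exists>j. \<forall>f\<in>dom T1. ev (?\<rho>((''k'', TNat) := num k, (''j'', TNat) := num j, (''f'', T1) := f)) [] ?\<psi>"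
      by blast
  qed (use g in simp_all)
  then obtain h where h: "h \<in> dom T1" and inf: "\<And>k. inf_often g k (fn h k)" "\<And>k. \<not> inf_often g k (fn h k + 1)"
    using ev g by blast
  define x where "x = evt (env((''h'', T1) := h)) [] (\<^bold>\<lambda>''k''. qcode (fnv ''h'' \<cdot> nv ''k'') Zero (pow2_tm \<cdot> nv ''k''))"
  have x: "x \<in> dom T1" unfolding x_def using h by (intro evt_dom) simp_all
  have "fn x k = code (fn h k) 0 (pow2 k)" for k unfolding x_def using h by (simp add: code_def)
  then have seq: "seq x k = emb (fn h k) * pw k" for k by (simp add: seq_def val_code pw_def)
  have "isR x"
    unfolding isR_def
  proof (intro allI)
    fix k l
    \<comment> \<open>On the grid finer by \<open>l\<close> halvings the largest index lies between
      \<open>fn h k * pow2 l\<close>, included, and \<open>(fn h k + 1) * pow2 l\<close>, excluded.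
      This is the required rate of convergence.\<close>
    have "fn h k * pow2 l \<le> fn h (k + l)"
    proof (rule ccontr)
      assume "\<not> ?thesis"
      then have "fn h (k + l) + 1 \<le> fn h k * pow2 l" by (simp add: not_le discrete)
      moreover have "inf_often g (k + l) (fn h k * pow2 l)" unfolding inf_often_scale by (rule inf(1))
      ultimately show False using inf(2) inf_often_antimono by blast
    qed
    then have "emb (fn h k) * emb (pow2 l) \<le> emb (fn h (k + l))" unfolding emb_mult[symmetric] emb_le .
    then have "(emb (fn h k) * emb (pow2 l)) * pw (k + l) \<le> emb (fn h (k + l)) * pw (k + l)"
      by (intro mult_right_mono) (simp_all add: less_imp_le)
    then have 1: "seq x k \<le> seq x (k + l)" unfolding seq by (simp add: pw_add mult.assoc mult.left_commute[of "emb (pow2 l)"])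
    have "fn h (k + l) < (fn h k + 1) * pow2 l"
    proof (rule ccontr)
      assume "\<not> ?thesis"
      then have "(fn h k + 1) * pow2 l \<le> fn h (k + l)" by simp
      then have "inf_often g (k + l) ((fn h k + 1) * pow2 l)" using inf(1) inf_often_antimono by blast
      then show False using inf(2) unfolding inf_often_scale by blast
    qed
    then have "emb (fn h (k + l)) < emb (fn h k + 1) * emb (pow2 l)" unfolding emb_mult[symmetric] emb_less .
    then have "emb (fn h (k + l)) * pw (k + l) < (emb (fn h k + 1) * emb (pow2 l)) * pw (k + l)"
      by (intro mult_strict_right_mono) simp_all
    then have 2: "seq x (k + l) < seq x k + pw k"
      unfolding seq by (simp add: pw_add mult.assoc mult.left_commute[of "emb (pow2 l)"] ring_distribs)
    show "\<bar>seq x k - seq x (k + l)\<bar> < pw k" using 1 2 by linarith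
  qed
  moreover have "0 \<le> seq x k" for k unfolding seq by (intro mult_nonneg_nonneg) (simp_all add: less_imp_le)
  moreover have "seq x k \<le> 1" for k
  proof -
    have "fn h k \<le> pow2 k"
    proof (rule ccontr)
      assume "\<not> ?thesis"
      then show False using top[of k] inf(1)[of k] inf_often_antimono[of g k "fn h k" "pow2 k"] by simp
    qed
    then have "emb (fn h k) * pw k \<le> emb (pow2 k) * pw k"
      by (intro mult_right_mono) (simp_all add: less_imp_le)
    then show ?thesis unfolding seq by simp
  qed
  ultimately have "inU x"
    unfolding inU_def by (auto intro!: add_nonneg_nonneg add_increasing2 simp: less_imp_le)
  moreover have "\<exists>n. K \<le> n \<and> seq x K \<le> emb (fn g n) * pw n \<and> emb (fn g n) * pw n < seq x K + pw K" for K
  proof -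
    \<comment> \<open>From \<open>N\<close> on the sequence stays below the next grid point, while
      the current grid point is still reached at some index past both \<open>N\<close> and
      \<open>K\<close>.\<close>
    obtain N where "\<forall>n. \<not> (N \<le> n \<and> (fn h K + 1) * pow2 n \<le> fn g n * pow2 K)"
      using inf(2)[of K] unfolding inf_often_def by blast
    then have N: "fn g n * pow2 K < (fn h K + 1) * pow2 n" if "N \<le> n" for n using that not_le by blast
    obtain n where n: "N + K \<le> n" "fn h K * pow2 n \<le> fn g n * pow2 K"
      using inf(1)[of K] unfolding inf_often_def by blast
    have "N \<le> n" "K \<le> n" using n(1) order_trans[of _ "N + K" n] by simp_all
    have "emb (fn h K) * emb (pow2 n) \<le> emb (fn g n) * emb (pow2 K)"
      using n(2) unfolding emb_mult[symmetric] emb_le .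
    then have "(emb (fn h K) * emb (pow2 n)) * (pw n * pw K) \<le> (emb (fn g n) * emb (pow2 K)) * (pw n * pw K)"
      by (intro mult_right_mono) (simp_all add: less_imp_le)
    moreover have "(emb (fn h K) * emb (pow2 n)) * (pw n * pw K) = emb (fn h K) * pw K * (emb (pow2 n) * pw n)"
      "(emb (fn g n) * emb (pow2 K)) * (pw n * pw K) = emb (fn g n) * pw n * (emb (pow2 K) * pw K)"
      by (simp_all only: ac_simps)
    ultimately have 1: "seq x K \<le> emb (fn g n) * pw n" unfolding seq by simp
    have "emb (fn g n) * emb (pow2 K) < emb (fn h K + 1) * emb (pow2 n)"
      using N[OF \<open>N \<le> n\<close>] unfolding emb_mult[symmetric] emb_less .
    then have "(emb (fn g n) * emb (pow2 K)) * (pw n * pw K) < (emb (fn h K + 1) * emb (pow2 n)) * (pw n * pw K)"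
      by (intro mult_strict_right_mono mult_pos_pos) simp_all
    moreover have "(emb (fn h K + 1) * emb (pow2 n)) * (pw n * pw K) = emb (fn h K + 1) * pw K * (emb (pow2 n) * pw n)"
      "(emb (fn g n) * emb (pow2 K)) * (pw n * pw K) = emb (fn g n) * pw n * (emb (pow2 K) * pw K)"
      by (simp_all only: ac_simps)
    ultimately have 2: "emb (fn g n) * pw n < seq x K + pw K" unfolding seq by (simp add: ring_distribs)
    show ?thesis using 1 2 \<open>K \<le> n\<close> by blast
  qed
  ultimately show ?thesis using x by blast
qed

section \<open>Capturing as an arithmetical formula, and finite families of points\<close>

lemma seq_const_tm:
  assumes "typed \<rho>" "tyof [] a = Some TNat" "tyof [] b = Some TNat" "tyof [] n = Some TNat"
    "(''k'', TNat) \<notin> fv_tm a \<union> fv_tm b \<union> fv_tm n"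
  shows "seq (evt \<rho> [] (const_tm a b n)) l =
    (emb (den (evt \<rho> [] a)) - emb (den (evt \<rho> [] b))) * pw (den (evt \<rho> [] n))"
proof -
  obtain a' b' n' where "evt \<rho> [] a = num a'" "evt \<rho> [] b = num b'" "evt \<rho> [] n = num n'"
    using evt_num[OF assms(1)] assms(2-4) by meson
  moreover from this have "fn (evt \<rho> [] (const_tm a b n)) l = code a' b' (pow2 n')"
    using assms by (simp add: const_tm_def evt_drop code_def)
  ultimately show ?thesis by (simp add: seq_def val_code pw_def)
qed

lemma psi_dom: "typed \<rho> \<Longrightarrow> y \<in> dom T1 \<Longrightarrow> app (\<rho> (''psi'', T1 \<Rrightarrow> T1)) y \<in> dom T1"
  by (rule app_dom[of _ T1]) (simp add: typed_def)

lemma ev_captures_fm: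
  assumes "typed \<rho>" "tyof [] y = Some T1" "tyof [] n = Some TNat" "tyof [] i = Some TNat"
    and "(''k'', TNat) \<notin> fv_tm y \<union> fv_tm n \<union> fv_tm i" "(''l'', TNat) \<notin> fv_tm y"
  shows "ev \<rho> bs (captures_fm y n i) \<longleftrightarrow> inU (evt \<rho> [] y) \<and>
    captures (evt \<rho> [] y) (app (\<rho> (''psi'', T1 \<Rrightarrow> T1)) (evt \<rho> [] y)) (den (evt \<rho> [] n)) (den (evt \<rho> [] i))"
proof -
  obtain n' i' where ni: "evt \<rho> [] n = num n'" "evt \<rho> [] i = num i'"
    using evt_num[OF assms(1)] assms(3,4) by meson
  have y: "evt \<rho> [] y \<in> dom T1" using assms by (intro evt_dom)
  have r: "app (\<rho> (''psi'', T1 \<Rrightarrow> T1)) (evt \<rho> [] y) \<in> dom T1" using assms(1) y by (rule psi_dom)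
  have "seq (evt \<rho> [] (const_tm i (Succ \<cdot> Zero) n)) l = (emb i' - 1) * pw n'"
    "seq (evt \<rho> [] (const_tm (Succ \<cdot> (Succ \<cdot> i)) Zero n)) l = (emb i' + 2) * pw n'" for l
    using assms ni by (simp_all add: seq_const_tm)
  then show ?thesis
    using assms y r ni
    by (simp add: captures_fm_def captures_def evt_real_ops leq_def seq_add_real seq_sub_real not_le del: app_num)
qed

text \<open>\<open>Sigma_IND\<close> quantifies over one type-1 object, so a family of points is
  coded in a single \<open>f\<close> by pairing, each point being recovered by a term.\<close>

abbreviation row_tm :: tm where
  "row_tm \<equiv> \<^bold>\<lambda>''j''. (fnv ''f'' \<cdot> (pair_tm \<cdot> nv ''i'' \<cdot> nv ''j''))"

definition row :: "'u \<Rightarrow> 'n \<Rightarrow> 'u" where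
  "row f i = evt (env((''f'', T1) := f, (''i'', TNat) := num i)) [] row_tm"

lemma row_dom [simp]: "f \<in> dom T1 \<Longrightarrow> row f i \<in> dom T1"
  unfolding row_def by (intro evt_dom) simp_all

lemma fn_row [simp]: "f \<in> dom T1 \<Longrightarrow> fn (row f i) j = fn f (Pair i j)"
  by (simp add: row_def)

lemma evt_row: "\<rho> (''f'', T1) = f \<Longrightarrow> \<rho> (''i'', TNat) = num i \<Longrightarrow> evt \<rho> [] row_tm = row f i"
  unfolding row_def by (rule evt_cong) auto

lemma row_update_exists:
  assumes f: "f \<in> dom T1" and y: "y \<in> dom T1"
  shows "\<exists>f'\<in>dom T1. row f' a = y \<and> (\<forall>i. i \<noteq> a \<longrightarrow> row f' i = row f i)"
proof -
  let ?\<rho> = "env((''f'', T1) := f, (''y'', T1) := y, (''a'', TNat) := num a)"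
  let ?h = "\<^bold>\<lambda>''u''. \<^bold>\<lambda>''v''. (fnv ''f'' \<cdot> nv ''p'')"
  \<comment> \<open>Definition by cases as a recursion along the distance between the first
    component of \<open>p\<close> and \<open>a\<close>: at 0 it returns the new row, and at a
    successor the step function ignores the previous value and returns the old entry.\<close>
  define t where "t = Rec \<cdot> ((fst_tm \<cdot> nv ''p'' \<^bold>- nv ''a'') \<^bold>+ (nv ''a'' \<^bold>- fst_tm \<cdot> nv ''p'')) \<cdot>
    (fnv ''y'' \<cdot> (snd_tm \<cdot> nv ''p'')) \<cdot> ?h"
  define f' where "f' = evt ?\<rho> [] (\<^bold>\<lambda>''p''. t)"
  have t: "tyof [] t = Some TNat" by (simp add: t_def)
  have f': "f' \<in> dom T1" unfolding f'_def using f y t by (intro evt_dom) simp_all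
  have val: "fn f' p = (if Fst p = a then fn y (Snd p) else fn f p)" for p
  proof -
    let ?\<rho>' = "?\<rho>((''p'', TNat) := num p)"
    let ?c = "(Fst p - a) + (a - Fst p)"
    let ?H = "evt ?\<rho>' [] ?h"
    have H: "?H \<in> dom (TNat \<Rrightarrow> T1)" using f y by (intro evt_dom) simp_all
    have "fn f' p = rec ?c (fn y (Snd p)) ?H"
      unfolding f'_def using f y t H by (simp add: t_def app_Rec)
    also have "\<dots> = (if Fst p = a then fn y (Snd p) else fn f p)"
    proof (cases "Fst p = a")
      case True
      then show ?thesis using rec_Z[OF H] by simp
    next
      case False
      then have "?c \<noteq> 0" by auto
      then obtain m where "?c = S m" using zero_or_S[of ?c] by auto
      then show ?thesis using False rec_S[OF H, of m] f y by simp
    qed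
    finally show ?thesis .
  qed
  have "row f' a = y" by (rule fn_ext) (use f y f' val in simp_all)
  moreover have "row f' i = row f i" if "i \<noteq> a" for i by (rule fn_ext) (use f y f' val that in simp_all)
  ultimately show ?thesis using f' by blast
qed

text \<open>The number of choices may be nonstandard, so they cannot be made externally; the code is
  extended one row at a time under \<open>Sigma_IND\<close>.\<close>

lemma finite_choice:
  assumes P: "P \<in> dom (T1 \<Rrightarrow> T1)"
    and ex: "\<And>i. i < pow2 n \<Longrightarrow> \<exists>y\<in>dom T1. inU y \<and> captures y (app P y) n i"
  shows "\<exists>f\<in>dom T1. \<forall>i < pow2 n. inU (row f i) \<and> captures (row f i) (app P (row f i)) n i"
proof -
  let ?\<rho> = "env((''psi'', T1 \<Rrightarrow> T1) := P, (''n'', TNat) := num n)"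
  \<comment> \<open>Induction demands a step for every \<open>m\<close>. The extra bound 2^n makes
    it trivial from there on: the code is simply kept.\<close>
  let ?\<phi> = "\<^bold>\<forall>''i'':TNat. nv ''i'' \<^bold>< nv ''m'' \<^bold>\<and> nv ''i'' \<^bold>< pow2_tm \<cdot> nv ''n'' \<^bold>\<longrightarrow>
    captures_fm row_tm (nv ''n'') (nv ''i'')"
  let ?good = "\<lambda>f i. inU (row f i) \<and> captures (row f i) (app P (row f i)) n i"
  have ev: "ev (?\<rho>((''f'', T1) := f, (''m'', TNat) := num m)) [] ?\<phi> \<longleftrightarrow> (\<forall>i. i < m \<and> i < pow2 n \<longrightarrow> ?good f i)"
    if "f \<in> dom T1" for f m
    using P that by (simp add: ev_captures_fm evt_row)
  have "\<exists>f\<in>dom T1. ev (?\<rho>((''f'', T1) := f, (''m'', TNat) := num (pow2 n))) [] ?\<phi>"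
  proof (rule sigma_induct)
    show "\<exists>f\<in>dom T1. ev (?\<rho>((''f'', T1) := f, (''m'', TNat) := num 0)) [] ?\<phi>"
    proof (rule bexI)
      have "\<not> i < 0" for i :: 'n using nonneg[of i] by (simp only: not_less)
      \<comment> \<open>No row is constrained yet, so any type-1 object serves; the successor
        function is at hand.\<close>
      then show "ev (?\<rho>((''f'', T1) := cst Succ, (''m'', TNat) := num 0)) [] ?\<phi>"
        unfolding ev[OF cst_dom_simps(2)] by blast
    qed simp
  next
    fix a f assume f: "f \<in> dom T1" and "ev (?\<rho>((''f'', T1) := f, (''m'', TNat) := num a)) [] ?\<phi>"
    then have IH: "\<forall>i. i < a \<and> i < pow2 n \<longrightarrow> ?good f i" using ev by blast
    have "\<exists>f'\<in>dom T1. \<forall>i. i < a + 1 \<and> i < pow2 n \<longrightarrow> ?good f' i"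
    proof (cases "a < pow2 n")
      case True
      then obtain y where y: "y \<in> dom T1" "inU y" "captures y (app P y) n a" using ex by blast
      obtain f' where f': "f' \<in> dom T1" "row f' a = y" "\<And>i. i \<noteq> a \<Longrightarrow> row f' i = row f i"
        using row_update_exists[OF f y(1)] by blast
      have "?good f' i" if "i < a + 1" "i < pow2 n" for i
      proof (cases "i = a")
        case False
        then have "i < a" using \<open>i < a + 1\<close> by (simp add: less_add_1)
        then show ?thesis using IH f'(3)[OF False] \<open>i < pow2 n\<close> by simp
      qed (use y f' in simp)
      then show ?thesis using f'(1) by blast
    next
      case False
      then have "?good f i" if "i < pow2 n" for i using IH that by (meson less_le_trans not_le)
      then show ?thesis using f by blast
    qed
    then show "\<exists>f'\<in>dom T1. ev (?\<rho>((''f'', T1) := f', (''m'', TNat) := num (a + 1))) [] ?\<phi>"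
      using ev by blast
  qed (use P in simp_all)
  then show ?thesis using ev by blast
qed

theorem cousin:
  assumes P: "P \<in> dom (T1 \<Rrightarrow> T1)"
    and real: "\<And>y. y \<in> dom T1 \<Longrightarrow> inU y \<Longrightarrow> isR (app P y)"
    and cover: "\<And>x. x \<in> dom T1 \<Longrightarrow> inU x \<Longrightarrow> \<exists>y\<in>dom T1. inU y \<and> ball x y (app P y)"
  shows "\<exists>pts\<in>dom (TNat \<Rrightarrow> T1). \<exists>m. (\<forall>i\<le>m. inU (app pts (num i))) \<and>
    (\<forall>x\<in>dom T1. inU x \<longrightarrow> (\<exists>i\<le>m. ball x (app pts (num i)) (app P (app pts (num i)))))"
proof (cases "\<exists>n. \<forall>i < pow2 n. \<exists>y\<in>dom T1. inU y \<and> captures y (app P y) n i")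
  case True
  then obtain n f where f: "f \<in> dom T1" "\<And>i. i < pow2 n \<Longrightarrow> inU (row f i) \<and> captures (row f i) (app P (row f i)) n i"
    using finite_choice[OF P] by blast
  define pts where "pts = evt (env((''f'', T1) := f)) [] (\<^bold>\<lambda>''i''. row_tm)"
  have pts: "pts \<in> dom (TNat \<Rrightarrow> T1)" unfolding pts_def using f(1) by (intro evt_dom) simp_all
  have app_pts: "app pts (num i) = row f i" for i unfolding pts_def row_def using f(1) by simp
  \<comment> \<open>\<open>HBT\<close> counts its points up to and including m, so 2^n points mean m
    = 2^n - 1.\<close>
  have "pow2 n - 1 + 1 = pow2 n" by (intro le_add_diff_inverse2) simp
  then have le: "i \<le> pow2 n - 1 \<longleftrightarrow> i < pow2 n" for i using less_add_1[of i "pow2 n - 1"] by simp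
  have "\<exists>i < pow2 n. ball x (row f i) (app P (row f i))" if x: "x \<in> dom T1" "inU x" for x
  proof -
    obtain i where i: "i < pow2 n" "\<And>k. n + 2 \<le> k \<Longrightarrow> (emb i - 1) * pw n \<le> seq x k \<and> seq x k \<le> (emb i + 2) * pw n"
      using interval_exists[OF x(2), of n] by blast
    have "ball x (row f i) (app P (row f i))"
      by (rule captures_ball[of _ _ n i]) (use f i real in \<open>auto simp: inU_def\<close>)
    then show ?thesis using i(1) by blast
  qed
  then show ?thesis using pts f by (intro bexI[of _ pts] exI[of _ "pow2 n - 1"]) (auto simp: app_pts le)
next
  case False
  let ?\<rho> = "env((''psi'', T1 \<Rrightarrow> T1) := P)"
  \<comment> \<open>The second conjunct, quantified over \<open>f\<close>, says that no point
    captures (n, i): one universal type-1 quantifier in front of an arithmetical matrix with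
    \<open>psi\<close> as parameter.\<close>
  let ?\<psi> = "nv ''i'' \<^bold>< pow2_tm \<cdot> nv ''n'' \<^bold>\<and> \<^bold>\<not> captures_fm (fnv ''f'') (nv ''n'') (nv ''i'')"
  have ev: "ev (?\<rho>((''n'', TNat) := num n, (''i'', TNat) := num i, (''f'', T1) := f)) [] ?\<psi> \<longleftrightarrow>
      i < pow2 n \<and> \<not> (inU f \<and> captures f (app P f) n i)" if "f \<in> dom T1" for n i f
    using P that by (simp add: ev_captures_fm)
  have "\<exists>g\<in>dom T1. \<forall>n. \<forall>f\<in>dom T1.
      ev (?\<rho>((''n'', TNat) := num n, (''i'', TNat) := num (fn g n), (''f'', T1) := f)) [] ?\<psi>"
  proof (rule enc)
    fix n
    obtain i where i: "i < pow2 n" "\<And>y. y \<in> dom T1 \<Longrightarrow> \<not> (inU y \<and> captures y (app P y) n i)" using False by blast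
    then have "\<forall>f\<in>dom T1. ev (?\<rho>((''n'', TNat) := num n, (''i'', TNat) := num i, (''f'', T1) := f)) [] ?\<psi>"
      using ev by blast
    then show "\<exists>i. \<forall>f\<in>dom T1. ev (?\<rho>((''n'', TNat) := num n, (''i'', TNat) := num i, (''f'', T1) := f)) [] ?\<psi>"
      by blast
  qed (use P in simp_all)
  then obtain g where g: "g \<in> dom T1"
    and gi: "\<And>n f. f \<in> dom T1 \<Longrightarrow> fn g n < pow2 n \<and> \<not> (inU f \<and> captures f (app P f) n (fn g n))"
    using ev by blast
  obtain x where x: "x \<in> dom T1" "inU x"
    and near: "\<And>K. \<exists>n. K \<le> n \<and> seq x K \<le> emb (fn g n) * pw n \<and> emb (fn g n) * pw n < seq x K + pw K"
    \<comment> \<open>The bound on \<open>fn g n\<close> was obtained under a quantifier over type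
      1; \<open>g\<close> itself is a convenient instance.\<close>
    using limit_point[OF g] gi[OF g] by blast
  obtain y where y: "y \<in> dom T1" "inU y" "ball x y (app P y)" using cover x by blast
  have "\<exists>K. \<forall>n i. K \<le> n \<longrightarrow> seq x K \<le> emb i * pw n \<longrightarrow> emb i * pw n < seq x K + pw K \<longrightarrow>
      captures y (app P y) n i"
    by (rule ball_captures) (use x y real in \<open>auto simp: inU_def\<close>)
  \<comment> \<open>At the threshold \<open>K\<close> of the ball, \<open>near\<close> supplies an
    \<open>n\<close> past \<open>K\<close> with g(n) / 2^n at most 2^-K above
    \<open>seq x K\<close>.\<close>
  then obtain n where n: "captures y (app P y) n (fn g n)" using near by blast
  have False using gi[OF y(1), of n] y(2) n by simp
  then show ?thesis ..
qed

lemma HBT_holds: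
  assumes \<rho>: "typed \<rho>"
  shows "ev \<rho> [] HBT"
proof -
  have app_T1: "\<And>P x. P \<in> dom (T1 \<Rrightarrow> T1) \<Longrightarrow> x \<in> dom T1 \<Longrightarrow> app P x \<in> dom T1"
    "\<And>p i. p \<in> dom (TNat \<Rrightarrow> T1) \<Longrightarrow> app p (num i) \<in> dom T1"
    by (erule app_dom, assumption) (erule app_dom, rule num_dom)
  have psi_real: "\<forall>x\<in>dom T1. inU x \<longrightarrow> isR (app P x)"
    if "P \<in> dom (T1 \<Rrightarrow> T1)" "ev (\<rho>((''psi'', T1 \<Rrightarrow> T1) := P)) [] psi_is_function" for P
    using that \<rho> by (simp add: psi_is_function_def)
  show ?thesis
    unfolding HBT_def
    using \<rho> cousin psi_real by (simp add: app_T1)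
qed

end

theorem theorem3p3:
  shows "ACA0w \<union> {Sigma_IND} \<union> ENCw \<turnstile> HBT"
proof (rule ccontr)
  assume "\<not> ?thesis"
  then have unprov: "\<not> (Th \<turnstile> HBT)" by (simp add: Th_def)
  \<comment> \<open>The type \<open>nn\<close> is known to carry the arithmetic of the countermodel
    only if \<open>HBT\<close> is underivable, so this assumption must precede the
    interpretation.\<close>
  then interpret arith_model Dom Ap Cst Th Num by (rule countermodel_arith)
  interpret full_model Dom Ap Cst Th Num by unfold_locales simp
  show False using countermodel_nn(2)[OF unprov] HBT_holds by blast
qed

end
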